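(* There exist universal constants $C,c>0$ such that the following holds. Assume that $\boldsymbol{A}\in\mathbb{H}^{m\times d}$ is a standard Gaussian random matrix, where $\mathbb{H}=\mathbb{R}$ or $\mathbb{C}$. For any $0<\delta<0.4$, if $m\geq C\log(1/\delta)\,\delta^{-2}d$, then with probability at least $1-2\exp(-c\delta^2 m)$, $$\beta_0^{\mathbb{H}}\leq\beta_{\boldsymbol{A}}\leq\beta_0^{\mathbb{H}}+\delta,$$ where $\beta_0^{\mathbb{R}}=\sqrt{\frac{\pi}{\pi-2}}\approx 1.659$ and $\beta_0^{\mathbb{C}}=\sqrt{\frac{4}{4-\pi}}\approx 2.159$.
   Context: A standard Gaussian random matrix in $\mathbb{H}^{m\times d}$ is one whose rows are i.i.d. standard Gaussian random vectors, i.e. distributed as $\mathcal{N}(\boldsymbol{0},\boldsymbol{I})$ if $\mathbb{H}=\mathbb{R}$, and as $\mathcal{N}(\boldsymbol{0},\boldsymbol{I}/2)+\mathrm{i}\,\mathcal{N}(\boldsymbol{0},\boldsymbol{I}/2)$ (independent real and imaginary parts) if $\mathbb{H}=\mathbb{C}$. For $\boldsymbol{x},\boldsymbol{y}\in\mathbb{H}^d$ set $\mathrm{dist}(\boldsymbol{x},\boldsymbol{y}):=\min\{\|\boldsymbol{x}-c\boldsymbol{y}\|_2 : c\in\mathbb{H},\ |c|=1\}$. For $\boldsymbol{A}\in\mathbb{H}^{m\times d}$, $|\boldsymbol{A}\boldsymbol{x}|\in\mathbb{R}_+^m$ denotes the vector of entrywise absolute values of $\boldsymbol{A}\boldsymbol{x}$.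 Define $$L_{\boldsymbol{A}}:=\inf_{\boldsymbol{x},\boldsymbol{y}\in\mathbb{H}^d,\ \mathrm{dist}(\boldsymbol{x},\boldsymbol{y})\neq 0}\frac{\||\boldsymbol{A}\boldsymbol{x}|-|\boldsymbol{A}\boldsymbol{y}|\|_2}{\mathrm{dist}(\boldsymbol{x},\boldsymbol{y})},\qquad U_{\boldsymbol{A}}:=\sup_{\boldsymbol{x},\boldsymbol{y}\in\mathbb{H}^d,\ \mathrm{dist}(\boldsymbol{x},\boldsymbol{y})\neq 0}\frac{\||\boldsymbol{A}\boldsymbol{x}|-|\boldsymbol{A}\boldsymbol{y}|\|_2}{\mathrm{dist}(\boldsymbol{x},\boldsymbol{y})}.$$ The condition number is $\beta_{\boldsymbol{A}}:=U_{\boldsymbol{A}}/L_{\boldsymbol{A}}$, with the convention $\beta_{\boldsymbol{A}}=+\infty$ if $L_{\boldsymbol{A}}=0$.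
   Formalization: The formal theorem assumes d ≥ 2: for d = 1 every nonzero A has L_A = U_A, so β_A = 1 < β_0 and the stated lower bound fails, while for d = 0 the infimum and supremum range over an empty set. *)

theory Defs
  imports "HOL-Probability.Probability" "Jordan_Normal_Form.Matrix"
begin

no_notation vec_nth (infixl "$" 90)

definition l2norm :: "'a::real_normed_vector Matrix.vec \<Rightarrow> real" where
  "l2norm v = L2_set (\<lambda>i. norm (v $ i)) {..<dim_vec v}"

definition phase_dist :: "'a::real_normed_field Matrix.vec \<Rightarrow> 'a Matrix.vec \<Rightarrow> real" where
  "phase_dist x y = (INF c\<in>{c. norm c = 1}. l2norm (x - c \<cdot>\<^sub>v y))"

text \<open>The infimum in \<^const>\<open>phase_dist\<close> is a minimum.\<close>

lemma phase_dist_attained: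
  fixes x y :: "'a::{real_normed_field, heine_borel} Matrix.vec"
  assumes "dim_vec x = dim_vec y"
  shows "\<exists>c. norm c = 1 \<and> phase_dist x y = l2norm (x - c \<cdot>\<^sub>v y)"
    and "norm c = 1 \<Longrightarrow> phase_dist x y \<le> l2norm (x - c \<cdot>\<^sub>v y)"
proof -
  let ?S = "{c::'a. norm c = 1}"
  let ?f = "\<lambda>c. l2norm (x - c \<cdot>\<^sub>v y)"
  have S: "?S = sphere 0 1" by auto
  have f: "?f = (\<lambda>c. sqrt (\<Sum>i<dim_vec y. (norm (x $ i - c * y $ i))\<^sup>2))"
    by (auto simp: l2norm_def L2_set_def fun_eq_iff intro!: sum.cong)
  have "continuous_on ?S ?f"
    unfolding f by (intro continuous_intros)
  moreover have "compact ?S" unfolding S by simp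
  moreover have "?S \<noteq> {}" using norm_one by blast
  ultimately obtain c where c: "c \<in> ?S" and min: "\<And>b. b \<in> ?S \<Longrightarrow> ?f c \<le> ?f b"
    using continuous_attains_inf[of ?S ?f] by auto
  have eq: "phase_dist x y = ?f c"
    unfolding phase_dist_def by (rule cInf_eq_minimum) (use c min in auto)
  show "\<exists>c. norm c = 1 \<and> phase_dist x y = ?f c" using c eq by auto
  show "norm c = 1 \<Longrightarrow> phase_dist x y \<le> ?f c" for c using eq min by auto
qed

definition phaseless_pairs :: "nat \<Rightarrow> ('a::real_normed_field Matrix.vec \<times> 'a Matrix.vec) set" where
  "phaseless_pairs d = {(x, y). x \<in> carrier_vec d \<and> y \<in> carrier_vec d \<and> phase_dist x y \<noteq> 0}"

definition phaseless_ratio ::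
    "'a::real_normed_field mat \<Rightarrow> 'a Matrix.vec \<Rightarrow> 'a Matrix.vec \<Rightarrow> real" where
  "phaseless_ratio A x y =
     l2norm (map_vec norm (A *\<^sub>v x) - map_vec norm (A *\<^sub>v y)) / phase_dist x y"

definition lower_lipschitz :: "'a::real_normed_field mat \<Rightarrow> ereal" where
  "lower_lipschitz A = (INF (x, y)\<in>phaseless_pairs (dim_col A). ereal (phaseless_ratio A x y))"

definition upper_lipschitz :: "'a::real_normed_field mat \<Rightarrow> ereal" where
  "upper_lipschitz A = (SUP (x, y)\<in>phaseless_pairs (dim_col A). ereal (phaseless_ratio A x y))"

definition condition_number :: "'a::real_normed_field mat \<Rightarrow> ereal" where
  "condition_number A =
     (if lower_lipschitz A = 0 then \<infinity> else upper_lipschitz A / lower_lipschitz A)"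

text \<open>
  Vectors of length d are represented under these laws as functions on the index set
  \<^term>\<open>{..<d}\<close>. In \<^term>\<open>gaussian_vector s d\<close>, the parameter s is the standard
  deviation of each coordinate, so its covariance matrix is s^2 I.
\<close>

definition gaussian_vector :: "real \<Rightarrow> nat \<Rightarrow> (nat \<Rightarrow> real) measure" where
  "gaussian_vector s d = (\<Pi>\<^sub>M j\<in>{..<d}. density lborel (\<lambda>t. ennreal (normal_density 0 s t)))"

definition std_gaussian_real :: "nat \<Rightarrow> (nat \<Rightarrow> real) measure" where
  "std_gaussian_real d = gaussian_vector 1 d"

definition std_gaussian_complex :: "nat \<Rightarrow> (nat \<Rightarrow> complex) measure" where
  "std_gaussian_complex d =
     distr (gaussian_vector (sqrt (1 / 2)) d \<Otimes>\<^sub>M gaussian_vector (sqrt (1 / 2)) d)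
       (\<Pi>\<^sub>M j\<in>{..<d}. borel) (\<lambda>(u, v). \<lambda>j\<in>{..<d}. Complex (u j) (v j))"

text \<open>
  The law of an array of m i.i.d. rows with law R. The first index is the row index.
\<close>

definition iid_rows :: "nat \<Rightarrow> (nat \<Rightarrow> 'a) measure \<Rightarrow> (nat \<Rightarrow> nat \<Rightarrow> 'a) measure" where
  "iid_rows m R = (\<Pi>\<^sub>M i\<in>{..<m}. R)"

definition matrix_of :: "nat \<Rightarrow> nat \<Rightarrow> (nat \<Rightarrow> nat \<Rightarrow> 'a) \<Rightarrow> 'a mat" where
  "matrix_of m d \<omega> = mat m d (\<lambda>(i, j). \<omega> i j)"

text \<open>The map assembling a complex Gaussian vector is measurable, so its law is a genuine
  probability measure.\<close>

lemma prob_space_std_gaussian_complex: "prob_space (std_gaussian_complex d)"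
proof -
  have v: "prob_space (gaussian_vector (sqrt (1 / 2)) d)"
    unfolding gaussian_vector_def
    by (intro prob_space_PiM prob_space_normal_density) simp
  interpret pair_prob_space "gaussian_vector (sqrt (1 / 2)) d" "gaussian_vector (sqrt (1 / 2)) d"
    using v by (simp add: pair_prob_space_def pair_sigma_finite_def prob_space_imp_sigma_finite)
  have "(\<lambda>(u, v). \<lambda>j\<in>{..<d}. Complex (u j) (v j)) \<in>
      gaussian_vector (sqrt (1 / 2)) d \<Otimes>\<^sub>M gaussian_vector (sqrt (1 / 2)) d \<rightarrow>\<^sub>M (\<Pi>\<^sub>M j\<in>{..<d}. borel)"
    unfolding gaussian_vector_def split_beta' Complex_eq by measurable
  then show ?thesis
    unfolding std_gaussian_complex_def by (rule prob_space_distr)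
qed

definition beta0_real :: real where
  "beta0_real = sqrt (pi / (pi - 2))"

definition beta0_complex :: real where
  "beta0_complex = sqrt (4 / (4 - pi))"

end

theory Submission
  imports Defs
begin

text \<open>
  Replacing \<open>x + c y\<close> by a shorter multiple, where c is the optimal phase, shows that the lower
  Lipschitz constant is an infimum over orthogonal pairs x, y, for which the squared distance is
  \<open>|x|\<^sup>2 + |y|\<^sup>2\<close>. For a Gaussian row a and orthogonal x, y the numbers \<open>a x\<close> and \<open>a y\<close> are independent,
  so \<open>(|a x| - |a y|)\<^sup>2\<close> has mean \<open>|x|\<^sup>2 + |y|\<^sup>2 - 2 \<mu>\<^sup>2 |x| |y| \<ge> (1 - \<mu>\<^sup>2) (|x|\<^sup>2 + |y|\<^sup>2)\<close>, where \<open>\<mu>\<close> is the mean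
  modulus of the scalar Gaussian law, and \<open>\<beta>\<^sub>0 = 1 / sqrt (1 - \<mu>\<^sup>2)\<close>. The upper bound on the condition
  number is a union bound over a net of mesh proportional to \<open>\<delta>\<close>. The lower bound holds for
  every matrix: average the squared gap over a Gaussian orthogonal pair of equal lengths in a
  coordinate plane.
\<close>

subsection \<open>Nets from integer grids\<close>

text \<open>The quotient behind the lower constant is hard to discretise where the phase distance is
  small: a net error of fixed size cannot be compared with a vanishing denominator. On orthogonal
  pairs the gap and the squared distance are homogeneous of the same degree, so the infimum moves to
  the bounded set \<open>norm2 d x + norm2 d y = 1\<close>, where an absolute net error suffices.
  There the mean gap is smallest for equal lengths, which is why the pairs averaged for the lower
  bound have equal lengths. A net of mesh proportional to \<delta> has at most
  \<open>(T / \<delta>) ^ (k * d)\<close> points, while each tail is exponential in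
  \<open>\<delta>\<^sup>2 * m\<close>; this is the source of the logarithm in the condition on m.
  The gap is nonnegative, so its lower tail follows from two moments; the upper tail of the energy
  takes an exponential moment. For d = 1 every nonzero matrix has condition number 1, so the lower
  bound starts at d = 2.\<close>

lemma exp_minus_le_quadratic:
  fixes x :: real
  assumes "0 \<le> x"
  shows "exp (- x) \<le> 1 - x + x\<^sup>2 / 2"
proof -
  have pos: "0 < 1 + x + x\<^sup>2 / 2"
    using assms by (simp add: add_pos_nonneg)
  have "exp (- x) \<le> 1 / (1 + x + x\<^sup>2 / 2)"
    using exp_lower_Taylor_quadratic[OF assms] pos
    by (simp add: exp_minus field_simps)
  also have "\<dots> \<le> 1 - x + x\<^sup>2 / 2"
  proof -
    have "(1 - x + x\<^sup>2 / 2) * (1 + x + x\<^sup>2 / 2) = 1 + x^4 / 4"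
      by (simp add: field_simps power2_eq_square power4_eq_xxxx)
    then have "1 \<le> (1 - x + x\<^sup>2 / 2) * (1 + x + x\<^sup>2 / 2)"
      by simp
    then show ?thesis
      using pos by (simp add: pos_divide_le_eq)
  qed
  finally show ?thesis .
qed

lemma sum_exp_minus_abs_le:
  fixes \<eta> :: real and B :: int
  assumes "0 < \<eta>" "\<eta> \<le> 1"
  shows "(\<Sum>j\<in>{-B..B}. exp (- \<eta> * real_of_int \<bar>j\<bar>)) \<le> 4 / \<eta>"
proof -
  define q where "q = exp (- \<eta>)"
  have q: "0 < q" "q < 1" using assms by (auto simp: q_def)
  have q1: "1 - q \<ge> \<eta> / 2"
  proof -
    have "\<eta>\<^sup>2 \<le> \<eta>" using assms by (simp add: power2_eq_square mult_left_le)
    then show ?thesis using exp_minus_le_quadratic[of \<eta>] assms by (simp add: q_def)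
  qed
  let ?f = "\<lambda>j. exp (- \<eta> * real_of_int \<bar>j\<bar>)"
  have f: "?f (int i) = q ^ i" "?f (- int i) = q ^ i" for i
    by (simp_all add: q_def exp_of_nat_mult[symmetric] mult.commute)
  \<comment> \<open>Both images contain 0, so this overcounts by one term; the result is twice a
    geometric series.\<close>
  have "(\<Sum>j\<in>{-B..B}. ?f j) \<le> (\<Sum>j\<in>int ` {..nat B} \<union> (\<lambda>i. - int i) ` {..nat B}. ?f j)"
  proof (rule sum_mono2)
    show "{-B..B} \<subseteq> int ` {..nat B} \<union> (\<lambda>i. - int i) ` {..nat B}"
    proof
      fix j assume "j \<in> {-B..B}"
      then have "j = int (nat j) \<and> nat j \<le> nat B \<or> j = - int (nat (- j)) \<and> nat (- j) \<le> nat B"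
        by auto
      then show "j \<in> int ` {..nat B} \<union> (\<lambda>i. - int i) ` {..nat B}" by blast
    qed
  qed auto
  also have "\<dots> \<le> (\<Sum>j\<in>int ` {..nat B}. ?f j) + (\<Sum>j\<in>(\<lambda>i. - int i) ` {..nat B}. ?f j)"
    by (subst sum_Un) (auto intro!: sum_nonneg)
  also have "\<dots> = 2 * (\<Sum>i\<le>nat B. q ^ i)"
    by (subst (1 2) sum.reindex) (simp_all only: inj_on_def f o_def, auto)
  also have "(\<Sum>i\<le>nat B. q ^ i) \<le> (\<Sum>i. q ^ i)"
    using q by (intro sum_le_suminf) auto
  also have "(\<Sum>i. q ^ i) = 1 / (1 - q)"
    using q by (intro suminf_geometric) auto
  also have "\<dots> \<le> 1 / (\<eta> / 2)"
    using q1 assms by (intro divide_left_mono) (auto intro!: mult_pos_pos)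
  finally show ?thesis by simp
qed

text \<open>Exponential counting: with r the l1 radius, each point of \<open>G\<close> has weight
  exp (\<eta> (r - |g|_1)) >= 1, and the total weight over an enclosing box factors into one sum per
  coordinate. Since \<eta> r <= 2 n, the prefactor is at most exp(2)^n. Counting the box itself
  would lose a factor growing with the dimension in every coordinate.\<close>

lemma card_lattice_points_l1_ball_le:
  fixes \<eta> :: real and I :: "'i set"
  assumes "finite I" "0 < \<eta>" "\<eta> \<le> 1"
  defines "G \<equiv> {g \<in> PiE I (\<lambda>_. UNIV :: int set).
    (\<Sum>i\<in>I. real_of_int \<bar>g i\<bar>) \<le> real (card I) / \<eta> + real (card I)}"
  shows "finite G" and "real (card G) \<le> (4 * exp 2 / \<eta>) ^ card I"
proof -
  define r where "r = real (card I) / \<eta> + real (card I)"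
  define B where "B = \<lceil>r\<rceil>"
  let ?P = "PiE I (\<lambda>_. {-B..B})"
  have fin: "finite ?P" using assms by (intro finite_PiE) auto
  have sub: "G \<subseteq> ?P"
  proof
    fix g assume g: "g \<in> G"
    have "g i \<in> {-B..B}" if "i \<in> I" for i
    proof -
      have "real_of_int \<bar>g i\<bar> \<le> (\<Sum>i\<in>I. real_of_int \<bar>g i\<bar>)"
        using assms(1) that by (intro member_le_sum) auto
      also have "\<dots> \<le> r" using g by (simp add: G_def r_def)
      finally have "\<bar>g i\<bar> \<le> B" unfolding B_def by linarith
      then show ?thesis by auto
    qed
    then show "g \<in> ?P" using g by (auto simp: G_def PiE_iff)
  qed
  show "finite G" using sub fin by (rule finite_subset)
  have "real (card G) = (\<Sum>g\<in>G. 1)" by simp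
  also have "\<dots> \<le> (\<Sum>g\<in>G. exp (\<eta> * r) * (\<Prod>i\<in>I. exp (- \<eta> * real_of_int \<bar>g i\<bar>)))"
  proof (rule sum_mono)
    fix g assume g: "g \<in> G"
    have "exp (\<eta> * r) * (\<Prod>i\<in>I. exp (- \<eta> * real_of_int \<bar>g i\<bar>))
        = exp (\<eta> * (r - (\<Sum>i\<in>I. real_of_int \<bar>g i\<bar>)))"
      using assms(1) by (simp add: exp_sum[symmetric] exp_add[symmetric] algebra_simps sum_distrib_left sum_negf)
    moreover have "0 \<le> \<eta> * (r - (\<Sum>i\<in>I. real_of_int \<bar>g i\<bar>))"
      using g assms by (simp add: G_def r_def)
    ultimately show "1 \<le> exp (\<eta> * r) * (\<Prod>i\<in>I. exp (- \<eta> * real_of_int \<bar>g i\<bar>))"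
      by simp
  qed
  also have "\<dots> \<le> (\<Sum>g\<in>?P. exp (\<eta> * r) * (\<Prod>i\<in>I. exp (- \<eta> * real_of_int \<bar>g i\<bar>)))"
    using sub fin by (intro sum_mono2) (auto intro!: mult_nonneg_nonneg prod_nonneg)
  also have "\<dots> = exp (\<eta> * r) * (\<Prod>i\<in>I. \<Sum>j\<in>{-B..B}. exp (- \<eta> * real_of_int \<bar>j\<bar>))"
    by (subst prod_sum_PiE) (use assms(1) in \<open>simp_all add: sum_distrib_left\<close>)
  also have "\<dots> \<le> exp (\<eta> * r) * (\<Prod>i\<in>I. 4 / \<eta>)"
    using assms by (intro mult_left_mono prod_mono conjI sum_exp_minus_abs_le sum_nonneg) auto
  also have "\<dots> \<le> exp 2 ^ card I * (\<Prod>i\<in>I. 4 / \<eta>)"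
  proof (rule mult_right_mono)
    have "\<eta> * r = real (card I) * (1 + \<eta>)" using assms by (simp add: r_def field_simps)
    also have "\<dots> \<le> real (card I) * 2" using assms by (intro mult_left_mono) auto
    finally have "exp (\<eta> * r) \<le> exp (real (card I) * 2)" by simp
    then show "exp (\<eta> * r) \<le> exp 2 ^ card I" by (simp add: exp_of_nat_mult)
  qed (use assms in \<open>auto intro!: prod_nonneg\<close>)
  finally show "real (card G) \<le> (4 * exp 2 / \<eta>) ^ card I"
    using assms by (simp add: power_mult_distrib power_divide mult_ac)
qed

text \<open>The representatives of the cells of a rounding grid are chosen inside the set itself, so
  side conditions such as orthogonality are inherited by the net.\<close>

lemma finite_net_exists:
  fixes z :: "'s \<Rightarrow> 'i \<Rightarrow> real"
  assumes I: "finite I" and \<eta>: "0 < \<eta>" "\<eta> \<le> 1"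
    and S: "\<And>s. s \<in> S \<Longrightarrow> (\<Sum>i\<in>I. (z s i)\<^sup>2) \<le> 1"
  obtains N where "finite N" "N \<subseteq> S" "real (card N) \<le> (4 * exp 2 / \<eta>) ^ card I"
    "\<And>s. s \<in> S \<Longrightarrow> \<exists>t\<in>N. (\<Sum>i\<in>I. (z s i - z t i)\<^sup>2) \<le> \<eta>\<^sup>2"
proof -
  define n where "n = card I"
  \<comment> \<open>A cube of this side in n coordinates has diameter \<eta>. For empty
    \<open>I\<close> the side is 0 by division by zero, and all sums over \<open>I\<close> are
    empty.\<close>
  define h where "h = \<eta> / sqrt (real n)"
  define k where "k s = (\<lambda>i\<in>I. \<lfloor>z s i / h\<rfloor>)" for s
  define G where "G = {g \<in> PiE I (\<lambda>_. UNIV :: int set).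
    (\<Sum>i\<in>I. real_of_int \<bar>g i\<bar>) \<le> real (card I) / \<eta> + real (card I)}"
  define N where "N = inv_into S k ` k ` S"
  note G = card_lattice_points_l1_ball_le[OF I \<eta>, folded G_def]
  have kS: "k s \<in> G" if "s \<in> S" for s
  proof -
    \<comment> \<open>Cauchy-Schwarz puts the Euclidean unit ball inside an l1 ball of radius sqrt
      n. Dividing by \<open>h\<close> gives n / \<eta>, and the floor adds at most 1 per coordinate:
      this is the radius in \<open>G\<close>.\<close>
    have "(\<Sum>i\<in>I. \<bar>z s i\<bar> * \<bar>1\<bar>) \<le> L2_set (z s) I * L2_set (\<lambda>_. 1) I"
      by (rule L2_set_mult_ineq)
    also have "\<dots> \<le> 1 * sqrt (real n)"
      using S[OF that] by (intro mult_mono) (auto simp: L2_set_def n_def)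
    finally have l1: "(\<Sum>i\<in>I. \<bar>z s i\<bar>) \<le> sqrt (real n)" by simp
    have "(\<Sum>i\<in>I. real_of_int \<bar>k s i\<bar>) \<le> (\<Sum>i\<in>I. \<bar>z s i / h\<bar> + 1)"
    proof (rule sum_mono)
      fix i assume "i \<in> I"
      then have "k s i = \<lfloor>z s i / h\<rfloor>" by (simp add: k_def)
      then show "real_of_int \<bar>k s i\<bar> \<le> \<bar>z s i / h\<bar> + 1" by linarith
    qed
    also have "\<dots> = (\<Sum>i\<in>I. \<bar>z s i\<bar> / h) + real n"
      using \<eta> by (simp add: sum.distrib h_def n_def abs_divide abs_mult)
    also have "(\<Sum>i\<in>I. \<bar>z s i\<bar> / h) = (\<Sum>i\<in>I. \<bar>z s i\<bar>) / h"
      by (simp add: sum_divide_distrib)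
    also have "(\<Sum>i\<in>I. \<bar>z s i\<bar>) / h \<le> sqrt (real n) / h"
      using l1 \<eta> by (intro divide_right_mono) (auto simp: h_def)
    also have "\<dots> = real n / \<eta>"
      by (simp add: h_def)
    finally show ?thesis by (simp add: G_def n_def k_def)
  qed
  then have sub: "k ` S \<subseteq> G" by auto
  have "finite (k ` S)" using sub G(1) by (rule finite_subset)
  then have "card N \<le> card (k ` S)" unfolding N_def by (rule card_image_le)
  also have "\<dots> \<le> card G" using sub G(1) by (rule card_mono[rotated])
  finally have card: "real (card N) \<le> (4 * exp 2 / \<eta>) ^ card I"
    using G(2) by linarith
  show ?thesis
  proof (rule that[OF _ _ card])
    show "finite N" using \<open>finite (k ` S)\<close> by (simp add: N_def)
    show "N \<subseteq> S" by (auto simp: N_def inv_into_into)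
    fix s assume s: "s \<in> S"
    define t where "t = inv_into S k (k s)"
    have t: "t \<in> N" "k t = k s"
      using s by (auto simp: N_def t_def f_inv_into_f)
    have "(z s i - z t i)\<^sup>2 \<le> \<eta>\<^sup>2 / real n" if i: "i \<in> I" for i
    proof -
      have n: "0 < n" using i I by (auto simp: n_def card_gt_0_iff)
      then have h: "0 < h" using \<eta> by (simp add: h_def)
      have "\<lfloor>z s i / h\<rfloor> = \<lfloor>z t i / h\<rfloor>"
        using t(2) i by (metis k_def restrict_apply')
      then have "\<bar>z s i / h - z t i / h\<bar> \<le> 1" by linarith
      then have "\<bar>z s i - z t i\<bar> \<le> h"
        using h by (simp add: diff_divide_distrib[symmetric] abs_divide)
      then have "(z s i - z t i)\<^sup>2 \<le> h\<^sup>2"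
        using h by (simp add: abs_le_square_iff[symmetric])
      then show ?thesis using n by (simp add: h_def power_divide)
    qed
    then have "(\<Sum>i\<in>I. (z s i - z t i)\<^sup>2) \<le> (\<Sum>i\<in>I. \<eta>\<^sup>2 / real n)"
      by (rule sum_mono)
    also have "\<dots> \<le> \<eta>\<^sup>2" by (simp add: n_def)
    finally show "\<exists>t\<in>N. (\<Sum>i\<in>I. (z s i - z t i)\<^sup>2) \<le> \<eta>\<^sup>2" using t by blast
  qed
qed

subsection \<open>Reduction to orthogonal pairs\<close>

text \<open>The map fixes \<alpha> - \<beta> and multiplies \<alpha> + \<beta> by \<open>r\<close>.
  With \<open>s'\<close>, \<open>t'\<close> the new norms, \<open>(s' - t')\<^sup>2\<close> and
  \<open>(s' + t')\<^sup>2\<close> are the roots of a monic quadratic whose value at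
  \<open>(s - t)\<^sup>2\<close> is nonpositive by Cauchy-Schwarz. Hence
  \<open>(s - t)\<^sup>2\<close> lies between the roots and is at least the smaller one.\<close>

lemma norm_diff_contract_le:
  fixes \<alpha> \<beta> :: "'a::real_inner" and r :: real
  assumes "0 \<le> r" "r \<le> 1"
  defines "a \<equiv> (r + 1) / 2" and "b \<equiv> (r - 1) / 2"
  shows "(norm (a *\<^sub>R \<alpha> + b *\<^sub>R \<beta>) - norm (b *\<^sub>R \<alpha> + a *\<^sub>R \<beta>))\<^sup>2 \<le> (norm \<alpha> - norm \<beta>)\<^sup>2"
proof -
  define s t where "s = norm \<alpha>" and "t = norm \<beta>"
  define s' t' where "s' = norm (a *\<^sub>R \<alpha> + b *\<^sub>R \<beta>)" and "t' = norm (b *\<^sub>R \<alpha> + a *\<^sub>R \<beta>)"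
  define R where "R = inner \<alpha> \<beta>"
  have nn: "0 \<le> s" "0 \<le> t" "0 \<le> s'" "0 \<le> t'" by (auto simp: s_def t_def s'_def t'_def)
  have R: "R \<le> s * t" unfolding R_def s_def t_def by (rule norm_cauchy_schwarz)
  have s2: "s'\<^sup>2 = a\<^sup>2 * s\<^sup>2 + b\<^sup>2 * t\<^sup>2 + 2 * a * b * R"
    unfolding s'_def s_def t_def R_def power2_norm_eq_inner
    by (simp add: inner_add_left inner_add_right inner_commute algebra_simps power2_eq_square)
  have t2: "t'\<^sup>2 = b\<^sup>2 * s\<^sup>2 + a\<^sup>2 * t\<^sup>2 + 2 * a * b * R"
    unfolding t'_def s_def t_def R_def power2_norm_eq_inner
    by (simp add: inner_add_left inner_add_right inner_commute algebra_simps power2_eq_square)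
  \<comment> \<open>A difference of squares factors, so squaring \<open>dif\<close> gives the
    product of the two roots, and \<open>sm\<close> gives their sum.\<close>
  have dif: "s'\<^sup>2 - t'\<^sup>2 = r * (s\<^sup>2 - t\<^sup>2)"
    unfolding s2 t2 a_def b_def by (simp add: field_simps power2_eq_square)
  have sm: "2 * (s'\<^sup>2 + t'\<^sup>2) = (r\<^sup>2 + 1) * (s\<^sup>2 + t\<^sup>2) + 2 * (r\<^sup>2 - 1) * R"
    unfolding s2 t2 a_def b_def by (simp add: field_simps power2_eq_square)
  define f where "f = (s - t)\<^sup>2"
  have factor: "u\<^sup>2 - v\<^sup>2 = (u - v) * (u + v)" for u v :: real
    by (simp add: power2_eq_square algebra_simps)
  have sm': "(s' - t')\<^sup>2 + (s' + t')\<^sup>2 = (r\<^sup>2 + 1) * (s\<^sup>2 + t\<^sup>2) + 2 * (r\<^sup>2 - 1) * R"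
    unfolding sm[symmetric] by (simp add: power2_eq_square algebra_simps)
  have pr: "(s' - t')\<^sup>2 * (s' + t')\<^sup>2 = r\<^sup>2 * (f * (s + t)\<^sup>2)"
    using arg_cong[OF dif, of "\<lambda>u. u\<^sup>2"] unfolding factor by (simp add: power_mult_distrib f_def)
  have "(f - (s' - t')\<^sup>2) * (f - (s' + t')\<^sup>2) =
      f * (f - ((s' - t')\<^sup>2 + (s' + t')\<^sup>2)) + (s' - t')\<^sup>2 * (s' + t')\<^sup>2"
    by (simp add: algebra_simps)
  also have "\<dots> = f * (f - ((r\<^sup>2 + 1) * (s\<^sup>2 + t\<^sup>2) + 2 * (r\<^sup>2 - 1) * R) + r\<^sup>2 * (s + t)\<^sup>2)"
    unfolding pr sm' by (simp add: algebra_simps)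
  also have "f - ((r\<^sup>2 + 1) * (s\<^sup>2 + t\<^sup>2) + 2 * (r\<^sup>2 - 1) * R) + r\<^sup>2 * (s + t)\<^sup>2
      = (1 - r\<^sup>2) * (2 * R - 2 * s * t)"
    unfolding f_def by (simp add: power2_eq_square algebra_simps)
  also have "f * ((1 - r\<^sup>2) * (2 * R - 2 * s * t)) = f * (1 - r\<^sup>2) * (2 * R - 2 * s * t)"
    by simp
  also have "\<dots> \<le> 0"
    using R assms(1,2) by (intro mult_nonneg_nonpos mult_nonneg_nonneg) (auto simp: f_def abs_square_le_1)
  finally have key: "(f - (s' - t')\<^sup>2) * (f - (s' + t')\<^sup>2) \<le> 0" .
  have "(s' - t')\<^sup>2 \<le> (s' + t')\<^sup>2"
    using nn by (simp add: power2_eq_square algebra_simps)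
  with key have "(s' - t')\<^sup>2 \<le> f"
    by (smt (verit, ccfv_SIG) mult_neg_neg)
  then show ?thesis by (simp add: f_def s_def t_def s'_def t'_def)
qed

text \<open>Vectors are functions on all of \<open>nat\<close>, of which only the values below
  \<open>d\<close> count. This matches the product measures, and squared norms keep all identities
  polynomial.\<close>

definition norm2 :: "nat \<Rightarrow> (nat \<Rightarrow> 'a::real_normed_vector) \<Rightarrow> real" where
  "norm2 d x = (\<Sum>j<d. (norm (x j))\<^sup>2)"

definition lin :: "nat \<Rightarrow> (nat \<Rightarrow> 'a::real_normed_field) \<Rightarrow> (nat \<Rightarrow> 'a) \<Rightarrow> 'a" where
  "lin d a x = (\<Sum>j<d. a j * x j)"

definition energy :: "nat \<Rightarrow> nat \<Rightarrow> (nat \<Rightarrow> nat \<Rightarrow> 'a::real_normed_field) \<Rightarrow> (nat \<Rightarrow> 'a) \<Rightarrow> real" where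
  "energy m d A x = (\<Sum>i<m. (norm (lin d (A i) x))\<^sup>2)"

definition gap :: "nat \<Rightarrow> nat \<Rightarrow> (nat \<Rightarrow> nat \<Rightarrow> 'a::real_normed_field) \<Rightarrow>
    (nat \<Rightarrow> 'a) \<Rightarrow> (nat \<Rightarrow> 'a) \<Rightarrow> real" where
  "gap m d A x y = (\<Sum>i<m. (norm (lin d (A i) x) - norm (lin d (A i) y))\<^sup>2)"

lemma norm2_nonneg [simp]: "0 \<le> norm2 d x"
  by (simp add: norm2_def sum_nonneg)

lemma energy_nonneg [simp]: "0 \<le> energy m d A x"
  by (simp add: energy_def sum_nonneg)

lemma gap_nonneg [simp]: "0 \<le> gap m d A x y"
  by (simp add: gap_def sum_nonneg)

lemma lin_add: "lin d a (\<lambda>j. x j + y j) = lin d a x + lin d a y"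
  by (simp add: lin_def algebra_simps sum.distrib)

lemma lin_diff: "lin d a (\<lambda>j. x j - y j) = lin d a x - lin d a y"
  by (simp add: lin_def algebra_simps sum_subtractf)

lemma lin_cmult: "lin d a (\<lambda>j. c * x j) = c * lin d a x"
  by (simp add: lin_def sum_distrib_left mult_ac)

lemma norm2_cmult: "norm2 d (\<lambda>j. c * x j) = (norm c)\<^sup>2 * norm2 d (x :: nat \<Rightarrow> 'a::real_normed_field)"
  by (simp add: norm2_def norm_mult power_mult_distrib sum_distrib_left)

lemma energy_cmult: "energy m d A (\<lambda>j. c * x j) = (norm c)\<^sup>2 * energy m d A x"
  by (simp add: energy_def lin_cmult norm_mult power_mult_distrib sum_distrib_left)

lemma gap_cmult: "gap m d A (\<lambda>j. c * x j) (\<lambda>j. c * y j) = (norm c)\<^sup>2 * gap m d A x y"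
  by (simp add: gap_def lin_cmult norm_mult power_mult_distrib sum_distrib_left flip: right_diff_distrib)

lemma gap_phase: "norm c = 1 \<Longrightarrow> gap m d A x (\<lambda>j. c * y j) = gap m d A x y"
  by (simp add: gap_def lin_cmult norm_mult)

lemma gap_le_energy: "gap m d A x y \<le> energy m d A (\<lambda>j. x j - y j)"
proof -
  have "(norm u - norm v)\<^sup>2 \<le> (norm (u - v))\<^sup>2" for u v :: 'a
    by (rule abs_le_square_iff[THEN iffD1]) (simp add: norm_triangle_ineq3)
  then show ?thesis unfolding gap_def energy_def lin_diff by (intro sum_mono)
qed

lemma l2norm_vec: "l2norm (Matrix.vec d x) = sqrt (norm2 d x)"
  by (simp add: l2norm_def L2_set_def norm2_def)

lemma dim_col_matrix_of: "dim_col (matrix_of m d A) = d"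
  by (simp add: matrix_of_def)

lemma matrix_of_mult_vec:
  "matrix_of m d A *\<^sub>v Matrix.vec d x = Matrix.vec m (\<lambda>i. lin d (A i) x)"
  by (auto simp: matrix_of_def lin_def scalar_prod_def lessThan_atLeast0 intro!: sum.cong)

lemma l2norm_gap:
  "l2norm (map_vec norm (matrix_of m d A *\<^sub>v Matrix.vec d x) -
     map_vec norm (matrix_of m d A *\<^sub>v Matrix.vec d y)) = sqrt (gap m d A x y)"
  unfolding matrix_of_mult_vec by (simp add: l2norm_def L2_set_def gap_def)

text \<open>One interface for both scalar fields: \<open>cj\<close> is the identity on the reals and
  \<open>cnj\<close> on the complex numbers. Real parts are expressed through z + cj z or through
  the real inner product of the field.\<close>

locale conj_field =
  fixes cj :: "'a::{real_normed_field, euclidean_space} \<Rightarrow> 'a"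
  assumes cj_add: "cj (x + y) = cj x + cj y"
    and cj_mult: "cj (x * y) = cj x * cj y"
    and cj_of_real: "cj (of_real r) = of_real r"
    and cj_cj: "cj (cj x) = x"
    and mult_cj: "x * cj x = of_real ((norm x)\<^sup>2)"
begin

lemma cj_0: "cj 0 = 0" using cj_of_real[of 0] by simp

lemma cj_minus: "cj (- x) = - cj x"
  using cj_add[of x "- x"] by (simp add: cj_0 eq_neg_iff_add_eq_0 add.commute)

lemma cj_diff: "cj (x - y) = cj x - cj y"
  using cj_add[of x "- y"] by (simp add: cj_minus)

lemma cj_sum: "cj (sum f A) = (\<Sum>i\<in>A. cj (f i))"
  by (induction A rule: infinite_finite_induct) (auto simp: cj_0 cj_add)

lemma norm_cj: "norm (cj x) = norm x"
proof -
  have "of_real ((norm (cj x))\<^sup>2) = (of_real ((norm x)\<^sup>2) :: 'a)"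
    using mult_cj[of x] mult_cj[of "cj x"] by (simp add: cj_cj mult.commute)
  then have "(norm (cj x))\<^sup>2 = (norm x)\<^sup>2" by (simp only: of_real_eq_iff)
  then show ?thesis by simp
qed

definition ip :: "nat \<Rightarrow> (nat \<Rightarrow> 'a) \<Rightarrow> (nat \<Rightarrow> 'a) \<Rightarrow> 'a" where
  "ip d x y = (\<Sum>j<d. x j * cj (y j))"

lemma ip_self: "ip d x x = of_real (norm2 d x)"
  by (simp add: ip_def norm2_def mult_cj)

lemma ip_commute: "ip d y x = cj (ip d x y)"
  by (simp add: ip_def cj_sum cj_mult cj_cj mult.commute)

lemma ip_combination:
  "ip d (\<lambda>j. a * x j + b * y j) (\<lambda>j. a' * x j + b' * y j) =
     a * cj a' * ip d x x + a * cj b' * ip d x y + b * cj a' * ip d y x + b * cj b' * ip d y y"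
  by (simp add: ip_def cj_add cj_mult algebra_simps sum.distrib sum_distrib_left)

lemma norm2_combination:
  assumes "ip d x y = of_real \<rho>"
  shows "norm2 d (\<lambda>j. of_real a * x j + of_real b * y j) =
    a\<^sup>2 * norm2 d x + b\<^sup>2 * norm2 d y + 2 * a * b * \<rho>"
proof -
  have "(of_real (norm2 d (\<lambda>j. of_real a * x j + of_real b * y j)) :: 'a) =
    of_real (a\<^sup>2 * norm2 d x + b\<^sup>2 * norm2 d y + 2 * a * b * \<rho>)"
    unfolding ip_self[symmetric] ip_combination
    using assms by (simp add: ip_self ip_commute[of d y x] cj_of_real power2_eq_square algebra_simps)
  then show ?thesis by (simp only: of_real_eq_iff)
qed

lemma phase_exists: "\<exists>c. norm c = 1 \<and> ip d x (\<lambda>j. c * y j) = of_real (norm (ip d x y))"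
proof -
  define z where "z = ip d x y"
  have e: "ip d x (\<lambda>j. c * y j) = cj c * z" for c
    by (simp add: z_def ip_def cj_mult sum_distrib_left mult_ac)
  show ?thesis
  proof (cases "z = 0")
    case True
    then show ?thesis using e z_def by (intro exI[of _ 1]) auto
  next
    case False
    define c where "c = z * of_real (inverse (norm z))"
    have "norm c = 1" using False by (simp add: c_def norm_mult norm_inverse)
    moreover have "cj c * z = of_real (norm z)"
    proof -
      have "cj c * z = (z * cj z) * of_real (inverse (norm z))"
        by (simp only: c_def cj_mult cj_of_real mult_ac)
      also have "\<dots> = of_real ((norm z)\<^sup>2 * inverse (norm z))"
        by (simp only: mult_cj of_real_mult)
      also have "(norm z)\<^sup>2 * inverse (norm z) = norm z"
        using False by (simp add: power2_eq_square)
      finally show ?thesis .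
    qed
    ultimately show ?thesis using e z_def by auto
  qed
qed

lemma norm_ip_le: "2 * norm (ip d x y) \<le> norm2 d x + norm2 d y"
proof -
  have "norm (ip d x y) \<le> (\<Sum>j<d. norm (x j) * norm (y j))"
    unfolding ip_def by (rule order.trans[OF norm_sum]) (simp add: norm_mult norm_cj)
  also have "2 * \<dots> = (\<Sum>j<d. 2 * norm (x j) * norm (y j))"
    by (simp add: sum_distrib_left mult_ac)
  also have "\<dots> \<le> (\<Sum>j<d. (norm (x j))\<^sup>2 + (norm (y j))\<^sup>2)"
    by (intro sum_mono sum_squares_bound)
  finally show ?thesis by (simp add: norm2_def sum.distrib)
qed

text \<open>The square of \<open>phase_dist\<close> in closed form: in the expansion of |x - c y|^2
  the cross term is largest when the phase of \<open>c\<close> turns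
  \<open>ip d x (\<lambda>j. c * y j)\<close> into the modulus of \<open>ip d x y\<close>.\<close>

definition pdist2 :: "nat \<Rightarrow> (nat \<Rightarrow> 'a) \<Rightarrow> (nat \<Rightarrow> 'a) \<Rightarrow> real" where
  "pdist2 d x y = norm2 d x + norm2 d y - 2 * norm (ip d x y)"

lemma pdist2_nonneg [simp]: "0 \<le> pdist2 d x y"
  using norm_ip_le[of d x y] by (simp add: pdist2_def)

lemma pdist2_le:
  assumes "norm c = 1"
  shows "pdist2 d x y \<le> norm2 d (\<lambda>j. x j - c * y j)"
proof -
  \<comment> \<open>The abstract field has no real part: the cross term stays in the form w + cj w,
    and the triangle inequality with \<open>norm_cj\<close> bounds it by twice the modulus of
    w.\<close>
  have "(of_real (norm2 d (\<lambda>j. x j - c * y j)) :: 'a) =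
     of_real (norm2 d x + norm2 d y) - (cj c * ip d x y + cj (cj c * ip d x y))"
    unfolding ip_self[symmetric]
    using ip_combination[of d 1 x "- c" y 1 "- c"] mult_cj[of c] assms cj_of_real[of 1]
    by (simp add: ip_self ip_commute[of d y x] cj_minus cj_mult cj_cj)
  then have "of_real (norm2 d x + norm2 d y - norm2 d (\<lambda>j. x j - c * y j)) =
     cj c * ip d x y + cj (cj c * ip d x y)"
    by (simp add: algebra_simps)
  then have "norm (of_real (norm2 d x + norm2 d y - norm2 d (\<lambda>j. x j - c * y j)) :: 'a)
     \<le> norm (cj c * ip d x y) + norm (cj (cj c * ip d x y))"
    by (simp only: norm_triangle_ineq)
  then have "\<bar>norm2 d x + norm2 d y - norm2 d (\<lambda>j. x j - c * y j)\<bar> \<le> 2 * norm (ip d x y)"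
    unfolding norm_of_real norm_cj norm_mult assms by (simp only: mult_1 mult_2)
  then show ?thesis by (simp add: pdist2_def)
qed

lemma pdist2_attained: "\<exists>c. norm c = 1 \<and> norm2 d (\<lambda>j. x j - c * y j) = pdist2 d x y"
proof -
  obtain c where c: "norm c = 1" "ip d x (\<lambda>j. c * y j) = of_real (norm (ip d x y))"
    using phase_exists by blast
  have "norm2 d (\<lambda>j. x j - c * y j) = pdist2 d x y"
    using norm2_combination[OF c(2), of 1 "-1"] c(1)
    by (simp add: pdist2_def norm2_cmult)
  with c(1) show ?thesis by blast
qed

lemma phase_dist_vec: "phase_dist (Matrix.vec d x) (Matrix.vec d y) = sqrt (pdist2 d x y)"
proof -
  have e: "Matrix.vec d x - c \<cdot>\<^sub>v Matrix.vec d y = Matrix.vec d (\<lambda>j. x j - c * y j)" for c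
    by auto
  have dim: "dim_vec (Matrix.vec d x) = dim_vec (Matrix.vec d y)" by simp
  obtain c where c: "norm c = 1"
      "phase_dist (Matrix.vec d x) (Matrix.vec d y) = l2norm (Matrix.vec d x - c \<cdot>\<^sub>v Matrix.vec d y)"
    using phase_dist_attained(1)[OF dim] by blast
  obtain b where b: "norm b = 1" "norm2 d (\<lambda>j. x j - b * y j) = pdist2 d x y"
    using pdist2_attained by blast
  have "phase_dist (Matrix.vec d x) (Matrix.vec d y) \<le> sqrt (pdist2 d x y)"
    using phase_dist_attained(2)[OF dim b(1)] by (simp add: e l2norm_vec b(2))
  moreover have "sqrt (pdist2 d x y) \<le> phase_dist (Matrix.vec d x) (Matrix.vec d y)"
    unfolding c(2) e l2norm_vec using pdist2_le[OF c(1)] by simp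
  ultimately show ?thesis by simp
qed

text \<open>Shrinking \<open>x + c y\<close> to the length of \<open>x - c y\<close>, with c the optimal phase, makes the pair
  orthogonal; it keeps the distance and does not increase the gap.\<close>

lemma orthogonal_reduction:
  "\<exists>x' y'. ip d x' y' = 0 \<and> norm2 d x' + norm2 d y' = pdist2 d x y \<and>
     gap m d A x' y' \<le> gap m d A x y"
proof -
  define \<rho> where "\<rho> = norm (ip d x y)"
  obtain c where c: "norm c = 1" "ip d x (\<lambda>j. c * y j) = of_real \<rho>"
    using phase_exists \<rho>_def by blast
  define y1 where "y1 = (\<lambda>j. c * y j)"
  define n where "n = norm2 d x + norm2 d y"
  have ip1: "ip d x y1 = of_real \<rho>" using c(2) by (simp add: y1_def)
  have ip2: "ip d y1 x = of_real \<rho>" using ip1 by (simp add: ip_commute[of d y1 x] cj_of_real)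
  have n1: "norm2 d y1 = norm2 d y" using c(1) by (simp add: y1_def norm2_cmult)
  have \<rho>: "0 \<le> \<rho>" "2 * \<rho> \<le> n" using norm_ip_le[of d x y] by (auto simp: \<rho>_def n_def)
  \<comment> \<open>\<open>n + 2 * \<rho>\<close> and \<open>n - 2 * \<rho>\<close> are the squared
    lengths of x + y1 and x - y1, so \<open>l\<close> is the ratio of the lengths. If the first
    vanishes, so does the second, and 0 serves as \<open>l\<close>.\<close>
  have "\<exists>l\<ge>0. l \<le> 1 \<and> l\<^sup>2 * (n + 2 * \<rho>) = n - 2 * \<rho>"
  proof (cases "n + 2 * \<rho> = 0")
    case True
    then show ?thesis using \<rho> by (intro exI[of _ 0]) auto
  next
    case False
    define l where "l = sqrt ((n - 2 * \<rho>) / (n + 2 * \<rho>))"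
    have "0 \<le> l" "l \<le> 1" "l\<^sup>2 = (n - 2 * \<rho>) / (n + 2 * \<rho>)"
      using \<rho> False by (auto simp: l_def intro!: divide_le_eq_1[THEN iffD2])
    then show ?thesis using False by (intro exI[of _ l]) auto
  qed
  then obtain l where l: "0 \<le> l" "l \<le> 1" "l\<^sup>2 * (n + 2 * \<rho>) = n - 2 * \<rho>" by blast
  define a b where "a = (l + 1) / 2" and "b = (l - 1) / 2"
  define x' where "x' = (\<lambda>j. of_real a * x j + of_real b * y1 j)"
  define y' where "y' = (\<lambda>j. of_real b * x j + of_real a * y1 j)"
  \<comment> \<open>The sum x' + y' is l (x + y1) and the difference x' - y' is x - y1. Their
    squared lengths agree by the choice of \<open>l\<close>, and as the inner product is real it
    must vanish.\<close>
  have "ip d x' y' = of_real (a * b * n + (a\<^sup>2 + b\<^sup>2) * \<rho>)"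
    unfolding x'_def y'_def ip_combination ip1 ip2 ip_self n1 cj_of_real n_def
    by (simp add: algebra_simps power2_eq_square)
  also have "a * b * n + (a\<^sup>2 + b\<^sup>2) * \<rho> = (l\<^sup>2 * (n + 2 * \<rho>) - (n - 2 * \<rho>)) / 4"
    by (simp add: a_def b_def field_simps power2_eq_square)
  finally have 1: "ip d x' y' = 0" using l(3) by simp
  have "norm2 d x' + norm2 d y' = (a\<^sup>2 + b\<^sup>2) * n + 4 * a * b * \<rho>"
    unfolding x'_def y'_def norm2_combination[OF ip1] n1 by (simp add: n_def algebra_simps)
  also have "\<dots> = (l\<^sup>2 * (n + 2 * \<rho>) + (n - 2 * \<rho>)) / 2"
    by (simp add: a_def b_def field_simps power2_eq_square)
  also have "\<dots> = pdist2 d x y"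
    unfolding l(3) by (simp add: pdist2_def n_def \<rho>_def)
  finally have 2: "norm2 d x' + norm2 d y' = pdist2 d x y" .
  have "gap m d A x' y' \<le> gap m d A x y1"
    unfolding gap_def x'_def y'_def lin_add lin_cmult unfolding a_def b_def scaleR_conv_of_real[symmetric]
    by (rule sum_mono) (rule norm_diff_contract_le[OF l(1,2)])
  also have "\<dots> = gap m d A x y"
    using c(1) by (simp add: y1_def gap_phase)
  finally show ?thesis using 1 2 by blast
qed

abbreviation pairs :: "nat \<Rightarrow> ((nat \<Rightarrow> 'a) \<times> (nat \<Rightarrow> 'a)) set" where
  "pairs d \<equiv> {(x, y). pdist2 d x y \<noteq> 0}"

abbreviation ratio :: "nat \<Rightarrow> nat \<Rightarrow> (nat \<Rightarrow> nat \<Rightarrow> 'a) \<Rightarrow> (nat \<Rightarrow> 'a) \<times> (nat \<Rightarrow> 'a) \<Rightarrow> real" where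
  "ratio m d A p \<equiv> sqrt (gap m d A (fst p) (snd p)) / sqrt (pdist2 d (fst p) (snd p))"

lemma phaseless_pairs_eq:
  "phaseless_pairs d = (\<lambda>(x, y). (Matrix.vec d x, Matrix.vec d y)) ` pairs d"
proof (intro subset_antisym subsetI)
  fix p :: "'a Matrix.vec \<times> 'a Matrix.vec" assume p: "p \<in> phaseless_pairs d"
  obtain v w where vw: "p = (v, w)" "v \<in> carrier_vec d" "w \<in> carrier_vec d" "phase_dist v w \<noteq> 0"
    using p by (auto simp: phaseless_pairs_def)
  define x y where "x = (\<lambda>j. v $ j)" and "y = (\<lambda>j. w $ j)"
  have "v = Matrix.vec d x" "w = Matrix.vec d y"
    using vw by (auto simp: x_def y_def)
  then show "p \<in> (\<lambda>(x, y). (Matrix.vec d x, Matrix.vec d y)) ` pairs d"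
    using vw by (auto simp: phase_dist_vec intro!: image_eqI[of _ _ "(x, y)"])
qed (auto simp: phaseless_pairs_def phase_dist_vec)

lemma lower_lipschitz_eq:
  "lower_lipschitz (matrix_of m d A) = (INF p\<in>pairs d. ereal (ratio m d A p))"
  unfolding lower_lipschitz_def
  by (simp add: dim_col_matrix_of phaseless_pairs_eq image_image split_beta phaseless_ratio_def
      phase_dist_vec l2norm_gap)

lemma upper_lipschitz_eq:
  "upper_lipschitz (matrix_of m d A) = (SUP p\<in>pairs d. ereal (ratio m d A p))"
  unfolding upper_lipschitz_def
  by (simp add: dim_col_matrix_of phaseless_pairs_eq image_image split_beta phaseless_ratio_def
      phase_dist_vec l2norm_gap)

text \<open>After the reduction to an orthogonal pair, the gap and the squared distance scale alike,
  so the pair can be normalised. Pairs at small distance thus need no separate estimate.\<close>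

lemma lower_lipschitz_ge:
  assumes "0 \<le> l"
    and orth: "\<And>x y. ip d x y = 0 \<Longrightarrow> norm2 d x + norm2 d y = 1 \<Longrightarrow> l\<^sup>2 \<le> gap m d A x y"
  shows "ereal l \<le> lower_lipschitz (matrix_of m d A)"
  unfolding lower_lipschitz_eq
proof (rule INF_greatest)
  fix p assume p: "p \<in> pairs d"
  obtain x y where xy: "p = (x, y)" by (cases p)
  define D where "D = pdist2 d x y"
  have D: "0 < D" using p xy pdist2_nonneg[of d x y] by (auto simp: D_def less_le)
  obtain x' y' where r: "ip d x' y' = 0" "norm2 d x' + norm2 d y' = D" "gap m d A x' y' \<le> gap m d A x y"
    using orthogonal_reduction unfolding D_def by blast
  define c where "c = (of_real (1 / sqrt D) :: 'a)"
  have c: "(norm c)\<^sup>2 = 1 / D" using D by (simp add: c_def power_divide norm_divide)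
  have "l\<^sup>2 \<le> gap m d A (\<lambda>j. c * x' j) (\<lambda>j. c * y' j)"
  proof (rule orth)
    have "ip d (\<lambda>j. c * x' j) (\<lambda>j. c * y' j) = c * cj c * ip d x' y'"
      by (simp add: ip_def cj_mult sum_distrib_left mult_ac)
    then show "ip d (\<lambda>j. c * x' j) (\<lambda>j. c * y' j) = 0" by (simp add: r)
    show "norm2 d (\<lambda>j. c * x' j) + norm2 d (\<lambda>j. c * y' j) = 1"
      unfolding norm2_cmult distrib_left[symmetric] r c using D by simp
  qed
  also have "\<dots> = gap m d A x' y' / D" by (simp add: gap_cmult c)
  also have "\<dots> \<le> gap m d A x y / D" using r D by (simp add: divide_right_mono)
  finally have "sqrt (l\<^sup>2) \<le> sqrt (gap m d A x y / D)" by (rule real_sqrt_le_mono)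
  then show "ereal l \<le> ereal (ratio m d A p)"
    using assms(1) by (simp add: xy D_def real_sqrt_divide)
qed

text \<open>The gap ignores a phase on \<open>y\<close>, so \<open>y\<close> may first be aligned
  optimally with \<open>x\<close>; then the reverse triangle inequality in each row bounds the gap
  by the energy of the difference.\<close>

lemma upper_lipschitz_le:
  fixes A :: "nat \<Rightarrow> nat \<Rightarrow> 'a"
  assumes "0 \<le> B" and "\<And>x. energy m d A x \<le> B\<^sup>2 * norm2 d x"
  shows "upper_lipschitz (matrix_of m d A) \<le> ereal B"
  unfolding upper_lipschitz_eq
proof (rule SUP_least)
  fix p assume p: "p \<in> pairs d"
  obtain x y where xy: "p = (x, y)" by (cases p)
  define D where "D = pdist2 d x y"
  have D: "0 < D" using p xy pdist2_nonneg[of d x y] by (auto simp: D_def less_le)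
  obtain c where c: "norm c = 1" "norm2 d (\<lambda>j. x j - c * y j) = D"
    using pdist2_attained D_def by blast
  have "gap m d A x y \<le> energy m d A (\<lambda>j. x j - c * y j)"
    using gap_le_energy[of m d A x "\<lambda>j. c * y j"] c(1) by (simp add: gap_phase)
  also have "\<dots> \<le> B\<^sup>2 * D" using assms(2) c(2) by metis
  finally have "sqrt (gap m d A x y / D) \<le> sqrt (B\<^sup>2)"
    using D by (intro real_sqrt_le_mono) (simp add: pos_divide_le_eq)
  then show "ereal (ratio m d A p) \<le> ereal B"
    using assms(1) by (simp add: xy D_def real_sqrt_divide)
qed

text \<open>A crude bound by the Frobenius norm. It serves to make suprema finite; its size never
  enters the estimates.\<close>

lemma energy_bounded:
  fixes A :: "nat \<Rightarrow> nat \<Rightarrow> 'a"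
  shows "\<exists>B\<ge>0. \<forall>x. energy m d A x \<le> B\<^sup>2 * norm2 d x"
proof -
  have lin: "(norm (lin d a x))\<^sup>2 \<le> norm2 d a * norm2 d x" for a x :: "nat \<Rightarrow> 'a"
  proof -
    have "norm (lin d a x) \<le> (\<Sum>j<d. \<bar>norm (a j)\<bar> * \<bar>norm (x j)\<bar>)"
      unfolding lin_def by (rule order.trans[OF norm_sum]) (simp add: norm_mult)
    also have "\<dots> \<le> L2_set (\<lambda>j. norm (a j)) {..<d} * L2_set (\<lambda>j. norm (x j)) {..<d}"
      by (rule L2_set_mult_ineq)
    finally have "(norm (lin d a x))\<^sup>2 \<le> (L2_set (\<lambda>j. norm (a j)) {..<d} * L2_set (\<lambda>j. norm (x j)) {..<d})\<^sup>2"
      by (intro power_mono) auto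
    then show ?thesis by (simp add: L2_set_def power_mult_distrib norm2_def sum_nonneg)
  qed
  define F where "F = (\<Sum>i<m. norm2 d (A i))"
  have F: "0 \<le> F" by (simp add: F_def sum_nonneg)
  have "energy m d A x \<le> F * norm2 d x" for x
    unfolding energy_def F_def sum_distrib_right by (intro sum_mono lin)
  then show ?thesis using F by (intro exI[of _ "sqrt F"]) auto
qed

end

subsection \<open>Scalar Gaussian laws and tail bounds\<close>

text \<open>Markov's inequality for the exponential of the sum, which factors over the independent
  rows. \<open>F\<close> may take negative values: a positive multiple of a squared form gives the
  upper tail of the energy, a negative multiple of the squared difference the lower tail of the
  gap.\<close>

lemma chernoff_iid:
  fixes F :: "'b \<Rightarrow> real" and k s :: real
  assumes "prob_space R" and F[measurable]: "F \<in> borel_measurable R"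
    and bound: "(\<integral>\<^sup>+a. ennreal (exp (F a)) \<partial>R) \<le> ennreal (exp k)"
  shows "measure (PiM {..<m} (\<lambda>_. R))
      {\<omega> \<in> space (PiM {..<m} (\<lambda>_. R)). real m * (k + s) \<le> (\<Sum>i<m. F (\<omega> i))} \<le> exp (- real m * s)"
proof -
  interpret R: prob_space R by fact
  interpret M: prob_space "PiM {..<m} (\<lambda>_. R)" by (rule prob_space_PiM) (rule assms(1))
  interpret P: product_prob_space "\<lambda>_. R" "{..<m}" ..
  let ?M = "PiM {..<m} (\<lambda>_. R)"
  let ?A = "{\<omega> \<in> space ?M. real m * (k + s) \<le> (\<Sum>i<m. F (\<omega> i))}"
  have A[measurable]: "?A \<in> sets ?M" by measurable
  have "emeasure ?M ?A = (\<integral>\<^sup>+\<omega>. indicator ?A \<omega> \<partial>?M)" by simp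
  also have "\<dots> \<le> (\<integral>\<^sup>+\<omega>. ennreal (exp (- real m * (k + s))) * (\<Prod>i<m. ennreal (exp (F (\<omega> i)))) \<partial>?M)"
  proof (rule nn_integral_mono)
    fix \<omega>
    have "(\<Prod>i<m. ennreal (exp (F (\<omega> i)))) = ennreal (exp (\<Sum>i<m. F (\<omega> i)))"
      by (simp add: prod_ennreal exp_sum)
    then have "ennreal (exp (- real m * (k + s))) * (\<Prod>i<m. ennreal (exp (F (\<omega> i)))) =
        ennreal (exp ((\<Sum>i<m. F (\<omega> i)) - real m * (k + s)))"
      by (simp add: ennreal_mult[symmetric] exp_add[symmetric])
    then show "indicator ?A \<omega> \<le> ennreal (exp (- real m * (k + s))) * (\<Prod>i<m. ennreal (exp (F (\<omega> i))))"
      by (auto split: split_indicator)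
  qed
  also have "\<dots> = ennreal (exp (- real m * (k + s))) * (\<Prod>i<m. (\<integral>\<^sup>+a. ennreal (exp (F a)) \<partial>R))"
    by (subst nn_integral_cmult, measurable) (subst P.product_nn_integral_prod, auto)
  also have "\<dots> \<le> ennreal (exp (- real m * (k + s))) * (\<Prod>i<m. ennreal (exp k))"
    using bound by (simp add: mult_left_mono power_mono)
  also have "\<dots> = ennreal (exp (- real m * s))"
    by (simp add: prod_ennreal ennreal_mult[symmetric] ennreal_power exp_of_nat_mult[symmetric] exp_add[symmetric] algebra_simps)
  finally show ?thesis by (simp add: M.emeasure_eq_measure)
qed

lemma rotation_exists:
  fixes p u :: real
  shows "\<exists>c s. c\<^sup>2 + s\<^sup>2 = 1 \<and> p = c * sqrt (p\<^sup>2 + u\<^sup>2) \<and> u = s * sqrt (p\<^sup>2 + u\<^sup>2)"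
proof (cases "p\<^sup>2 + u\<^sup>2 = 0")
  case True
  then show ?thesis by (intro exI[of _ 1] exI[of _ 0]) (auto simp: sum_power2_eq_zero_iff)
next
  case False
  then have pos: "0 < p\<^sup>2 + u\<^sup>2" by (simp add: sum_power2_gt_zero_iff sum_power2_eq_zero_iff)
  then have "(p / sqrt (p\<^sup>2 + u\<^sup>2))\<^sup>2 + (u / sqrt (p\<^sup>2 + u\<^sup>2))\<^sup>2 = 1"
    by (simp add: power_divide add_divide_distrib[symmetric] del: sum_power2_gt_zero_iff sum_power2_eq_zero_iff)
  with pos show ?thesis
    by (intro exI[of _ "p / sqrt (p\<^sup>2 + u\<^sup>2)"] exI[of _ "u / sqrt (p\<^sup>2 + u\<^sup>2)"]) auto
qed

text \<open>The structural input is invariance of one scalar under phases and of two independent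
  scalars under plane rotations, phrased as iterated integrals. The moment constants cover both
  fields: 3 is the fourth moment in the real case, and the bound in \<open>mgf_G\<close> dominates
  both \<open>1 / sqrt (1 - 2 * t)\<close> and \<open>1 / (1 - t)\<close>.\<close>

locale gaussian_field = conj_field cj for cj :: "'a::{real_normed_field, euclidean_space} \<Rightarrow> 'a" +
  fixes G :: "'a measure" and \<mu> :: real
  assumes sets_G [measurable_cong]: "sets G = sets borel"
    and prob_G: "prob_space G"
    and phase_inv: "\<And>c f. norm c = 1 \<Longrightarrow> f \<in> borel_measurable borel \<Longrightarrow>
      (\<integral>\<^sup>+g. f (c * g) \<partial>G) = (\<integral>\<^sup>+g. f g \<partial>G)"
    and rot_inv: "\<And>c s f. c\<^sup>2 + s\<^sup>2 = 1 \<Longrightarrow> f \<in> borel_measurable (borel \<Otimes>\<^sub>M borel) \<Longrightarrow>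
      (\<integral>\<^sup>+g. \<integral>\<^sup>+h. f (of_real c * g + of_real s * h, of_real c * h - of_real s * g) \<partial>G \<partial>G) =
      (\<integral>\<^sup>+g. \<integral>\<^sup>+h. f (g, h) \<partial>G \<partial>G)"
    and mean_G: "(\<integral>\<^sup>+g. ennreal (norm g) \<partial>G) = ennreal \<mu>"
    and second_G: "(\<integral>\<^sup>+g. ennreal ((norm g)\<^sup>2) \<partial>G) = 1"
    and fourth_G: "(\<integral>\<^sup>+g. ennreal ((norm g)^4) \<partial>G) \<le> 3"
    and mgf_G: "0 \<le> t \<Longrightarrow> t \<le> 1/4 \<Longrightarrow>
      (\<integral>\<^sup>+g. ennreal (exp (t * (norm g)\<^sup>2)) \<partial>G) \<le> ennreal (exp (t + 4 * t\<^sup>2))"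
    and mu: "0 \<le> \<mu>" "\<mu>\<^sup>2 < 1"
begin

sublocale G: prob_space G by (rule prob_G)

sublocale GG: pair_sigma_finite G G ..

abbreviation row :: "nat \<Rightarrow> (nat \<Rightarrow> 'a) measure" where
  "row d \<equiv> PiM {..<d} (\<lambda>_. G)"

sublocale P: product_prob_space "\<lambda>_::nat. G" UNIV ..

lemma prob_row: "prob_space (row d)"
  by (rule prob_space_PiM) (rule prob_G)

lemma measurable_lin [measurable]: "(\<lambda>a. lin d a x) \<in> borel_measurable (row d)"
proof -
  have "(\<lambda>a. a j) \<in> borel_measurable (row d)" if "j \<in> {..<d}" for j
    using measurable_component_singleton[OF that, of "\<lambda>_. G"] measurable_cong_sets[OF refl sets_G] by blast
  then show ?thesis unfolding lin_def by measurable
qed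

lemma phase_real:
  assumes [measurable]: "f \<in> borel_measurable borel"
  shows "(\<integral>\<^sup>+g. f (w * g) \<partial>G) = (\<integral>\<^sup>+g. f (of_real (norm w) * g) \<partial>G)"
proof (cases "w = 0")
  case False
  define c where "c = w * of_real (inverse (norm w))"
  have c: "norm c = 1" using False by (simp add: c_def norm_mult norm_inverse)
  have w: "w = of_real (norm w) * c" using False by (simp add: c_def)
  have "(\<integral>\<^sup>+g. f (w * g) \<partial>G) = (\<integral>\<^sup>+g. f (of_real (norm w) * (c * g)) \<partial>G)"
    by (subst w) (simp add: mult.assoc)
  also have "\<dots> = (\<integral>\<^sup>+g. f (of_real (norm w) * g) \<partial>G)"
    by (rule phase_inv[OF c]) measurable
  finally show ?thesis .
qed simp

lemma rot_inv':
  assumes cs: "c\<^sup>2 + s\<^sup>2 = 1" and [measurable]: "f \<in> borel_measurable (borel \<Otimes>\<^sub>M borel)"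
  shows "(\<integral>\<^sup>+g. \<integral>\<^sup>+h. f (g, h) \<partial>G \<partial>G) =
    (\<integral>\<^sup>+g. \<integral>\<^sup>+h. f (of_real c * g - of_real s * h, of_real s * g + of_real c * h) \<partial>G \<partial>G)"
proof -
  have "c\<^sup>2 + (- s)\<^sup>2 = 1" using cs by simp
  from rot_inv[OF this, of f] show ?thesis by (simp add: algebra_simps)
qed

text \<open>Rotating the coefficient vector (r, u) onto the first axis leaves an integrand that
  depends on one scalar, and the other integrates to 1.\<close>

lemma rotate_sum:
  assumes [measurable]: "f \<in> borel_measurable borel"
  shows "(\<integral>\<^sup>+g. \<integral>\<^sup>+h. f (of_real r * g + of_real u * h) \<partial>G \<partial>G) =
    (\<integral>\<^sup>+g. f (of_real (sqrt (r\<^sup>2 + u\<^sup>2)) * g) \<partial>G)"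
proof -
  obtain c s where cs: "c\<^sup>2 + s\<^sup>2 = 1" "r = c * sqrt (r\<^sup>2 + u\<^sup>2)" "u = s * sqrt (r\<^sup>2 + u\<^sup>2)"
    using rotation_exists by blast
  define q where "q = sqrt (r\<^sup>2 + u\<^sup>2)"
  have "of_real r * g + of_real u * h = of_real q * (of_real c * g + of_real s * h)" for g h :: 'a
    using arg_cong[OF cs(2), of "of_real :: real \<Rightarrow> 'a"] arg_cong[OF cs(3), of "of_real :: real \<Rightarrow> 'a"]
    by (simp add: q_def[symmetric] algebra_simps)
  then have "(\<integral>\<^sup>+g. \<integral>\<^sup>+h. f (of_real r * g + of_real u * h) \<partial>G \<partial>G) =
      (\<integral>\<^sup>+g. \<integral>\<^sup>+h. (\<lambda>(a, b). f (of_real q * a)) (of_real c * g + of_real s * h, of_real c * h - of_real s * g) \<partial>G \<partial>G)"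
    by simp
  also have "\<dots> = (\<integral>\<^sup>+g. \<integral>\<^sup>+h. f (of_real q * g) \<partial>G \<partial>G)"
    by (subst rot_inv[OF cs(1)]) (simp_all, measurable)
  finally show ?thesis by (simp add: q_def G.emeasure_space_1)
qed

text \<open>The triple (p, q, r) is the Cholesky factor of the Gram matrix of (x, y), updated by one
  unitary rotation per coordinate.\<close>

lemma joint_law:
  "\<exists>p q r. 0 \<le> p \<and> 0 \<le> r \<and> p\<^sup>2 = norm2 d x \<and> of_real p * q = ip d y x \<and>
     (norm q)\<^sup>2 + r\<^sup>2 = norm2 d y \<and>
     (\<forall>f \<in> borel_measurable (borel \<Otimes>\<^sub>M borel). (\<integral>\<^sup>+a. f (lin d a x, lin d a y) \<partial>row d) =
        (\<integral>\<^sup>+g. \<integral>\<^sup>+h. f (of_real p * g, q * g + of_real r * h) \<partial>G \<partial>G))"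
proof (induction d)
  case 0
  have "(\<integral>\<^sup>+a. f (lin 0 a x, lin 0 a y) \<partial>row 0) = f (0, 0)" for f :: "'a \<times> 'a \<Rightarrow> ennreal"
    by (simp add: lin_def nn_integral_const PiM_empty nn_integral_count_space_finite)
  then show ?case
    by (intro exI[of _ 0]) (simp add: norm2_def ip_def G.emeasure_space_1)
next
  case (Suc d)
  then obtain p q r where IH: "0 \<le> p" "0 \<le> r" "p\<^sup>2 = norm2 d x" "of_real p * q = ip d y x"
      "(norm q)\<^sup>2 + r\<^sup>2 = norm2 d y"
    and law: "\<And>f. f \<in> borel_measurable (borel \<Otimes>\<^sub>M borel) \<Longrightarrow> (\<integral>\<^sup>+a. f (lin d a x, lin d a y) \<partial>row d) =
        (\<integral>\<^sup>+g. \<integral>\<^sup>+h. f (of_real p * g, q * g + of_real r * h) \<partial>G \<partial>G)"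
    by blast
  define u where "u = norm (x d)"
  \<comment> \<open>A phase on the new Gaussian entry makes its coefficient in the first form real
    and nonnegative, so that a real rotation can merge it with the term in \<open>p\<close>.\<close>
  obtain c0 where c0: "norm c0 = 1" "x d * c0 = of_real u"
  proof (cases "x d = 0")
    case True
    then show ?thesis using that[of 1] by (simp add: u_def)
  next
    case False
    have "x d * (cj (x d) * of_real (inverse u)) = of_real (u\<^sup>2 * inverse u)"
      using mult_cj[of "x d"] by (simp add: u_def mult.assoc[symmetric])
    also have "u\<^sup>2 * inverse u = u" using False by (simp add: u_def power2_eq_square)
    finally show ?thesis
      using False that[of "cj (x d) * of_real (inverse u)"] by (simp add: norm_mult norm_cj norm_inverse u_def)
  qed
  define \<eta> where "\<eta> = y d * c0"
  \<comment> \<open>This rotation takes (p, u) to (p', 0). The rotated new entry drops out of the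
    first form and stays in the second with coefficient \<open>w\<close>, whose modulus is then
    combined with \<open>r\<close> into \<open>r'\<close>.\<close>
  obtain c s where cs: "c\<^sup>2 + s\<^sup>2 = 1" "p = c * sqrt (p\<^sup>2 + u\<^sup>2)" "u = s * sqrt (p\<^sup>2 + u\<^sup>2)"
    using rotation_exists by blast
  define p' where "p' = sqrt (p\<^sup>2 + u\<^sup>2)"
  define q' where "q' = q * of_real c + \<eta> * of_real s"
  define w where "w = \<eta> * of_real c - q * of_real s"
  define r' where "r' = sqrt (r\<^sup>2 + (norm w)\<^sup>2)"
  have pp: "p = c * p'" "u = s * p'" using cs by (auto simp: p'_def)
  have "p'\<^sup>2 = norm2 (Suc d) x"
    using IH(3)[symmetric] by (simp add: p'_def norm2_def u_def)
  moreover have "of_real p' * q' = ip (Suc d) y x"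
  proof -
    have "of_real p' * q' = q * of_real (c * p') + \<eta> * of_real (s * p')"
      by (simp add: q'_def algebra_simps)
    also have "\<dots> = q * of_real p + \<eta> * of_real u" using pp by simp
    also have "\<eta> * of_real u = y d * cj (x d)"
    proof -
      have "cj (x d) * cj c0 = of_real u"
        using arg_cong[OF c0(2), of cj] by (simp add: cj_mult cj_of_real)
      then have "c0 * of_real u = cj (x d) * (c0 * cj c0)" by (metis mult.left_commute)
      then have "c0 * of_real u = cj (x d)" using mult_cj[of c0] c0(1) by simp
      then show ?thesis by (simp add: \<eta>_def mult.assoc)
    qed
    finally show ?thesis using IH(4) by (simp add: ip_def mult.commute)
  qed
  moreover have "(norm q')\<^sup>2 + r'\<^sup>2 = norm2 (Suc d) y"
  proof -
    have "(norm (q * of_real c + \<eta> * of_real s))\<^sup>2 + (norm (\<eta> * of_real c - q * of_real s))\<^sup>2 =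
       (c\<^sup>2 + s\<^sup>2) * ((norm q)\<^sup>2 + (norm \<eta>)\<^sup>2)"
    proof -
      have e: "z * of_real t = t *\<^sub>R z" for z :: 'a and t by (simp add: scaleR_conv_of_real mult.commute)
      show ?thesis unfolding e power2_norm_eq_inner
        by (simp add: inner_add_left inner_add_right inner_diff_left inner_diff_right inner_commute algebra_simps power2_eq_square)
    qed
    moreover have "norm \<eta> = norm (y d)" using c0 by (simp add: \<eta>_def norm_mult)
    ultimately show ?thesis using IH(5) cs(1)
      by (simp add: r'_def q'_def w_def norm2_def)
  qed
  moreover have "(\<integral>\<^sup>+a. f (lin (Suc d) a x, lin (Suc d) a y) \<partial>row (Suc d)) =
        (\<integral>\<^sup>+g. \<integral>\<^sup>+h. f (of_real p' * g, q' * g + of_real r' * h) \<partial>G \<partial>G)"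
    if f[measurable]: "f \<in> borel_measurable (borel \<Otimes>\<^sub>M borel)" for f
  proof -
    have upd: "lin (Suc d) (a(d := g)) z = lin d a z + g * z d" for a g and z :: "nat \<Rightarrow> 'a"
      by (simp add: lin_def)
    have "(\<integral>\<^sup>+a. f (lin (Suc d) a x, lin (Suc d) a y) \<partial>row (Suc d)) =
        (\<integral>\<^sup>+a. (\<integral>\<^sup>+g. f (lin (Suc d) (a(d := g)) x, lin (Suc d) (a(d := g)) y) \<partial>G) \<partial>row d)"
      unfolding lessThan_Suc
      by (rule P.product_nn_integral_insert) (simp_all add: lessThan_Suc[symmetric])
    also have "\<dots> = (\<integral>\<^sup>+a. (\<lambda>(u, v). \<integral>\<^sup>+g. f (u + g * x d, v + g * y d) \<partial>G) (lin d a x, lin d a y) \<partial>row d)"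
      by (simp add: upd)
    also have "\<dots> = (\<integral>\<^sup>+g1. \<integral>\<^sup>+g2. \<integral>\<^sup>+g.
        f (of_real p * g1 + g * x d, (q * g1 + of_real r * g2) + g * y d) \<partial>G \<partial>G \<partial>G)"
      by (subst law) (simp_all, measurable)
    also have "\<dots> = (\<integral>\<^sup>+g1. \<integral>\<^sup>+g2. \<integral>\<^sup>+g.
        f (of_real p * g1 + (c0 * g) * x d, (q * g1 + of_real r * g2) + (c0 * g) * y d) \<partial>G \<partial>G \<partial>G)"
      by (intro nn_integral_cong phase_inv[OF c0(1), symmetric]) measurable
    also have "\<dots> = (\<integral>\<^sup>+g1. \<integral>\<^sup>+g2. \<integral>\<^sup>+g.
        f (of_real p * g1 + of_real u * g, (q * g1 + \<eta> * g) + of_real r * g2) \<partial>G \<partial>G \<partial>G)"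
      by (simp add: c0(2)[symmetric] \<eta>_def algebra_simps)
    \<comment> \<open>The rotation mixes \<open>g1\<close> and \<open>g\<close>, so
      \<open>g2\<close> is moved outermost and held fixed.\<close>
    also have "\<dots> = (\<integral>\<^sup>+g2. \<integral>\<^sup>+g1. \<integral>\<^sup>+g.
        f (of_real p * g1 + of_real u * g, (q * g1 + \<eta> * g) + of_real r * g2) \<partial>G \<partial>G \<partial>G)"
      by (rule GG.Fubini') measurable
    also have "\<dots> = (\<integral>\<^sup>+g2. \<integral>\<^sup>+g1. \<integral>\<^sup>+g.
        f (of_real p' * g1, (q' * g1 + w * g) + of_real r * g2) \<partial>G \<partial>G \<partial>G)"
    proof (rule nn_integral_cong)
      fix g2
      define F where "F = (\<lambda>(g1, g). f (of_real p * g1 + of_real u * g, (q * g1 + \<eta> * g) + of_real r * g2))"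
      have [measurable]: "F \<in> borel_measurable (borel \<Otimes>\<^sub>M borel)" unfolding F_def by measurable
      have "of_real p * (of_real c * g1 - of_real s * g) + of_real u * (of_real s * g1 + of_real c * g) = of_real p' * g1"
        for g1 g :: 'a
      proof -
        have "of_real p * (of_real c * g1 - of_real s * g) + of_real u * (of_real s * g1 + of_real c * g) =
          of_real (p' * (c\<^sup>2 + s\<^sup>2)) * g1"
          by (simp add: pp algebra_simps power2_eq_square)
        then show ?thesis by (simp add: cs(1))
      qed
      moreover have "q * (of_real c * g1 - of_real s * g) + \<eta> * (of_real s * g1 + of_real c * g) = q' * g1 + w * g"
        for g1 g :: 'a
        by (simp add: q'_def w_def algebra_simps)
      ultimately have "F (of_real c * g1 - of_real s * g, of_real s * g1 + of_real c * g) =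
          f (of_real p' * g1, (q' * g1 + w * g) + of_real r * g2)" for g1 g
        by (simp add: F_def)
      moreover have "F (g1, g) = f (of_real p * g1 + of_real u * g, (q * g1 + \<eta> * g) + of_real r * g2)" for g1 g
        by (simp add: F_def)
      ultimately show "(\<integral>\<^sup>+g1. \<integral>\<^sup>+g. f (of_real p * g1 + of_real u * g, (q * g1 + \<eta> * g) + of_real r * g2) \<partial>G \<partial>G)
         = (\<integral>\<^sup>+g1. \<integral>\<^sup>+g. f (of_real p' * g1, (q' * g1 + w * g) + of_real r * g2) \<partial>G \<partial>G)"
        using rot_inv'[OF cs(1), of F] by simp
    qed
    also have "\<dots> = (\<integral>\<^sup>+g1. \<integral>\<^sup>+g2. \<integral>\<^sup>+g.
        f (of_real p' * g1, (q' * g1 + w * g) + of_real r * g2) \<partial>G \<partial>G \<partial>G)"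
      by (rule GG.Fubini') measurable
    also have "\<dots> = (\<integral>\<^sup>+g1. \<integral>\<^sup>+g2. \<integral>\<^sup>+g.
        f (of_real p' * g1, (q' * g1 + of_real (norm w) * g) + of_real r * g2) \<partial>G \<partial>G \<partial>G)"
      by (intro nn_integral_cong phase_real[of "\<lambda>v. f (of_real p' * _, (q' * _ + v) + of_real r * _)"]) measurable
    also have "\<dots> = (\<integral>\<^sup>+g1. \<integral>\<^sup>+g2. \<integral>\<^sup>+g.
        f (of_real p' * g1, q' * g1 + (of_real r * g2 + of_real (norm w) * g)) \<partial>G \<partial>G \<partial>G)"
      by (simp add: algebra_simps)
    also have "\<dots> = (\<integral>\<^sup>+g1. \<integral>\<^sup>+h. f (of_real p' * g1, q' * g1 + of_real r' * h) \<partial>G \<partial>G)"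
      unfolding r'_def
      by (intro nn_integral_cong rotate_sum[of "\<lambda>v. f (of_real p' * _, q' * _ + v)"]) measurable
    finally show ?thesis .
  qed
  moreover have "0 \<le> p'" "0 \<le> r'" by (auto simp: p'_def r'_def)
  ultimately show ?case by blast
qed

lemma marginal_law:
  assumes f[measurable]: "f \<in> borel_measurable borel"
  shows "(\<integral>\<^sup>+a. f (lin d a x) \<partial>row d) = (\<integral>\<^sup>+g. f (of_real (sqrt (norm2 d x)) * g) \<partial>G)"
proof -
  obtain p q r where p: "0 \<le> p" "p\<^sup>2 = norm2 d x"
    and law: "\<And>f. f \<in> borel_measurable (borel \<Otimes>\<^sub>M borel) \<Longrightarrow> (\<integral>\<^sup>+a. f (lin d a x, lin d a x) \<partial>row d) =
        (\<integral>\<^sup>+g. \<integral>\<^sup>+h. f (of_real p * g, q * g + of_real r * h) \<partial>G \<partial>G)"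
    using joint_law[of d x x] by blast
  have "p = sqrt (norm2 d x)" using p by (metis real_sqrt_unique)
  then show ?thesis
    using law[of "\<lambda>(a, b). f a"] by (simp add: G.emeasure_space_1)
qed

lemma orthogonal_law:
  assumes f[measurable]: "f \<in> borel_measurable (borel \<Otimes>\<^sub>M borel)" and orth: "ip d x y = 0"
  shows "(\<integral>\<^sup>+a. f (lin d a x, lin d a y) \<partial>row d) =
    (\<integral>\<^sup>+g. \<integral>\<^sup>+h. f (of_real (sqrt (norm2 d x)) * g, of_real (sqrt (norm2 d y)) * h) \<partial>G \<partial>G)"
\<comment> \<open>The identity \<open>of_real p * q = ip d y x\<close> forces \<open>q = 0\<close>
  only for nonzero \<open>p\<close>. If \<open>p\<close> vanishes, the first form is constantly 0
  and the marginal law of the second suffices.\<close>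
proof (cases "norm2 d x = 0")
  case False
  obtain p q r where p: "0 \<le> p" "0 \<le> r" "p\<^sup>2 = norm2 d x" "of_real p * q = ip d y x" "(norm q)\<^sup>2 + r\<^sup>2 = norm2 d y"
    and law: "\<And>f. f \<in> borel_measurable (borel \<Otimes>\<^sub>M borel) \<Longrightarrow> (\<integral>\<^sup>+a. f (lin d a x, lin d a y) \<partial>row d) =
        (\<integral>\<^sup>+g. \<integral>\<^sup>+h. f (of_real p * g, q * g + of_real r * h) \<partial>G \<partial>G)"
    using joint_law[of d x y] by blast
  have "of_real p * q = 0" using p(4) orth by (simp add: ip_commute[of d y x] cj_0)
  then have "q = 0" using False p(3) by auto
  moreover have "p = sqrt (norm2 d x)" using p by (metis real_sqrt_unique)
  moreover have "r = sqrt (norm2 d y)" using p \<open>q = 0\<close> by (metis add_0 norm_zero power_zero_numeral real_sqrt_unique)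
  ultimately show ?thesis using law[OF f] by simp
next
  case True
  then have x0: "\<forall>j<d. x j = 0"
    by (simp add: norm2_def sum_nonneg_eq_0_iff)
  then have l0: "lin d a x = 0" for a by (simp add: lin_def)
  have "(\<integral>\<^sup>+a. f (lin d a x, lin d a y) \<partial>row d) = (\<integral>\<^sup>+g. f (0, of_real (sqrt (norm2 d y)) * g) \<partial>G)"
    unfolding l0 by (rule marginal_law) measurable
  then show ?thesis using True by (simp add: G.emeasure_space_1)
qed

end

section \<open>Exponential tails for a fixed unit vector and a fixed orthogonal pair\<close>

context gaussian_field
begin

lemma energy_tail:
  assumes x: "norm2 d x = 1" and e: "0 < e" "e \<le> 1"
  shows "measure (PiM {..<m} (\<lambda>_. row d))
      {\<omega> \<in> space (PiM {..<m} (\<lambda>_. row d)). real m * (1 + e) \<le> energy m d \<omega> x} \<le> exp (- real m * e\<^sup>2 / 16)"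
proof -
  \<comment> \<open>The maximiser of t e - 4 t^2, with value e^2 / 16; \<open>e \<le> 1\<close>
    keeps it within the range of \<open>mgf_G\<close>.\<close>
  define t where "t = e / 8"
  have t: "0 < t" "t \<le> 1 / 4" using e by (auto simp: t_def)
  let ?F = "\<lambda>a. t * (norm (lin d a x))\<^sup>2"
  have "(\<integral>\<^sup>+a. ennreal (exp (?F a)) \<partial>row d) = (\<integral>\<^sup>+g. ennreal (exp (t * (norm g)\<^sup>2)) \<partial>G)"
    using marginal_law[of "\<lambda>z. ennreal (exp (t * (norm z)\<^sup>2))" d x] x by simp
  also have "\<dots> \<le> ennreal (exp (t + 4 * t\<^sup>2))"
    using t by (intro mgf_G) auto
  finally have "measure (PiM {..<m} (\<lambda>_. row d)) {\<omega> \<in> space (PiM {..<m} (\<lambda>_. row d)).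
      real m * ((t + 4 * t\<^sup>2) + (t * e - 4 * t\<^sup>2)) \<le> (\<Sum>i<m. ?F (\<omega> i))} \<le> exp (- real m * (t * e - 4 * t\<^sup>2))"
    by (intro chernoff_iid prob_row) auto
  moreover have "real m * ((t + 4 * t\<^sup>2) + (t * e - 4 * t\<^sup>2)) \<le> (\<Sum>i<m. ?F (\<omega> i)) \<longleftrightarrow>
      real m * (1 + e) \<le> energy m d \<omega> x" for \<omega>
  proof -
    have "(\<Sum>i<m. ?F (\<omega> i)) = t * energy m d \<omega> x" by (simp add: energy_def sum_distrib_left)
    moreover have "real m * ((t + 4 * t\<^sup>2) + (t * e - 4 * t\<^sup>2)) = t * (real m * (1 + e))" by (simp add: algebra_simps)
    ultimately show ?thesis using t by (simp only: mult_le_cancel_left_pos)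
  qed
  moreover have "- real m * (t * e - 4 * t\<^sup>2) = - real m * e\<^sup>2 / 16"
    by (simp add: t_def power2_eq_square field_simps)
  ultimately show ?thesis by (simp only:)
qed

lemma mean_abs_product:
  assumes "ip d x y = 0"
  shows "(\<integral>\<^sup>+a. ennreal (norm (lin d a x) * norm (lin d a y)) \<partial>row d) =
    ennreal (sqrt (norm2 d x) * sqrt (norm2 d y) * \<mu>\<^sup>2)"
proof -
  have "(\<integral>\<^sup>+a. ennreal (norm (lin d a x) * norm (lin d a y)) \<partial>row d) =
    (\<integral>\<^sup>+g. \<integral>\<^sup>+h. ennreal (sqrt (norm2 d x) * norm g * (sqrt (norm2 d y) * norm h)) \<partial>G \<partial>G)"
    using orthogonal_law[of "\<lambda>(u, v). ennreal (norm u * norm v)", OF _ assms] by (simp add: norm_mult)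
  also have "\<dots> = (\<integral>\<^sup>+g. \<integral>\<^sup>+h. ennreal (sqrt (norm2 d x) * sqrt (norm2 d y)) * ennreal (norm g) * ennreal (norm h) \<partial>G \<partial>G)"
    by (simp add: ennreal_mult[symmetric] mult_ac)
  also have "\<dots> = ennreal (sqrt (norm2 d x) * sqrt (norm2 d y)) * ennreal \<mu> * ennreal \<mu>"
    by (simp add: nn_integral_cmult nn_integral_multc mean_G)
  finally show ?thesis using mu by (simp add: ennreal_mult[symmetric] power2_eq_square mult_ac)
qed

lemma mean_square: "(\<integral>\<^sup>+a. ennreal ((norm (lin d a x))\<^sup>2) \<partial>row d) = ennreal (norm2 d x)"
proof -
  have "(\<integral>\<^sup>+a. ennreal ((norm (lin d a x))\<^sup>2) \<partial>row d) = (\<integral>\<^sup>+g. ennreal (norm2 d x) * ennreal ((norm g)\<^sup>2) \<partial>G)"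
    using marginal_law[of "\<lambda>z. ennreal ((norm z)\<^sup>2)" d x]
    by (simp add: norm_mult power_mult_distrib ennreal_mult[symmetric])
  then show ?thesis by (simp add: nn_integral_cmult second_G)
qed

lemma mean_fourth: "(\<integral>\<^sup>+a. ennreal ((norm (lin d a x))^4) \<partial>row d) \<le> ennreal (3 * (norm2 d x)\<^sup>2)"
proof -
  have s4: "(sqrt (norm2 d x))^4 = (norm2 d x)\<^sup>2"
    by (metis mult_2 numeral_Bit0 power2_eq_square power_add norm2_nonneg real_sqrt_pow2)
  have "(\<integral>\<^sup>+a. ennreal ((norm (lin d a x))^4) \<partial>row d) = (\<integral>\<^sup>+g. ennreal ((norm2 d x)\<^sup>2) * ennreal ((norm g)^4) \<partial>G)"
    using marginal_law[of "\<lambda>z. ennreal ((norm z)^4)" d x]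
    by (simp add: norm_mult power_mult_distrib ennreal_mult[symmetric] s4)
  also have "\<dots> = ennreal ((norm2 d x)\<^sup>2) * (\<integral>\<^sup>+g. ennreal ((norm g)^4) \<partial>G)"
    by (simp add: nn_integral_cmult)
  also have "\<dots> \<le> ennreal ((norm2 d x)\<^sup>2) * 3"
    by (intro mult_left_mono fourth_G) auto
  also have "\<dots> = ennreal (3 * (norm2 d x)\<^sup>2)"
    by (simp add: ennreal_mult' mult.commute)
  finally show ?thesis .
qed

text \<open>As the squared difference \<open>X\<close> is nonnegative, exp (-t X) <= 1 - t X + t^2
  X^2 / 2 for every t >= 0, so the first two moments suffice. The mean is 1 - 2 z with 2 z at most
  \<open>\<mu>\<^sup>2\<close>, because 2 |x| |y| <= |x|^2 + |y|^2 = 1.\<close>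

lemma gap_mgf:
  assumes orth: "ip d x y = 0" and xy: "norm2 d x + norm2 d y = 1" and t: "0 \<le> t"
  shows "(\<integral>\<^sup>+a. ennreal (exp (- t * (norm (lin d a x) - norm (lin d a y))\<^sup>2)) \<partial>row d)
    \<le> ennreal (exp (- t * (1 - \<mu>\<^sup>2) + 3 * t\<^sup>2))"
proof -
  define X where "X a = (norm (lin d a x) - norm (lin d a y))\<^sup>2" for a
  define Z where "Z a = norm (lin d a x) * norm (lin d a y)" for a
  have [measurable]: "X \<in> borel_measurable (row d)" "Z \<in> borel_measurable (row d)"
    unfolding X_def Z_def by measurable
  define z where "z = sqrt (norm2 d x) * sqrt (norm2 d y) * \<mu>\<^sup>2"
  have "2 * (sqrt (norm2 d x) * sqrt (norm2 d y)) \<le> (sqrt (norm2 d x))\<^sup>2 + (sqrt (norm2 d y))\<^sup>2"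
    using sum_squares_bound[of "sqrt (norm2 d x)" "sqrt (norm2 d y)"] by (simp only: mult.assoc)
  then have z: "0 \<le> z" "2 * z \<le> \<mu>\<^sup>2"
    using mu xy mult_right_mono[of "2 * (sqrt (norm2 d x) * sqrt (norm2 d y))" 1 "\<mu>\<^sup>2"] by (auto simp: z_def)
  interpret R: prob_space "row d" by (rule prob_row)
  have "(\<integral>\<^sup>+a. ennreal (X a) \<partial>row d) + 2 * (\<integral>\<^sup>+a. ennreal (Z a) \<partial>row d)
      = (\<integral>\<^sup>+a. ennreal (X a) + 2 * ennreal (Z a) \<partial>row d)"
    by (simp add: nn_integral_add nn_integral_cmult)
  also have "\<dots> = (\<integral>\<^sup>+a. ennreal ((norm (lin d a x))\<^sup>2) + ennreal ((norm (lin d a y))\<^sup>2) \<partial>row d)"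
  proof (rule nn_integral_cong)
    fix a
    have "ennreal (X a) + 2 * ennreal (Z a) = ennreal (X a + 2 * Z a)"
      by (simp add: X_def Z_def ennreal_mult')
    also have "X a + 2 * Z a = (norm (lin d a x))\<^sup>2 + (norm (lin d a y))\<^sup>2"
      by (simp add: X_def Z_def power2_eq_square algebra_simps)
    finally show "ennreal (X a) + 2 * ennreal (Z a) = ennreal ((norm (lin d a x))\<^sup>2) + ennreal ((norm (lin d a y))\<^sup>2)"
      by simp
  qed
  also have "\<dots> = ennreal 1"
    by (subst nn_integral_add) (simp_all add: mean_square xy flip: ennreal_plus)
  finally have sum1: "(\<integral>\<^sup>+a. ennreal (X a) \<partial>row d) + ennreal (2 * z) = ennreal 1"
    using mean_abs_product[OF orth] z by (simp add: Z_def z_def ennreal_mult')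
  have "(\<integral>\<^sup>+a. ennreal (X a) \<partial>row d) \<le> ennreal 1"
    unfolding sum1[symmetric] by simp
  \<comment> \<open>Nonnegative integrals cannot be subtracted, so the cross term was kept on the
    left; finiteness now permits real arithmetic with the mean \<open>b\<close>.\<close>
  then obtain b where b: "0 \<le> b" "(\<integral>\<^sup>+a. ennreal (X a) \<partial>row d) = ennreal b"
    by (cases "\<integral>\<^sup>+a. ennreal (X a) \<partial>row d") (auto simp: top_unique)
  have "ennreal (b + 2 * z) = ennreal 1" using sum1 b z by simp
  then have bz: "b + 2 * z = 1" using b z by (subst (asm) ennreal_inj) auto
  have "(\<integral>\<^sup>+a. ennreal ((X a)\<^sup>2) \<partial>row d) \<le> (\<integral>\<^sup>+a. 2 * ennreal ((norm (lin d a x))^4) + 2 * ennreal ((norm (lin d a y))^4) \<partial>row d)"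
  proof (rule nn_integral_mono)
    fix a
    \<comment> \<open>The second moment of \<open>X\<close> is at most 2 * 3 (|x|^4 + |y|^4) <= 6,
      which after multiplication by t^2 / 2 is the term 3 t^2.\<close>
    define p q where "p = norm (lin d a x)" and "q = norm (lin d a y)"
    have pq: "0 \<le> p" "0 \<le> q" by (auto simp: p_def q_def)
    have "(p - q)\<^sup>2 \<le> p\<^sup>2 + q\<^sup>2" using pq by (simp add: power2_eq_square algebra_simps)
    then have "((p - q)\<^sup>2)\<^sup>2 \<le> (p\<^sup>2 + q\<^sup>2)\<^sup>2" by (intro power_mono) auto
    also have "\<dots> \<le> 2 * (p\<^sup>2)\<^sup>2 + 2 * (q\<^sup>2)\<^sup>2"
      using sum_squares_bound[of "p\<^sup>2" "q\<^sup>2"] by (simp add: power2_sum)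
    finally have "(X a)\<^sup>2 \<le> 2 * p^4 + 2 * q^4" by (simp add: X_def p_def q_def)
    then have "ennreal ((X a)\<^sup>2) \<le> ennreal (2 * p^4 + 2 * q^4)" by (rule ennreal_leI)
    then show "ennreal ((X a)\<^sup>2) \<le> 2 * ennreal ((norm (lin d a x))^4) + 2 * ennreal ((norm (lin d a y))^4)"
      by (simp add: ennreal_mult' p_def q_def)
  qed
  also have "\<dots> = 2 * (\<integral>\<^sup>+a. ennreal ((norm (lin d a x))^4) \<partial>row d) + 2 * (\<integral>\<^sup>+a. ennreal ((norm (lin d a y))^4) \<partial>row d)"
    by (simp add: nn_integral_add nn_integral_cmult)
  also have "\<dots> \<le> 2 * ennreal (3 * (norm2 d x)\<^sup>2) + 2 * ennreal (3 * (norm2 d y)\<^sup>2)"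
    by (intro add_mono mult_left_mono mean_fourth) auto
  also have "\<dots> = ennreal (6 * ((norm2 d x)\<^sup>2 + (norm2 d y)\<^sup>2))"
    by (simp add: ennreal_mult'[symmetric] flip: ennreal_plus ennreal_numeral)
  also have "\<dots> \<le> ennreal 6"
  proof (rule ennreal_leI)
    have "(norm2 d x)\<^sup>2 + (norm2 d y)\<^sup>2 \<le> (norm2 d x + norm2 d y)\<^sup>2"
      by (simp add: power2_sum)
    then show "6 * ((norm2 d x)\<^sup>2 + (norm2 d y)\<^sup>2) \<le> 6" using xy by simp
  qed
  finally have X2: "(\<integral>\<^sup>+a. ennreal ((X a)\<^sup>2) \<partial>row d) \<le> ennreal 6" .
  have "(\<integral>\<^sup>+a. ennreal (exp (- t * X a)) \<partial>row d) + ennreal t * (\<integral>\<^sup>+a. ennreal (X a) \<partial>row d)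
      = (\<integral>\<^sup>+a. ennreal (exp (- t * X a)) + ennreal t * ennreal (X a) \<partial>row d)"
    by (simp add: nn_integral_add nn_integral_cmult)
  also have "\<dots> \<le> (\<integral>\<^sup>+a. 1 + ennreal (t\<^sup>2 / 2) * ennreal ((X a)\<^sup>2) \<partial>row d)"
  proof (rule nn_integral_mono)
    fix a
    have X0: "0 \<le> X a" by (simp add: X_def)
    have "exp (- t * X a) + t * X a \<le> 1 + t\<^sup>2 / 2 * (X a)\<^sup>2"
      using exp_minus_le_quadratic[of "t * X a"] t X0 by (simp add: power_mult_distrib)
    then have "ennreal (exp (- t * X a) + t * X a) \<le> ennreal (1 + t\<^sup>2 / 2 * (X a)\<^sup>2)"
      by (rule ennreal_leI)
    then show "ennreal (exp (- t * X a)) + ennreal t * ennreal (X a) \<le> 1 + ennreal (t\<^sup>2 / 2) * ennreal ((X a)\<^sup>2)"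
      using t X0 by (simp add: ennreal_mult''[symmetric] flip: ennreal_plus ennreal_1)
  qed
  also have "\<dots> = 1 + ennreal (t\<^sup>2 / 2) * (\<integral>\<^sup>+a. ennreal ((X a)\<^sup>2) \<partial>row d)"
    by (simp add: nn_integral_add nn_integral_cmult R.emeasure_space_1)
  also have "\<dots> \<le> 1 + ennreal (t\<^sup>2 / 2) * ennreal 6"
    by (intro add_left_mono mult_left_mono X2) auto
  also have "\<dots> = 1 + ennreal (t\<^sup>2 / 2 * 6)"
    by (subst ennreal_mult) auto
  also have "\<dots> = ennreal (1 + 3 * t\<^sup>2)"
    by (subst ennreal_plus) auto
  finally have main: "(\<integral>\<^sup>+a. ennreal (exp (- t * X a)) \<partial>row d) + ennreal (t * b) \<le> ennreal (1 + 3 * t\<^sup>2)"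
    using t b by (simp add: ennreal_mult'')
  have "(\<integral>\<^sup>+a. ennreal (exp (- t * X a)) \<partial>row d) \<le> ennreal (1 + 3 * t\<^sup>2)"
    by (rule order.trans[OF _ main]) simp
  then obtain e where e: "0 \<le> e" "(\<integral>\<^sup>+a. ennreal (exp (- t * X a)) \<partial>row d) = ennreal e"
    by (cases "\<integral>\<^sup>+a. ennreal (exp (- t * X a)) \<partial>row d") (auto simp: top_unique)
  have "ennreal (e + t * b) \<le> ennreal (1 + 3 * t\<^sup>2)" using main e t b by simp
  then have "e + t * b \<le> 1 + 3 * t\<^sup>2" by (subst (asm) ennreal_le_iff) auto
  moreover have "t * (1 - \<mu>\<^sup>2) \<le> t * b" using t z bz by (intro mult_left_mono) auto
  ultimately have "e \<le> 1 + (- t * (1 - \<mu>\<^sup>2) + 3 * t\<^sup>2)" by simp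
  also have "\<dots> \<le> exp (- t * (1 - \<mu>\<^sup>2) + 3 * t\<^sup>2)" by (rule exp_ge_add_one_self)
  finally show ?thesis unfolding X_def[symmetric] e(2) by (rule ennreal_leI)
qed

lemma gap_tail:
  assumes orth: "ip d x y = 0" and xy: "norm2 d x + norm2 d y = 1" and e: "0 < e"
  shows "measure (PiM {..<m} (\<lambda>_. row d))
      {\<omega> \<in> space (PiM {..<m} (\<lambda>_. row d)). gap m d \<omega> x y \<le> real m * (1 - \<mu>\<^sup>2 - e)} \<le> exp (- real m * e\<^sup>2 / 12)"
proof -
  \<comment> \<open>The maximiser of t e - 3 t^2, with value e^2 / 12.\<close>
  define t where "t = e / 6"
  have t: "0 < t" using e by (auto simp: t_def)
  let ?F = "\<lambda>a. - t * (norm (lin d a x) - norm (lin d a y))\<^sup>2"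
  have "measure (PiM {..<m} (\<lambda>_. row d)) {\<omega> \<in> space (PiM {..<m} (\<lambda>_. row d)).
      real m * ((- t * (1 - \<mu>\<^sup>2) + 3 * t\<^sup>2) + (t * e - 3 * t\<^sup>2)) \<le> (\<Sum>i<m. ?F (\<omega> i))} \<le> exp (- real m * (t * e - 3 * t\<^sup>2))"
    using t by (intro chernoff_iid prob_row gap_mgf orth xy) auto
  moreover have "real m * ((- t * (1 - \<mu>\<^sup>2) + 3 * t\<^sup>2) + (t * e - 3 * t\<^sup>2)) \<le> (\<Sum>i<m. ?F (\<omega> i)) \<longleftrightarrow>
      gap m d \<omega> x y \<le> real m * (1 - \<mu>\<^sup>2 - e)" for \<omega>
  proof -
    have "(\<Sum>i<m. ?F (\<omega> i)) = - t * gap m d \<omega> x y" by (simp add: gap_def sum_distrib_left sum_negf)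
    moreover have "real m * ((- t * (1 - \<mu>\<^sup>2) + 3 * t\<^sup>2) + (t * e - 3 * t\<^sup>2)) = - t * (real m * (1 - \<mu>\<^sup>2 - e))" by (simp add: algebra_simps)
    ultimately show ?thesis using t by (simp only: mult_le_cancel_left_neg neg_less_0_iff_less)
  qed
  moreover have "- real m * (t * e - 3 * t\<^sup>2) = - real m * e\<^sup>2 / 12"
    by (simp add: t_def power2_eq_square field_simps)
  ultimately show ?thesis by (simp only:)
qed

end

subsection \<open>Measurability and the universal lower bound\<close>

context conj_field
begin

text \<open>For positive \<open>d\<close> the first unit vector paired with 0 is admissible. Without
  an admissible pair the infimum would be \<infinity> and the supremum -\<infinity>. Taking y = 0
  turns the gap into the energy, so the upper constant also bounds the operator norm.\<close>

lemma lipschitz_constants_real: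
  fixes A :: "nat \<Rightarrow> nat \<Rightarrow> 'a"
  assumes "0 < d"
  obtains l u where "lower_lipschitz (matrix_of m d A) = ereal l" "upper_lipschitz (matrix_of m d A) = ereal u"
    "0 \<le> l" "0 \<le> u" "\<And>x y. l\<^sup>2 * pdist2 d x y \<le> gap m d A x y" "\<And>x. energy m d A x \<le> u\<^sup>2 * norm2 d x"
proof -
  let ?L = "lower_lipschitz (matrix_of m d A)" and ?U = "upper_lipschitz (matrix_of m d A)"
  have lin0: "lin d a (\<lambda>_. 0) = 0" for a :: "nat \<Rightarrow> 'a" by (simp add: lin_def)
  have p0: "pdist2 d x (\<lambda>_. 0) = norm2 d x" for x by (simp add: pdist2_def ip_def cj_0) (simp add: norm2_def)
  have g0: "gap m d A x (\<lambda>_. 0) = energy m d A x" for x by (simp add: gap_def energy_def lin0)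
  define e where "e = (\<lambda>j::nat. if j = 0 then 1 else 0 :: 'a)"
  have "norm2 d e = 1"
    using assms by (simp add: norm2_def e_def if_distrib[of norm] if_distrib[of "\<lambda>x. x\<^sup>2"] sum.delta cong: if_cong)
  then have mem: "(e, \<lambda>_. 0) \<in> pairs d" by (simp add: p0)
  have L0: "0 \<le> ?L" unfolding lower_lipschitz_eq by (rule INF_greatest) auto
  have U0: "0 \<le> ?U" unfolding upper_lipschitz_eq
    by (rule SUP_upper2[OF mem]) (simp add: zero_ereal_def)
  have L1: "?L \<le> ereal (ratio m d A (e, \<lambda>_. 0))"
    unfolding lower_lipschitz_eq by (rule INF_lower[OF mem])
  obtain B where "0 \<le> B" "\<And>x. energy m d A x \<le> B\<^sup>2 * norm2 d x"
    using energy_bounded by blast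
  then have U1: "?U \<le> ereal B" by (rule upper_lipschitz_le)
  obtain l where l: "?L = ereal l" "0 \<le> l" using L0 L1 by (cases ?L) auto
  obtain u where u: "?U = ereal u" "0 \<le> u" using U0 U1 by (cases ?U) auto
  show ?thesis
  proof (rule that[OF l(1) u(1) l(2) u(2)])
    fix x y
    show "l\<^sup>2 * pdist2 d x y \<le> gap m d A x y"
    proof (cases "pdist2 d x y = 0")
      case False
      then have mem: "(x, y) \<in> pairs d" and pos: "0 < pdist2 d x y"
        using pdist2_nonneg[of d x y] by (auto simp: less_le)
      have "ereal l \<le> ereal (ratio m d A (x, y))"
        unfolding l(1)[symmetric] lower_lipschitz_eq by (rule INF_lower[OF mem])
      then have "l \<le> sqrt (gap m d A x y / pdist2 d x y)" by (simp add: real_sqrt_divide)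
      then have "l\<^sup>2 \<le> gap m d A x y / pdist2 d x y"
        using l(2) pos by (metis real_sqrt_pow2 power_mono divide_nonneg_pos gap_nonneg)
      then show ?thesis using pos by (simp add: pos_le_divide_eq)
    qed simp
  next
    fix x
    show "energy m d A x \<le> u\<^sup>2 * norm2 d x"
    proof (cases "norm2 d x = 0")
      case False
      then have mem: "(x, \<lambda>_. 0) \<in> pairs d" and pos: "0 < norm2 d x"
        using norm2_nonneg[of d x] by (auto simp: less_le p0)
      have "ereal (ratio m d A (x, \<lambda>_. 0)) \<le> ereal u"
        unfolding u(1)[symmetric] upper_lipschitz_eq by (rule SUP_upper[OF mem])
      then have "sqrt (energy m d A x / norm2 d x) \<le> u" by (simp add: real_sqrt_divide p0 g0)
      then have "energy m d A x / norm2 d x \<le> u\<^sup>2"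
        by (rule sqrt_le_D)
      then show ?thesis using pos by (simp add: pos_divide_le_eq)
    next
      case True
      then have "\<forall>j<d. x j = 0" by (simp add: norm2_def sum_nonneg_eq_0_iff)
      then show ?thesis by (simp add: energy_def lin_def norm2_def)
    qed
  qed
qed

lemma continuous_cj: "continuous_on UNIV cj"
  unfolding continuous_on_iff
proof (intro ballI allI impI)
  fix x :: 'a and e :: real assume "0 < e"
  then show "\<exists>d>0. \<forall>x'\<in>UNIV. dist x' x < d \<longrightarrow> dist (cj x') (cj x) < e"
    by (intro exI[of _ e]) (auto simp: dist_norm norm_cj simp flip: cj_diff)
qed

lemma continuous_ratio: "continuous_on (pairs d) (ratio m d A)"
proof -
  let ?T = "UNIV :: ((nat \<Rightarrow> 'a) \<times> (nat \<Rightarrow> 'a)) set"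
  have c: "continuous_on ?T (\<lambda>p. fst p j)" "continuous_on ?T (\<lambda>p. snd p j)" for j
    by (rule continuous_on_product_then_coordinatewise, rule continuous_on_fst continuous_on_snd,
        rule continuous_on_id)+
  have cc: "continuous_on ?T (\<lambda>p. cj (snd p j))" for j
    by (rule continuous_on_compose2[OF continuous_cj c(2)]) simp
  have "continuous_on ?T (\<lambda>p. gap m d A (fst p) (snd p))"
    unfolding gap_def lin_def
    by (intro continuous_on_sum continuous_on_power continuous_on_diff continuous_on_norm
        continuous_on_mult continuous_on_const c)
  moreover have "continuous_on ?T (\<lambda>p. pdist2 d (fst p) (snd p))"
    unfolding pdist2_def norm2_def ip_def
    by (intro continuous_on_sum continuous_on_power continuous_on_diff continuous_on_add continuous_on_norm
        continuous_on_mult continuous_on_const c cc)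
  ultimately have "continuous_on (pairs d) (\<lambda>p. gap m d A (fst p) (snd p))"
      "continuous_on (pairs d) (\<lambda>p. pdist2 d (fst p) (snd p))"
    by (blast intro: continuous_on_subset)+
  then show ?thesis
    by (intro continuous_on_divide continuous_on_real_sqrt) auto
qed

end

text \<open>Needed for measurability: the Lipschitz constants are extrema over uncountably many
  pairs, and continuity of the quotient lets a countable dense subset replace them.\<close>

lemma INF_dense_eq:
  fixes f :: "'s::metric_space \<Rightarrow> real"
  assumes f: "continuous_on S f" and D: "D \<subseteq> S" "S \<subseteq> closure D"
  shows "(INF p\<in>S. ereal (f p)) = (INF p\<in>D. ereal (f p))"
    and "(SUP p\<in>S. ereal (f p)) = (SUP p\<in>D. ereal (f p))"
proof -
  have seq: "\<exists>X. (\<forall>n. X n \<in> D) \<and> (\<lambda>n. ereal (f (X n))) \<longlonglongrightarrow> ereal (f p)" if p: "p \<in> S" for p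
  proof -
    have "p \<in> closure D" using p D(2) by blast
    then obtain X where X: "\<And>n. X n \<in> D" "X \<longlonglongrightarrow> p"
      unfolding closure_sequential by blast
    have "(\<lambda>n. f (X n)) \<longlonglongrightarrow> f p"
      using X(1) p D(1) by (intro continuous_on_tendsto_compose[OF f X(2)] always_eventually) auto
    then show ?thesis using X by auto
  qed
  show "(INF p\<in>S. ereal (f p)) = (INF p\<in>D. ereal (f p))"
  proof (rule antisym)
    show "(INF p\<in>S. ereal (f p)) \<le> (INF p\<in>D. ereal (f p))"
      using D(1) by (intro INF_superset_mono) auto
    show "(INF p\<in>D. ereal (f p)) \<le> (INF p\<in>S. ereal (f p))"
    proof (rule INF_greatest)
      fix p assume "p \<in> S"
      then obtain X where X: "\<And>n. X n \<in> D" "(\<lambda>n. ereal (f (X n))) \<longlonglongrightarrow> ereal (f p)"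
        using seq by blast
      show "(INF p\<in>D. ereal (f p)) \<le> ereal (f p)"
        by (rule LIMSEQ_le_const[OF X(2)]) (auto intro!: INF_lower X(1))
    qed
  qed
  show "(SUP p\<in>S. ereal (f p)) = (SUP p\<in>D. ereal (f p))"
  proof (rule antisym)
    show "(SUP p\<in>D. ereal (f p)) \<le> (SUP p\<in>S. ereal (f p))"
      using D(1) by (intro SUP_subset_mono) auto
    show "(SUP p\<in>S. ereal (f p)) \<le> (SUP p\<in>D. ereal (f p))"
    proof (rule SUP_least)
      fix p assume "p \<in> S"
      then obtain X where X: "\<And>n. X n \<in> D" "(\<lambda>n. ereal (f (X n))) \<longlonglongrightarrow> ereal (f p)"
        using seq by blast
      show "ereal (f p) \<le> (SUP p\<in>D. ereal (f p))"
        by (rule LIMSEQ_le_const2[OF X(2)]) (auto intro!: SUP_upper X(1))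
    qed
  qed
qed

context gaussian_field
begin

lemma measurable_lin_row:
  assumes "i < m"
  shows "(\<lambda>\<omega>. lin d (\<omega> i) x) \<in> borel_measurable (PiM {..<m} (\<lambda>_. row d))"
proof -
  have "(\<lambda>\<omega>. \<omega> i) \<in> measurable (PiM {..<m} (\<lambda>_. row d)) (row d)"
    using assms by (intro measurable_component_singleton) auto
  then show ?thesis by (rule measurable_compose) (rule measurable_lin)
qed

lemma measurable_gap:
  "(\<lambda>\<omega>. gap m d \<omega> x y) \<in> borel_measurable (PiM {..<m} (\<lambda>_. row d))"
  unfolding gap_def
  by (intro borel_measurable_sum borel_measurable_power borel_measurable_diff
      measurable_compose[OF measurable_lin_row borel_measurable_norm]) auto

lemma measurable_energy:
  "(\<lambda>\<omega>. energy m d \<omega> x) \<in> borel_measurable (PiM {..<m} (\<lambda>_. row d))"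
  unfolding energy_def
  by (intro borel_measurable_sum borel_measurable_power
      measurable_compose[OF measurable_lin_row borel_measurable_norm]) auto

text \<open>The countable dense set of pairs does not depend on \<omega>, so both constants are
  countable extrema of measurable quotients.\<close>

lemma measurable_condition_number:
  "(\<lambda>\<omega>. condition_number (matrix_of m d \<omega>)) \<in> borel_measurable (PiM {..<m} (\<lambda>_. row d))"
proof -
  obtain D :: "((nat \<Rightarrow> 'a) \<times> (nat \<Rightarrow> 'a)) set" where D: "countable D" "D \<subseteq> pairs d" "pairs d \<subseteq> closure D"
    using separable by blast
  have ratio: "(\<lambda>\<omega>. ereal (ratio m d \<omega> p)) \<in> borel_measurable (PiM {..<m} (\<lambda>_. row d))" for p
    by (intro borel_measurable_ereal borel_measurable_divide borel_measurable_const
        measurable_compose[OF measurable_gap borel_measurable_sqrt])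
  have lowm: "(\<lambda>\<omega>. lower_lipschitz (matrix_of m d \<omega>)) \<in> borel_measurable (PiM {..<m} (\<lambda>_. row d))"
    unfolding lower_lipschitz_eq INF_dense_eq(1)[OF continuous_ratio D(2,3)]
    by (intro borel_measurable_INF D(1) ratio)
  have upm: "(\<lambda>\<omega>. upper_lipschitz (matrix_of m d \<omega>)) \<in> borel_measurable (PiM {..<m} (\<lambda>_. row d))"
    unfolding upper_lipschitz_eq INF_dense_eq(2)[OF continuous_ratio D(2,3)]
    by (intro borel_measurable_SUP D(1) ratio)
  have "(\<lambda>\<omega>. if f \<omega> = 0 then \<infinity> else g \<omega> / f \<omega>) \<in> borel_measurable M"
    if [measurable]: "f \<in> borel_measurable M" "g \<in> borel_measurable M"
    for f g :: "(nat \<Rightarrow> nat \<Rightarrow> 'a) \<Rightarrow> ereal" and M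
    unfolding divide_ereal_def by measurable
  from this[OF lowm upm] show ?thesis unfolding condition_number_def .
qed

text \<open>Averaging the gap over the orthogonal pairs \<open>(z\<^sub>0, z\<^sub>1)\<close>, \<open>(- cj z\<^sub>1, cj z\<^sub>0)\<close> with z Gaussian:
  each row sees two independent Gaussians.\<close>

lemma condition_number_ge:
  fixes A :: "nat \<Rightarrow> nat \<Rightarrow> 'a"
  assumes d: "2 \<le> d"
  shows "ereal (1 / sqrt (1 - \<mu>\<^sup>2)) \<le> condition_number (matrix_of m d A)"
proof -
  obtain l u where lu: "lower_lipschitz (matrix_of m d A) = ereal l" "upper_lipschitz (matrix_of m d A) = ereal u"
    "0 \<le> l" "0 \<le> u" and low: "\<And>x y. l\<^sup>2 * pdist2 d x y \<le> gap m d A x y"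
    and up: "\<And>x. energy m d A x \<le> u\<^sup>2 * norm2 d x"
  proof (rule lipschitz_constants_real[of d m A])
    show "0 < d" using d by simp
  qed (rule that)
  have split2: "(\<Sum>j<d. f j) = f 0 + f 1" if "\<And>j. 2 \<le> j \<Longrightarrow> f j = 0" for f :: "nat \<Rightarrow> 'b::comm_monoid_add"
  proof -
    have "(\<Sum>j<d. f j) = (\<Sum>j\<in>{0,1}. f j)"
      using d that by (intro sum.mono_neutral_right) (auto simp: not_less less_2_cases_iff)
    then show ?thesis by simp
  qed
  have two: "{..<2::nat} = {0, 1}" by auto
  define e where "e k = (\<lambda>j::nat. if j = k then 1 else 0 :: 'a)" for k
  \<comment> \<open>The squared Frobenius norm of the first two columns. It is at most twice the
    square of \<open>u\<close>, and the averaged inequality sees the matrix only through it and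
    \<open>l\<close>.\<close>
  define S where "S = (\<Sum>i<m. norm2 2 (A i))"
  have S0: "0 \<le> S" by (simp add: S_def sum_nonneg)
  have line: "lin d a (e k) = a k" if "k < d" for a k
    using that by (simp add: lin_def e_def if_distrib[of "\<lambda>x. _ * x"] sum.delta' cong: if_cong)
  have n2e: "norm2 d' (e k) = 1" if "k < d'" for k d'
    using that by (simp add: norm2_def e_def if_distrib[of norm] if_distrib[of "\<lambda>x. x\<^sup>2"] sum.delta' cong: if_cong)
  have "S = energy m d A (e 0) + energy m d A (e 1)"
    using d by (simp add: S_def energy_def line norm2_def two sum.distrib)
  also have "\<dots> \<le> u\<^sup>2 + u\<^sup>2"
    using up[of "e 0"] up[of "e 1"] d by (simp add: n2e)
  finally have Su: "S \<le> 2 * u\<^sup>2" by simp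
  define X where "X z = (\<lambda>j::nat. if j = 0 then z 0 else if j = 1 then z 1 else 0 :: 'a)" for z :: "nat \<Rightarrow> 'a"
  define Y where "Y z = (\<lambda>j::nat. if j = 0 then - cj (z 1) else if j = 1 then cj (z 0) else 0 :: 'a)" for z :: "nat \<Rightarrow> 'a"
  \<comment> \<open>The roles of matrix and vector are exchanged: \<open>z\<close> is the Gaussian
    row and the rows of \<open>A\<close> are fixed. Applying \<open>A i\<close> to
    \<open>Y z\<close> has the modulus of the form with coefficients \<open>b i\<close> in
    \<open>z\<close>, and \<open>b i\<close> is orthogonal to \<open>A i\<close> with the same
    length, so the product of the two moduli has a known mean.\<close>
  define b where "b i = (\<lambda>j::nat. if j = 0 then cj (A i 1) else - cj (A i 0))" for i
  have linX: "lin d a (X z) = lin 2 z a" for a z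
    unfolding lin_def by (subst split2) (auto simp: X_def two mult.commute)
  have linY: "norm (lin d (A i) (Y z)) = norm (lin 2 z (b i))" for i z
  proof -
    have "lin 2 z (b i) = cj (lin d (A i) (Y z))"
      unfolding lin_def by (subst split2) (auto simp: Y_def b_def two cj_add cj_diff cj_mult cj_cj cj_minus mult.commute)
    then show ?thesis by (simp add: norm_cj)
  qed
  have nX: "norm2 d (X z) = norm2 2 z" for z
    unfolding norm2_def by (subst split2) (auto simp: X_def two)
  have nY: "norm2 d (Y z) = norm2 2 z" for z
    unfolding norm2_def by (subst split2) (auto simp: Y_def two norm_cj)
  have ipXY: "ip d (X z) (Y z) = 0" for z
    unfolding ip_def by (subst split2) (auto simp: X_def Y_def cj_minus cj_cj mult.commute)
  have nb: "norm2 2 (b i) = norm2 2 (A i)" for i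
    by (simp add: norm2_def b_def two norm_cj)
  have ipb: "ip 2 (A i) (b i) = 0" for i
    by (simp add: ip_def b_def two cj_minus cj_cj)
  \<comment> \<open>The cross terms are moved to the left so that both sides are nonnegative and can
    be integrated as they stand.\<close>
  have pw: "2 * l\<^sup>2 * norm2 2 z + (\<Sum>i<m. 2 * (norm (lin 2 z (A i)) * norm (lin 2 z (b i))))
     \<le> (\<Sum>i<m. (norm (lin 2 z (A i)))\<^sup>2 + (norm (lin 2 z (b i)))\<^sup>2)" for z
  proof -
    have "2 * l\<^sup>2 * norm2 2 z = l\<^sup>2 * pdist2 d (X z) (Y z)"
      by (simp add: pdist2_def nX nY ipXY)
    also have "\<dots> \<le> gap m d A (X z) (Y z)" by (rule low)
    also have "\<dots> = (\<Sum>i<m. (norm (lin 2 z (A i)))\<^sup>2 + (norm (lin 2 z (b i)))\<^sup>2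
        - 2 * (norm (lin 2 z (A i)) * norm (lin 2 z (b i))))"
      unfolding gap_def linX linY by (intro sum.cong) (auto simp: power2_eq_square algebra_simps)
    finally show ?thesis by (simp add: sum_subtractf)
  qed
  have int_norm2: "(\<integral>\<^sup>+z. ennreal (norm2 2 z) \<partial>row 2) = 2"
  proof -
    have "ennreal (norm2 2 z) = ennreal ((norm (lin 2 z (e 0)))\<^sup>2) + ennreal ((norm (lin 2 z (e 1)))\<^sup>2)" for z
      by (simp add: norm2_def lin_def e_def two)
    then have "(\<integral>\<^sup>+z. ennreal (norm2 2 z) \<partial>row 2) = ennreal (norm2 2 (e 0)) + ennreal (norm2 2 (e 1))"
      by (simp add: nn_integral_add mean_square del: ennreal_plus)
    then show ?thesis by (simp add: n2e one_add_one)
  qed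
  have meas[measurable]: "(\<lambda>z. norm2 2 z) \<in> borel_measurable (row 2)"
  proof -
    have "norm2 2 z = (norm (lin 2 z (e 0)))\<^sup>2 + (norm (lin 2 z (e 1)))\<^sup>2" for z
      by (simp add: norm2_def lin_def e_def two)
    then show ?thesis by simp
  qed
  have "ennreal (4 * l\<^sup>2 + 2 * \<mu>\<^sup>2 * S) =
     (\<integral>\<^sup>+z. ennreal (2 * l\<^sup>2) * ennreal (norm2 2 z) + (\<Sum>i<m. 2 * ennreal (norm (lin 2 z (A i)) * norm (lin 2 z (b i)))) \<partial>row 2)"
  proof -
    have "(\<integral>\<^sup>+z. ennreal (2 * l\<^sup>2) * ennreal (norm2 2 z) + (\<Sum>i<m. 2 * ennreal (norm (lin 2 z (A i)) * norm (lin 2 z (b i)))) \<partial>row 2)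
       = ennreal (2 * l\<^sup>2) * 2 + (\<Sum>i<m. 2 * ennreal (norm2 2 (A i) * \<mu>\<^sup>2))"
      by (simp add: nn_integral_add nn_integral_cmult nn_integral_sum int_norm2 mean_abs_product[OF ipb] nb)
    also have "\<dots> = ennreal (2 * l\<^sup>2 * 2) + (\<Sum>i<m. ennreal (2 * (norm2 2 (A i) * \<mu>\<^sup>2)))"
    proof -
      have "2 * ennreal x = ennreal (2 * x)" "ennreal x * 2 = ennreal (x * 2)" for x
        by (simp_all add: ennreal_mult' ennreal_mult'')
      then show ?thesis by (simp only:)
    qed
    also have "\<dots> = ennreal (2 * l\<^sup>2 * 2 + (\<Sum>i<m. 2 * (norm2 2 (A i) * \<mu>\<^sup>2)))"
      by (simp add: sum_ennreal sum_nonneg del: ennreal_plus flip: ennreal_plus)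
    finally show ?thesis by (simp add: S_def sum_distrib_left sum_distrib_right mult_ac)
  qed
  also have "\<dots> \<le> (\<integral>\<^sup>+z. (\<Sum>i<m. ennreal ((norm (lin 2 z (A i)))\<^sup>2) + ennreal ((norm (lin 2 z (b i)))\<^sup>2)) \<partial>row 2)"
  proof (rule nn_integral_mono)
    fix z
    have "ennreal (2 * l\<^sup>2) * ennreal (norm2 2 z) + (\<Sum>i<m. 2 * ennreal (norm (lin 2 z (A i)) * norm (lin 2 z (b i))))
      = ennreal (2 * l\<^sup>2 * norm2 2 z) + (\<Sum>i<m. ennreal (2 * (norm (lin 2 z (A i)) * norm (lin 2 z (b i)))))"
      by (simp add: ennreal_mult')
    also have "\<dots> = ennreal (2 * l\<^sup>2 * norm2 2 z + (\<Sum>i<m. 2 * (norm (lin 2 z (A i)) * norm (lin 2 z (b i)))))"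
      by (subst sum_ennreal) (auto simp: sum_nonneg)
    also have "\<dots> \<le> ennreal (\<Sum>i<m. (norm (lin 2 z (A i)))\<^sup>2 + (norm (lin 2 z (b i)))\<^sup>2)"
      using pw[of z] by (rule ennreal_leI)
    also have "\<dots> = (\<Sum>i<m. ennreal ((norm (lin 2 z (A i)))\<^sup>2) + ennreal ((norm (lin 2 z (b i)))\<^sup>2))"
      by (subst sum_ennreal[symmetric]) auto
    finally show "ennreal (2 * l\<^sup>2) * ennreal (norm2 2 z) + (\<Sum>i<m. 2 * ennreal (norm (lin 2 z (A i)) * norm (lin 2 z (b i))))
      \<le> (\<Sum>i<m. ennreal ((norm (lin 2 z (A i)))\<^sup>2) + ennreal ((norm (lin 2 z (b i)))\<^sup>2))" .
  qed
  also have "\<dots> = (\<Sum>i<m. ennreal (norm2 2 (A i)) + ennreal (norm2 2 (A i)))"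
    by (simp add: nn_integral_sum nn_integral_add mean_square nb)
  also have "\<dots> = (\<Sum>i<m. ennreal (2 * norm2 2 (A i)))"
    unfolding mult_2 by (simp only: ennreal_plus norm2_nonneg)
  also have "\<dots> = ennreal (2 * S)"
    by (subst sum_ennreal) (simp_all add: S_def sum_distrib_left)
  \<comment> \<open>The factor 4 appears because a Gaussian vector in the plane has mean squared
    length 2.\<close>
  finally have "4 * l\<^sup>2 + 2 * \<mu>\<^sup>2 * S \<le> 2 * S"
    using S0 by (subst (asm) ennreal_le_iff) auto
  then have "2 * l\<^sup>2 \<le> (1 - \<mu>\<^sup>2) * S" by (simp add: algebra_simps)
  also have "\<dots> \<le> (1 - \<mu>\<^sup>2) * (2 * u\<^sup>2)" using Su mu by (intro mult_left_mono) auto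
  finally have "sqrt (l\<^sup>2) \<le> sqrt ((1 - \<mu>\<^sup>2) * u\<^sup>2)" by (intro real_sqrt_le_mono) simp
  then have lu': "l \<le> sqrt (1 - \<mu>\<^sup>2) * u" using lu by (simp add: real_sqrt_mult)
  show ?thesis
  proof (cases "l = 0")
    case True
    then show ?thesis by (simp add: condition_number_def lu zero_ereal_def)
  next
    case False
    then have "1 / sqrt (1 - \<mu>\<^sup>2) \<le> u / l" using lu lu' mu by (simp add: field_simps)
    then show ?thesis using False by (simp add: condition_number_def lu zero_ereal_def)
  qed
qed

end

subsection \<open>Concentration\<close>

lemma sqrt_energy_triangle:
  "sqrt (energy m d A x) \<le> sqrt (energy m d A y) + sqrt (energy m d A (\<lambda>j. x j - y j))"
proof -
  have "L2_set (\<lambda>i. norm (lin d (A i) x)) {..<m}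
      \<le> L2_set (\<lambda>i. norm (lin d (A i) y) + norm (lin d (A i) x - lin d (A i) y)) {..<m}"
    by (rule L2_set_mono) (auto intro: norm_triangle_sub)
  also have "\<dots> \<le> L2_set (\<lambda>i. norm (lin d (A i) y)) {..<m} + L2_set (\<lambda>i. norm (lin d (A i) x - lin d (A i) y)) {..<m}"
    by (rule L2_set_triangle_ineq)
  finally show ?thesis by (simp add: energy_def L2_set_def lin_diff)
qed

lemma sqrt_gap_triangle:
  "sqrt (gap m d A x y) \<le> sqrt (gap m d A x' y') +
     sqrt (energy m d A (\<lambda>j. x j - x' j)) + sqrt (energy m d A (\<lambda>j. y j - y' j))"
proof -
  define n where "n i x = norm (lin d (A i) x)" for i x
  define e where "e i x y = norm (lin d (A i) x - lin d (A i) y)" for i x y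
  have "sqrt (gap m d A x y) = L2_set (\<lambda>i. \<bar>n i x - n i y\<bar>) {..<m}"
    by (simp add: gap_def L2_set_def n_def)
  also have "\<dots> \<le> L2_set (\<lambda>i. (\<bar>n i x' - n i y'\<bar> + e i x x') + e i y y') {..<m}"
  proof (rule L2_set_mono)
    fix i
    have "\<bar>n i x - n i x'\<bar> \<le> e i x x'" "\<bar>n i y - n i y'\<bar> \<le> e i y y'"
      by (auto simp: n_def e_def norm_triangle_ineq3)
    then show "\<bar>n i x - n i y\<bar> \<le> \<bar>n i x' - n i y'\<bar> + e i x x' + e i y y'" by linarith
  qed simp
  also have "\<dots> \<le> L2_set (\<lambda>i. \<bar>n i x' - n i y'\<bar> + e i x x') {..<m} + L2_set (\<lambda>i. e i y y') {..<m}"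
    by (rule L2_set_triangle_ineq)
  also have "\<dots> \<le> L2_set (\<lambda>i. \<bar>n i x' - n i y'\<bar>) {..<m} + L2_set (\<lambda>i. e i x x') {..<m} + L2_set (\<lambda>i. e i y y') {..<m}"
    by (intro add_right_mono L2_set_triangle_ineq)
  finally show ?thesis
    by (simp add: gap_def energy_def L2_set_def n_def e_def lin_diff)
qed

section \<open>From nets to all vectors and all orthogonal pairs\<close>

context conj_field
begin

lemma energy_le_of_unit:
  fixes A :: "nat \<Rightarrow> nat \<Rightarrow> 'a"
  assumes unit: "\<And>x. norm2 d x = 1 \<Longrightarrow> energy m d A x \<le> K"
  shows "energy m d A x \<le> K * norm2 d x"
proof (cases "norm2 d x = 0")
  case True
  then have "\<forall>j<d. x j = 0" by (simp add: norm2_def sum_nonneg_eq_0_iff)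
  then show ?thesis using True by (simp add: energy_def lin_def)
next
  case False
  then have pos: "0 < norm2 d x" using norm2_nonneg[of d x] by (simp add: less_le)
  define c where "c = (of_real (1 / sqrt (norm2 d x)) :: 'a)"
  have c: "(norm c)\<^sup>2 = 1 / norm2 d x" using pos by (simp add: c_def power_divide norm_divide)
  have "energy m d A (\<lambda>j. c * x j) \<le> K"
    by (rule unit) (use pos in \<open>simp add: norm2_cmult c\<close>)
  then show ?thesis using pos by (simp add: energy_cmult c field_simps)
qed

text \<open>Self-bounding argument: moving from a unit vector to a net point costs at most \<eta>
  times the supremum itself, so Sup <= K + \<eta> Sup. Solving for the supremum requires that it is
  finite, which the Frobenius bound guarantees.\<close>

lemma energy_le_of_net:
  fixes A :: "nat \<Rightarrow> nat \<Rightarrow> 'a"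
  assumes \<eta>: "0 \<le> \<eta>" "\<eta> < 1" and K: "0 \<le> K"
    and net: "\<And>x. norm2 d x = 1 \<Longrightarrow> \<exists>t\<in>N. norm2 d (\<lambda>j. x j - t j) \<le> \<eta>\<^sup>2"
    and N: "\<And>t. t \<in> N \<Longrightarrow> energy m d A t \<le> K\<^sup>2"
  shows "energy m d A x \<le> (K / (1 - \<eta>))\<^sup>2 * norm2 d x"
proof (rule energy_le_of_unit)
  fix x0 :: "nat \<Rightarrow> 'a" assume x0: "norm2 d x0 = 1"
  define E where "E = (\<lambda>x. sqrt (energy m d A x)) ` {x. norm2 d x = 1}"
  obtain B where B: "0 \<le> B" "\<And>x. energy m d A x \<le> B\<^sup>2 * norm2 d x"
    using energy_bounded[of m d A] by blast
  have bdd: "bdd_above E"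
    unfolding E_def using B by (intro bdd_aboveI2[of _ _ B]) (auto intro!: real_le_lsqrt, metis mult.right_neutral)
  have sup: "sqrt (energy m d A x) \<le> Sup E" if "norm2 d x = 1" for x
    by (rule cSup_upper) (use that bdd in \<open>auto simp: E_def\<close>)
  have Sup0: "0 \<le> Sup E" using sup[OF x0] by (rule order.trans[rotated]) simp
  have hom: "energy m d A x \<le> (Sup E)\<^sup>2 * norm2 d x" for x
    by (rule energy_le_of_unit) (use sup in \<open>auto dest: sqrt_le_D\<close>)
  have "s \<le> K + Sup E * \<eta>" if s: "s \<in> E" for s
  proof -
    obtain x where x: "norm2 d x = 1" "s = sqrt (energy m d A x)"
      using s by (auto simp: E_def)
    obtain t where t: "t \<in> N" "norm2 d (\<lambda>j. x j - t j) \<le> \<eta>\<^sup>2" using net x(1) by blast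
    have "sqrt (energy m d A t) \<le> K" using N[OF t(1)] K by (intro real_le_lsqrt) auto
    moreover have "sqrt (energy m d A (\<lambda>j. x j - t j)) \<le> Sup E * \<eta>"
    proof (rule real_le_lsqrt)
      have "energy m d A (\<lambda>j. x j - t j) \<le> (Sup E)\<^sup>2 * norm2 d (\<lambda>j. x j - t j)" by (rule hom)
      also have "\<dots> \<le> (Sup E)\<^sup>2 * \<eta>\<^sup>2" using t by (intro mult_left_mono) auto
      finally show "energy m d A (\<lambda>j. x j - t j) \<le> (Sup E * \<eta>)\<^sup>2" by (simp add: power_mult_distrib)
    qed (use Sup0 \<eta> in auto)
    ultimately show ?thesis
      unfolding x(2) using sqrt_energy_triangle[of m d A x t] by linarith
  qed
  then have "Sup E \<le> K + Sup E * \<eta>"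
    by (intro cSup_least) (use x0 in \<open>auto simp: E_def\<close>)
  then have "Sup E \<le> K / (1 - \<eta>)" using \<eta> by (simp add: pos_le_divide_eq algebra_simps)
  then have "sqrt (energy m d A x0) \<le> K / (1 - \<eta>)" using sup[OF x0] by linarith
  then show "energy m d A x0 \<le> (K / (1 - \<eta>))\<^sup>2" by (rule sqrt_le_D)
qed

text \<open>Up to the factor sqrt m, the upper constant is at most (1 + e/2) / (1 - e) <= 1 + 4 e <=
  3. For the lower one, sqrt (s^2 - e) >= s - e/s on the net, and moving \<open>x\<close> and
  \<open>y\<close> to the net point costs at most 3 e each; this is the loss 6 e in
  \<open>bound\<close>.\<close>

lemma condition_number_le_of_nets:
  fixes A :: "nat \<Rightarrow> nat \<Rightarrow> 'a"
  assumes d: "0 < d" and e: "0 < e" "e \<le> 1 / 2" and s: "0 < s" "e \<le> s\<^sup>2" and m: "0 < m"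
    and bound: "1 + 4 * e \<le> \<beta> * (s - e / s - 6 * e)" and \<beta>: "0 < \<beta>"
    and net1: "\<And>x. norm2 d x = 1 \<Longrightarrow> \<exists>t\<in>N1. norm2 d (\<lambda>j. x j - t j) \<le> e\<^sup>2"
    and N1: "\<And>t. t \<in> N1 \<Longrightarrow> energy m d A t \<le> real m * (1 + e)"
    and net2: "\<And>x y. ip d x y = 0 \<Longrightarrow> norm2 d x + norm2 d y = 1 \<Longrightarrow>
      \<exists>(t, t')\<in>N2. norm2 d (\<lambda>j. x j - t j) \<le> e\<^sup>2 \<and> norm2 d (\<lambda>j. y j - t' j) \<le> e\<^sup>2"
    and N2: "\<And>t t'. (t, t') \<in> N2 \<Longrightarrow> real m * (s\<^sup>2 - e) \<le> gap m d A t t'"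
  shows "condition_number (matrix_of m d A) \<le> ereal \<beta>"
proof -
  define M where "M = sqrt (real m)"
  have M: "0 < M" "M\<^sup>2 = real m" using m by (auto simp: M_def)
  define u' where "u' = M * (1 + 4 * e)"
  define l' where "l' = M * (s - e / s - 6 * e)"
  have l0: "0 < s - e / s - 6 * e"
  proof -
    have "0 < \<beta> * (s - e / s - 6 * e)" using bound e by linarith
    then show ?thesis using \<beta> by (simp only: zero_less_mult_pos)
  qed
  have "energy m d A x \<le> (M * (1 + e / 2) / (1 - e))\<^sup>2 * norm2 d x" for x
  proof (rule energy_le_of_net[OF _ _ _ net1])
    fix t assume "t \<in> N1"
    then have "energy m d A t \<le> real m * (1 + e)" by (rule N1)
    also have "\<dots> \<le> real m * (1 + e / 2)\<^sup>2"
      by (intro mult_left_mono) (auto simp: power2_eq_square algebra_simps)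
    finally show "energy m d A t \<le> (M * (1 + e / 2))\<^sup>2" by (simp add: power_mult_distrib M)
  qed (use e M in auto)
  moreover have "(M * (1 + e / 2) / (1 - e))\<^sup>2 \<le> u'\<^sup>2"
  proof -
    have "e * e \<le> e * (1 / 2)" using e by (intro mult_left_mono) auto
    moreover have "(1 + 4 * e) * (1 - e) = 1 + 3 * e - 4 * (e * e)" by (simp add: algebra_simps)
    ultimately have "1 + e / 2 \<le> (1 + 4 * e) * (1 - e)" using e by linarith
    then have "(1 + e / 2) / (1 - e) \<le> 1 + 4 * e" using e by (simp add: pos_divide_le_eq)
    then have "M * ((1 + e / 2) / (1 - e)) \<le> u'" unfolding u'_def using M by (intro mult_left_mono) auto
    then show ?thesis using e M by (intro power_mono) auto
  qed
  ultimately have en: "energy m d A x \<le> u'\<^sup>2 * norm2 d x" for x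
    by (meson mult_right_mono norm2_nonneg order.trans)
  have u0: "0 \<le> u'" using e M by (simp add: u'_def)
  have U: "upper_lipschitz (matrix_of m d A) \<le> ereal u'"
    using u0 en by (rule upper_lipschitz_le)
  have L: "ereal l' \<le> lower_lipschitz (matrix_of m d A)"
  proof (rule lower_lipschitz_ge)
    show "0 \<le> l'" using M l0 by (simp add: l'_def)
    fix x y assume "ip d x y = 0" "norm2 d x + norm2 d y = 1"
    from net2[OF this] obtain t t' where t: "(t, t') \<in> N2"
        "norm2 d (\<lambda>j. x j - t j) \<le> e\<^sup>2" "norm2 d (\<lambda>j. y j - t' j) \<le> e\<^sup>2" by blast
    have small: "sqrt (energy m d A w) \<le> M * (3 * e)" if "norm2 d w \<le> e\<^sup>2" for w
    proof (rule real_le_lsqrt)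
      have "energy m d A w \<le> u'\<^sup>2 * e\<^sup>2"
        using en[of w] that by (meson mult_left_mono order.trans zero_le_power2)
      also have "\<dots> = (u' * e)\<^sup>2" by (simp add: power_mult_distrib)
      also have "\<dots> \<le> (M * (3 * e))\<^sup>2"
      proof (rule power_mono)
        have "u' \<le> M * 3" unfolding u'_def using M e by (intro mult_left_mono) auto
        then show "u' * e \<le> M * (3 * e)" using e by (simp add: mult_right_mono mult.assoc[symmetric])
      qed (use u0 e in simp)
      finally show "energy m d A w \<le> (M * (3 * e))\<^sup>2" .
    qed (use M e in auto)
    have "M * (s - e / s) \<le> sqrt (gap m d A t t')"
    proof (rule real_le_rsqrt)
      have "(s - e / s)\<^sup>2 = s\<^sup>2 - 2 * e + (e / s)\<^sup>2"
        using s by (simp add: power2_diff)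
      also have "(e / s)\<^sup>2 \<le> e"
      proof -
        have "e * e \<le> e * s\<^sup>2" using s e by (intro mult_left_mono) auto
        then show ?thesis using s by (simp add: power_divide pos_divide_le_eq power2_eq_square)
      qed
      finally have "(s - e / s)\<^sup>2 \<le> s\<^sup>2 - e" by simp
      then have "real m * (s - e / s)\<^sup>2 \<le> real m * (s\<^sup>2 - e)" by (intro mult_left_mono) auto
      also have "\<dots> \<le> gap m d A t t'" by (rule N2[OF t(1)])
      finally show "(M * (s - e / s))\<^sup>2 \<le> gap m d A t t'" by (simp add: power_mult_distrib M)
    qed
    also have "\<dots> \<le> sqrt (gap m d A x y) + sqrt (energy m d A (\<lambda>j. t j - x j)) + sqrt (energy m d A (\<lambda>j. t' j - y j))"
      by (rule sqrt_gap_triangle)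
    also have "\<dots> \<le> sqrt (gap m d A x y) + M * (3 * e) + M * (3 * e)"
      using t by (intro add_mono small order.refl) (simp_all add: norm2_def norm_minus_commute)
    finally have "l' \<le> sqrt (gap m d A x y)" by (simp add: l'_def algebra_simps)
    then have "l'\<^sup>2 \<le> (sqrt (gap m d A x y))\<^sup>2"
      using M l0 by (intro power_mono) (auto simp: l'_def)
    then show "l'\<^sup>2 \<le> gap m d A x y" by simp
  qed
  obtain l u where lu: "lower_lipschitz (matrix_of m d A) = ereal l" "upper_lipschitz (matrix_of m d A) = ereal u"
    "0 \<le> u"
    using lipschitz_constants_real[OF d, of m A] by metis
  have l'0: "0 < l'" using M l0 by (simp add: l'_def)
  have l: "l' \<le> l" "u \<le> u'" using L U lu by auto
  have "u / l \<le> u' / l'" using l l'0 lu(3) by (intro frac_le) auto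
  also have "\<dots> \<le> \<beta>" using bound M l0 by (simp add: u'_def l'_def pos_divide_le_eq)
  finally show ?thesis
    using l l'0 by (simp add: condition_number_def lu zero_ereal_def)
qed

lemma norm2_coordinates:
  "norm2 d (x :: nat \<Rightarrow> 'a) = (\<Sum>(j, b)\<in>{..<d} \<times> Basis. (inner (x j) b)\<^sup>2)"
proof -
  have "(norm v)\<^sup>2 = (\<Sum>b\<in>Basis. (inner v b)\<^sup>2)" for v :: 'a
    unfolding power2_norm_eq_inner by (subst euclidean_inner) (simp add: power2_eq_square)
  then show ?thesis by (simp add: norm2_def sum.cartesian_product)
qed

lemma sphere_net_exists:
  assumes e: "0 < e" "e \<le> 1"
  obtains N :: "(nat \<Rightarrow> 'a) set" where "finite N" "\<And>t. t \<in> N \<Longrightarrow> norm2 d t = 1"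
    "real (card N) \<le> (4 * exp 2 / e) ^ (2 * d * DIM('a))"
    "\<And>x. norm2 d x = 1 \<Longrightarrow> \<exists>t\<in>N. norm2 d (\<lambda>j. x j - t j) \<le> e\<^sup>2"
proof -
  define z where "z x = (\<lambda>(j, b). inner (x j) b)" for x :: "nat \<Rightarrow> 'a"
  have z: "(\<Sum>i\<in>{..<d} \<times> Basis. (z x i)\<^sup>2) = norm2 d x"
    "(\<Sum>i\<in>{..<d} \<times> Basis. (z x i - z y i)\<^sup>2) = norm2 d (\<lambda>j. x j - y j)" for x y
    unfolding norm2_coordinates by (auto simp: z_def inner_diff_left intro!: sum.cong)
  obtain N where N: "finite N" "N \<subseteq> {x. norm2 d x = 1}"
      "real (card N) \<le> (4 * exp 2 / e) ^ card ({..<d} \<times> (Basis :: 'a set))"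
      "\<And>x. x \<in> {x. norm2 d x = 1} \<Longrightarrow> \<exists>t\<in>N. (\<Sum>i\<in>{..<d} \<times> Basis. (z x i - z t i)\<^sup>2) \<le> e\<^sup>2"
    by (rule finite_net_exists[of "{..<d} \<times> (Basis :: 'a set)" e "{x. norm2 d x = 1}" z])
      (use e in \<open>auto simp: z\<close>)
  note N(3)
  \<comment> \<open>The exponent is doubled so that both nets share one cardinality bound.\<close>
  also have "(4 * exp 2 / e) ^ card ({..<d} \<times> (Basis :: 'a set)) \<le> (4 * exp 2 / e) ^ (2 * d * DIM('a))"
  proof (rule power_increasing)
    have "1 \<le> exp (2::real)" by simp
    then show "1 \<le> 4 * exp 2 / e" using e by (simp only: pos_le_divide_eq)
  qed (simp add: card_cartesian_product)
  finally show ?thesis using N by (intro that[of N]) (auto simp: z)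
qed

text \<open>A pair is a point of the unit sphere in coordinates indexed by a disjoint sum of two
  copies of the index set. Net points must be orthogonal themselves, since \<open>gap_tail\<close>
  is available only for such pairs.\<close>

lemma orthogonal_net_exists:
  assumes e: "0 < e" "e \<le> 1"
  obtains N :: "((nat \<Rightarrow> 'a) \<times> (nat \<Rightarrow> 'a)) set" where "finite N"
    "\<And>t t'. (t, t') \<in> N \<Longrightarrow> ip d t t' = 0 \<and> norm2 d t + norm2 d t' = 1"
    "real (card N) \<le> (4 * exp 2 / e) ^ (2 * d * DIM('a))"
    "\<And>x y. ip d x y = 0 \<Longrightarrow> norm2 d x + norm2 d y = 1 \<Longrightarrow>
      \<exists>(t, t')\<in>N. norm2 d (\<lambda>j. x j - t j) \<le> e\<^sup>2 \<and> norm2 d (\<lambda>j. y j - t' j) \<le> e\<^sup>2"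
proof -
  let ?J = "{..<d} \<times> (Basis :: 'a set)"
  let ?I = "?J <+> ?J"
  let ?S = "{(x, y). ip d x y = 0 \<and> norm2 d x + norm2 d y = 1}"
  define z where "z p = case_sum (\<lambda>(j, b). inner (fst p j) b) (\<lambda>(j, b). inner (snd p j) b)"
    for p :: "(nat \<Rightarrow> 'a) \<times> (nat \<Rightarrow> 'a)"
  have fin: "finite ?J" by simp
  have z: "(\<Sum>i\<in>?I. (z (x, y) i)\<^sup>2) = norm2 d x + norm2 d y"
    "(\<Sum>i\<in>?I. (z (x, y) i - z (x', y') i)\<^sup>2) = norm2 d (\<lambda>j. x j - x' j) + norm2 d (\<lambda>j. y j - y' j)" for x y x' y'
    unfolding norm2_coordinates
    by (subst sum.Plus, simp, simp, auto simp: z_def inner_diff_left intro!: sum.cong arg_cong2[of _ _ _ _ "(+)"])+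
  obtain N where N: "finite N" "N \<subseteq> ?S"
      "real (card N) \<le> (4 * exp 2 / e) ^ card ?I"
      "\<And>p. p \<in> ?S \<Longrightarrow> \<exists>t\<in>N. (\<Sum>i\<in>?I. (z p i - z t i)\<^sup>2) \<le> e\<^sup>2"
  proof (rule finite_net_exists[of ?I e ?S z])
    show "(\<Sum>i\<in>?I. (z p i)\<^sup>2) \<le> 1" if "p \<in> ?S" for p
      using that by (cases p) (simp only: z, simp)
  qed (use e fin in simp_all)
  have card: "card ?I = 2 * d * DIM('a)"
    by (subst card_Plus) (auto simp: card_cartesian_product)
  show ?thesis
  proof (rule that[OF N(1)])
    show "real (card N) \<le> (4 * exp 2 / e) ^ (2 * d * DIM('a))" using N(3) by (simp only: card)
    fix x y assume "ip d x y = 0" "norm2 d x + norm2 d y = 1"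
    then obtain t t' where "(t, t') \<in> N" "(\<Sum>i\<in>?I. (z (x, y) i - z (t, t') i)\<^sup>2) \<le> e\<^sup>2"
      using N(4)[of "(x, y)"] by auto
    then have t: "(t, t') \<in> N" and le: "norm2 d (\<lambda>j. x j - t j) + norm2 d (\<lambda>j. y j - t' j) \<le> e\<^sup>2"
      by (simp_all only: z)
    have "norm2 d (\<lambda>j. x j - t j) \<le> e\<^sup>2" "norm2 d (\<lambda>j. y j - t' j) \<le> e\<^sup>2"
      using le norm2_nonneg[of d "\<lambda>j. x j - t j"] norm2_nonneg[of d "\<lambda>j. y j - t' j"] by linarith+
    with t show "\<exists>(t, t')\<in>N. norm2 d (\<lambda>j. x j - t j) \<le> e\<^sup>2 \<and> norm2 d (\<lambda>j. y j - t' j) \<le> e\<^sup>2"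
      by blast
  qed (use N(2) in auto)
qed

end

section \<open>The mesh of the nets and the cost of the union bound\<close>

lemma net_scale_exists:
  fixes s :: real
  assumes "0 < s" "s \<le> 1"
  obtains \<theta> where "0 < \<theta>" "\<theta> \<le> 1 / 4" "\<And>\<delta>. 0 < \<delta> \<Longrightarrow> \<delta> < 1 \<Longrightarrow> \<theta> * \<delta> \<le> s\<^sup>2 \<and>
    1 + 4 * (\<theta> * \<delta>) \<le> (1 / s + \<delta>) * (s - \<theta> * \<delta> / s - 6 * (\<theta> * \<delta>))"
proof -
  define K where "K = 1 / s + 6"
  \<comment> \<open>With e = \<theta> \<delta>, the product (1/s + \<delta>) (s - e K) equals 1 +
    \<delta> s - e K/s - \<delta> e K. As \<delta> < 1, it is at least 1 + 4 e once e (4 + K/s + K)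
    <= \<delta> s; this \<theta> gives equality.\<close>
  define \<theta> where "\<theta> = s / (4 + K / s + K)"
  have K: "1 / s \<le> K" "0 < K" using assms by (auto simp: K_def add_pos_pos)
  have D: "0 < 4 + K / s + K" using K assms by (auto intro!: add_pos_pos)
  have \<theta>: "\<theta> * (4 + K / s + K) = s" using D by (simp add: \<theta>_def)
  have pos: "0 < \<theta>" using assms D by (simp add: \<theta>_def)
  have "\<theta> * 4 \<le> \<theta> * (4 + K / s + K)" using pos K assms by (intro mult_left_mono) auto
  then have le: "\<theta> \<le> 1 / 4" using \<theta> assms by simp
  have "\<theta> * (1 / s / s) \<le> \<theta> * (4 + K / s + K)"
  proof (rule mult_left_mono)
    have "1 / s / s \<le> K / s" using K assms by (intro divide_right_mono) auto
    then show "1 / s / s \<le> 4 + K / s + K" using K by linarith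
  qed (use pos in simp)
  then have "\<theta> * (1 / s / s) * (s * s) \<le> s * (s * s)"
    unfolding \<theta> using assms by (intro mult_right_mono) auto
  then have "\<theta> \<le> s * (s * s)" using assms by simp
  also have "\<dots> \<le> 1 * (s * s)" using assms by (intro mult_right_mono) auto
  finally have sq: "\<theta> \<le> s\<^sup>2" by (simp add: power2_eq_square)
  show ?thesis
  proof (rule that[OF pos le])
    fix \<delta> :: real assume \<delta>: "0 < \<delta>" "\<delta> < 1"
    define e where "e = \<theta> * \<delta>"
    have e: "0 < e" using pos \<delta> by (simp add: e_def)
    have "e \<le> \<theta>" using pos \<delta> by (simp add: e_def mult_left_le)
    then have 1: "e \<le> s\<^sup>2" using sq by linarith
    have eK: "e * (4 + K / s + K) = \<delta> * s"
      using \<theta> by (simp add: e_def mult.commute mult.left_commute)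
    have K1: "s - e / s - 6 * e = s - e * K" by (simp add: K_def algebra_simps)
    have K2: "(1 / s + \<delta>) * (s - e * K) = 1 + \<delta> * s - e * (K / s) - \<delta> * (e * K)"
      using assms by (simp add: field_simps)
    have K3: "\<delta> * (e * K) \<le> 1 * (e * K)" using \<delta> e K by (intro mult_right_mono) auto
    have K4: "\<delta> * s = e * 4 + e * (K / s) + e * K" unfolding eK[symmetric] by (simp add: algebra_simps)
    have 2: "1 + 4 * e \<le> (1 / s + \<delta>) * (s - e / s - 6 * e)"
      unfolding K1 K2 using K3 K4 by linarith
    show "\<theta> * \<delta> \<le> s\<^sup>2 \<and> 1 + 4 * (\<theta> * \<delta>) \<le> (1 / s + \<delta>) * (s - \<theta> * \<delta> / s - 6 * (\<theta> * \<delta>))"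
      using 1 2 by (simp add: e_def)
  qed
qed

text \<open>For \<delta> < 0.4 the number ln (1/\<delta>) is at least 1 - \<delta> >= 1/2, so the
  constant ln T is at most 2 ln T ln (1/\<delta>). The logarithm of the net size is thus a multiple
  of d ln (1/\<delta>), and the condition on \<open>m\<close> lets half of the tail exponent pay for
  it.\<close>

lemma net_size_absorbed:
  fixes \<theta> \<delta> T c :: real and k d m :: nat
  assumes \<delta>: "0 < \<delta>" "\<delta> < 0.4" and T: "1 \<le> T" and c: "0 < c"
    and m: "(real k * (1 + 2 * ln T) / c) * ln (1 / \<delta>) * (1 / \<delta>\<^sup>2) * real d \<le> real m"
  shows "(T / \<delta>) ^ (k * d) * exp (- 2 * c * \<delta>\<^sup>2 * real m) \<le> exp (- c * \<delta>\<^sup>2 * real m)"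
proof -
  define \<Lambda> where "\<Lambda> = ln (1 / \<delta>)"
  have "1 - \<delta> \<le> \<Lambda>"
    using ln_le_minus_one[of \<delta>] \<delta> by (simp add: \<Lambda>_def ln_div)
  then have \<Lambda>: "1 / 2 \<le> \<Lambda>" using \<delta> by simp
  have lnT: "0 \<le> ln T" using T by simp
  have "ln T * 1 \<le> ln T * (2 * \<Lambda>)" using lnT \<Lambda> by (intro mult_left_mono) auto
  then have "ln (T / \<delta>) \<le> (1 + 2 * ln T) * \<Lambda>"
    using T \<delta> by (simp add: ln_div \<Lambda>_def algebra_simps)
  then have "real (k * d) * ln (T / \<delta>) \<le> real (k * d) * ((1 + 2 * ln T) * \<Lambda>)"
    by (intro mult_left_mono) auto
  also have "\<dots> = c * \<delta>\<^sup>2 * ((real k * (1 + 2 * ln T) / c) * \<Lambda> * (1 / \<delta>\<^sup>2) * real d)"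
    using c \<delta> by simp
  also have "\<dots> \<le> c * \<delta>\<^sup>2 * real m"
    using m c by (intro mult_left_mono) (auto simp: \<Lambda>_def)
  finally have "real (k * d) * ln (T / \<delta>) \<le> c * \<delta>\<^sup>2 * real m" .
  moreover have "(T / \<delta>) ^ (k * d) = exp (real (k * d) * ln (T / \<delta>))"
    using T \<delta> by (simp only: exp_of_nat_mult) (simp add: exp_ln)
  ultimately have "(T / \<delta>) ^ (k * d) * exp (- 2 * c * \<delta>\<^sup>2 * real m) \<le> exp (c * \<delta>\<^sup>2 * real m) * exp (- 2 * c * \<delta>\<^sup>2 * real m)"
    by (intro mult_right_mono) auto
  also have "\<dots> = exp (- c * \<delta>\<^sup>2 * real m)" by (simp add: exp_add[symmetric])
  finally show ?thesis .
qed

lemma (in prob_space) prob_UN_le_card: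
  assumes "finite N" "\<And>t. t \<in> N \<Longrightarrow> B t \<in> events" "\<And>t. t \<in> N \<Longrightarrow> prob (B t) \<le> p"
    and "real (card N) \<le> n" "0 \<le> p"
  shows "prob (\<Union>t\<in>N. B t) \<le> n * p"
proof -
  have "prob (\<Union>t\<in>N. B t) \<le> (\<Sum>t\<in>N. prob (B t))"
    using assms by (intro finite_measure_subadditive_finite) auto
  also have "\<dots> \<le> (\<Sum>t\<in>N. p)" by (intro sum_mono assms)
  also have "\<dots> \<le> n * p" using assms(4,5) by (simp add: mult_right_mono)
  finally show ?thesis .
qed

context gaussian_field
begin

text \<open>The lower inequality holds surely. Failure can come only from a net vector with too much
  energy or a net pair with too small a gap; the factor 2 counts these two nets.\<close>

theorem condition_number_concentration:
  "\<exists>C>0. \<exists>c>0. \<forall>(m::nat) (d::nat) (\<delta>::real). 2 \<le> d \<longrightarrow> 0 < \<delta> \<longrightarrow> \<delta> < 0.4 \<longrightarrow>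
     C * ln (1 / \<delta>) * (1 / \<delta>\<^sup>2) * real d \<le> real m \<longrightarrow>
     1 - 2 * exp (- c * \<delta>\<^sup>2 * real m) \<le>
       measure (PiM {..<m} (\<lambda>_. row d)) {\<omega> \<in> space (PiM {..<m} (\<lambda>_. row d)).
         ereal (1 / sqrt (1 - \<mu>\<^sup>2)) \<le> condition_number (matrix_of m d \<omega>) \<and>
         condition_number (matrix_of m d \<omega>) \<le> ereal (1 / sqrt (1 - \<mu>\<^sup>2) + \<delta>)}"
proof -
  define s where "s = sqrt (1 - \<mu>\<^sup>2)"
  have s: "0 < s" "s \<le> 1" "s\<^sup>2 = 1 - \<mu>\<^sup>2" using mu by (auto simp: s_def)
  obtain \<theta> where \<theta>: "0 < \<theta>" "\<theta> \<le> 1 / 4" and scale: "\<And>\<delta>. 0 < \<delta> \<Longrightarrow> \<delta> < 1 \<Longrightarrow> \<theta> * \<delta> \<le> s\<^sup>2 \<and>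
    1 + 4 * (\<theta> * \<delta>) \<le> (1 / s + \<delta>) * (s - \<theta> * \<delta> / s - 6 * (\<theta> * \<delta>))"
    using net_scale_exists[OF s(1,2)] by metis
  define k where "k = 2 * DIM('a)"
  define T where "T = 4 * exp 2 / \<theta>"
  \<comment> \<open>With mesh \<open>e = \<theta> * \<delta>\<close>, the weaker of the two tail
    exponents, e^2 / 16, equals 2 c \<delta>^2. One half is spent on the net, the other survives in
    the probability.\<close>
  define c where "c = \<theta>\<^sup>2 / 32"
  define C where "C = real k * (1 + 2 * ln T) / c"
  have T: "1 \<le> T"
  proof -
    have "1 \<le> exp (2::real)" by simp
    then have "\<theta> \<le> 4 * exp 2" using \<theta> by linarith
    then show ?thesis using \<theta> by (simp add: T_def)
  qed
  have c: "0 < c" using \<theta> by (simp add: c_def)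
  have C: "0 < C" using T c by (simp add: C_def k_def add_pos_nonneg)
  show ?thesis
  proof (rule exI[of _ C], rule conjI[OF C], rule exI[of _ c], rule conjI[OF c], intro allI impI)
    fix m d :: nat and \<delta> :: real
    assume d: "2 \<le> d" and \<delta>: "0 < \<delta>" "\<delta> < 0.4" and m: "C * ln (1 / \<delta>) * (1 / \<delta>\<^sup>2) * real d \<le> real m"
    define e where "e = \<theta> * \<delta>"
    have e: "0 < e" "e \<le> 1 / 2"
      using \<theta> \<delta> mult_mono[of \<theta> "1 / 4" \<delta> 1] by (auto simp: e_def)
    have m0: "0 < m"
    proof -
      have "0 < C * ln (1 / \<delta>) * (1 / \<delta>\<^sup>2) * real d"
        using C \<delta> d by (intro mult_pos_pos) (auto simp: ln_div)
      then have "0 < real m" using m by linarith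
      then show ?thesis by simp
    qed
    let ?M = "PiM {..<m} (\<lambda>_. row d)"
    interpret M: prob_space ?M by (intro prob_space_PiM prob_row)
    let ?n = "(4 * exp 2 / e) ^ (2 * d * DIM('a))"
    obtain N1 :: "(nat \<Rightarrow> 'a) set" where N1: "finite N1" "\<And>t. t \<in> N1 \<Longrightarrow> norm2 d t = 1" "real (card N1) \<le> ?n"
        "\<And>x. norm2 d x = 1 \<Longrightarrow> \<exists>t\<in>N1. norm2 d (\<lambda>j. x j - t j) \<le> e\<^sup>2"
      using sphere_net_exists[of e d] e by auto
    obtain N2 :: "((nat \<Rightarrow> 'a) \<times> (nat \<Rightarrow> 'a)) set" where N2: "finite N2" "\<And>t t'. (t, t') \<in> N2 \<Longrightarrow> ip d t t' = 0 \<and> norm2 d t + norm2 d t' = 1"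
        "real (card N2) \<le> ?n"
        "\<And>x y. ip d x y = 0 \<Longrightarrow> norm2 d x + norm2 d y = 1 \<Longrightarrow>
          \<exists>(t, t')\<in>N2. norm2 d (\<lambda>j. x j - t j) \<le> e\<^sup>2 \<and> norm2 d (\<lambda>j. y j - t' j) \<le> e\<^sup>2"
      using orthogonal_net_exists[of e d] e by auto
    define B1 where "B1 t = {\<omega> \<in> space ?M. real m * (1 + e) \<le> energy m d \<omega> t}" for t
    define B2 where "B2 p = {\<omega> \<in> space ?M. gap m d \<omega> (fst p) (snd p) \<le> real m * (1 - \<mu>\<^sup>2 - e)}" for p
    have meas: "B1 t \<in> sets ?M" "B2 p \<in> sets ?M" for t p
      unfolding B1_def B2_def using measurable_energy measurable_gap by simp_all
    define bad where "bad = (\<Union>t\<in>N1. B1 t) \<union> (\<Union>p\<in>N2. B2 p)"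
    have UN: "(\<Union>t\<in>N1. B1 t) \<in> sets ?M" "(\<Union>q\<in>N2. B2 q) \<in> sets ?M"
      by (intro sets.finite_UN N1(1) N2(1) meas)+
    then have bad: "bad \<in> sets ?M" unfolding bad_def by (rule sets.Un)
    define p where "p = exp (- 2 * c * \<delta>\<^sup>2 * real m)"
    have p12: "exp (- real m * e\<^sup>2 / 16) = p"
      by (simp add: p_def c_def e_def power_mult_distrib)
    have "M.prob (B1 t) \<le> p" if "t \<in> N1" for t
      unfolding B1_def p12[symmetric] using e by (intro energy_tail N1(2) that) auto
    then have P1: "M.prob (\<Union>t\<in>N1. B1 t) \<le> ?n * p"
      by (intro M.prob_UN_le_card N1(1,3) meas) (simp_all add: p_def)
    have "M.prob (B2 q) \<le> p" if "q \<in> N2" for q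
    proof -
      have "M.prob (B2 q) \<le> exp (- real m * e\<^sup>2 / 12)"
        unfolding B2_def using e N2(2)[of "fst q" "snd q"] that by (intro gap_tail) auto
      also have "\<dots> \<le> p" unfolding p12[symmetric] by simp
      finally show ?thesis .
    qed
    then have P2: "M.prob (\<Union>q\<in>N2. B2 q) \<le> ?n * p"
      by (intro M.prob_UN_le_card N2(1,3) meas) (simp_all add: p_def)
    have "M.prob bad \<le> M.prob (\<Union>t\<in>N1. B1 t) + M.prob (\<Union>q\<in>N2. B2 q)"
      unfolding bad_def by (rule measure_Un_le[OF UN])
    also have "\<dots> \<le> 2 * (?n * p)" using P1 P2 by simp
    also have "?n = (T / \<delta>) ^ (k * d)" by (simp add: T_def e_def k_def mult_ac)
    also have "(T / \<delta>) ^ (k * d) * p \<le> exp (- c * \<delta>\<^sup>2 * real m)"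
      unfolding p_def by (rule net_size_absorbed[OF \<delta> T c]) (use m in \<open>simp only: C_def\<close>)
    finally have Pbad: "M.prob bad \<le> 2 * exp (- c * \<delta>\<^sup>2 * real m)" by simp
    let ?A = "{\<omega> \<in> space ?M. ereal (1 / s) \<le> condition_number (matrix_of m d \<omega>) \<and>
         condition_number (matrix_of m d \<omega>) \<le> ereal (1 / s + \<delta>)}"
    have A: "?A \<in> sets ?M"
      using measurable_condition_number[of m d] by simp
    have "space ?M - bad \<subseteq> ?A"
    proof
      fix \<omega> assume \<omega>: "\<omega> \<in> space ?M - bad"
      have "condition_number (matrix_of m d \<omega>) \<le> ereal (1 / s + \<delta>)"
      proof (rule condition_number_le_of_nets[OF _ e s(1) _ m0 _ _ N1(4) _ N2(4)])
        show "0 < d" using d by simp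
        show "e \<le> s\<^sup>2" "1 + 4 * e \<le> (1 / s + \<delta>) * (s - e / s - 6 * e)"
          using scale[of \<delta>] \<delta> by (auto simp: e_def)
        show "0 < 1 / s + \<delta>" using s \<delta> by (simp add: add_pos_pos)
        show "energy m d \<omega> t \<le> real m * (1 + e)" if "t \<in> N1" for t
          using \<omega> that by (auto simp: bad_def B1_def)
        show "real m * (s\<^sup>2 - e) \<le> gap m d \<omega> t t'" if "(t, t') \<in> N2" for t t'
          using \<omega> that unfolding s(3) by (force simp: bad_def B2_def)
      qed
      moreover have "ereal (1 / s) \<le> condition_number (matrix_of m d \<omega>)"
        unfolding s_def by (rule condition_number_ge[OF d])
      ultimately show "\<omega> \<in> ?A" using \<omega> by simp
    qed
    then have "M.prob (space ?M - bad) \<le> M.prob ?A"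
      by (rule M.finite_measure_mono) (rule A)
    then have "1 - 2 * exp (- c * \<delta>\<^sup>2 * real m) \<le> M.prob ?A"
      using Pbad M.prob_compl[OF bad] by linarith
    then show "1 - 2 * exp (- c * \<delta>\<^sup>2 * real m) \<le>
       measure ?M {\<omega> \<in> space ?M.
         ereal (1 / sqrt (1 - \<mu>\<^sup>2)) \<le> condition_number (matrix_of m d \<omega>) \<and>
         condition_number (matrix_of m d \<omega>) \<le> ereal (1 / sqrt (1 - \<mu>\<^sup>2) + \<delta>)}"
      by (simp only: s_def)
  qed
qed

end

subsection \<open>The real and the complex Gaussian law\<close>

text \<open>One variable is substituted at a time. For nonzero \<open>c\<close> the first affine
  substitution contributes the factor 1 / |c|, which the second absorbs; for \<open>c = 0\<close>
  the rotation exchanges the coordinates up to signs.\<close>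

lemma nn_integral_lborel_rotation:
  fixes F :: "real \<times> real \<Rightarrow> ennreal"
  assumes cs: "c\<^sup>2 + s\<^sup>2 = 1" and [measurable]: "F \<in> borel_measurable (borel \<Otimes>\<^sub>M borel)"
  shows "(\<integral>\<^sup>+g. \<integral>\<^sup>+h. F (c * g + s * h, c * h - s * g) \<partial>lborel \<partial>lborel) =
    (\<integral>\<^sup>+g. \<integral>\<^sup>+h. F (g, h) \<partial>lborel \<partial>lborel)"
proof (cases "c = 0")
  case True
  then have s: "\<bar>s\<bar> = 1" using cs by (auto simp: power2_eq_1_iff)
  then have s0: "s \<noteq> 0" "- s \<noteq> 0" by auto
  have "(\<integral>\<^sup>+g. \<integral>\<^sup>+h. F (c * g + s * h, c * h - s * g) \<partial>lborel \<partial>lborel) =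
      (\<integral>\<^sup>+g. \<integral>\<^sup>+h. F (h, - s * g) \<partial>lborel \<partial>lborel)"
  proof (rule nn_integral_cong)
    fix g
    show "(\<integral>\<^sup>+h. F (c * g + s * h, c * h - s * g) \<partial>lborel) = (\<integral>\<^sup>+h. F (h, - s * g) \<partial>lborel)"
      using True s by (subst (2) nn_integral_real_affine[OF _ s0(1), of _ 0]) simp_all
  qed
  also have "\<dots> = (\<integral>\<^sup>+h. \<integral>\<^sup>+g. F (h, - s * g) \<partial>lborel \<partial>lborel)"
    by (rule lborel_pair.Fubini') measurable
  also have "\<dots> = (\<integral>\<^sup>+h. \<integral>\<^sup>+g. F (h, g) \<partial>lborel \<partial>lborel)"
  proof (rule nn_integral_cong)
    fix h
    show "(\<integral>\<^sup>+g. F (h, - s * g) \<partial>lborel) = (\<integral>\<^sup>+g. F (h, g) \<partial>lborel)"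
      using s by (subst (2) nn_integral_real_affine[OF _ s0(2), of _ 0]) simp_all
  qed
  finally show ?thesis .
next
  case False
  then have ic: "1 / c \<noteq> 0" by simp
  have "(\<integral>\<^sup>+g. \<integral>\<^sup>+h. F (c * g + s * h, c * h - s * g) \<partial>lborel \<partial>lborel) =
      (\<integral>\<^sup>+h. \<integral>\<^sup>+g. F (c * g + s * h, c * h - s * g) \<partial>lborel \<partial>lborel)"
    by (rule lborel_pair.Fubini') measurable
  also have "\<dots> = (\<integral>\<^sup>+h. \<bar>1 / c\<bar> * (\<integral>\<^sup>+u. F (u, - s / c * u + 1 / c * h) \<partial>lborel) \<partial>lborel)"
  proof (rule nn_integral_cong)
    fix h
    have e1: "c * (- s / c * h + 1 / c * u) + s * h = u" for u
      using False by (simp add: field_simps)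
    have e2: "c * h - s * (- s / c * h + 1 / c * u) = - s / c * u + 1 / c * h" for u
    proof -
      have "c * h - s * (- s / c * h + 1 / c * u) = (c\<^sup>2 + s\<^sup>2) / c * h - s / c * u"
        using False by (simp add: field_simps power2_eq_square)
      then show ?thesis by (simp add: cs)
    qed
    show "(\<integral>\<^sup>+g. F (c * g + s * h, c * h - s * g) \<partial>lborel) =
        \<bar>1 / c\<bar> * (\<integral>\<^sup>+u. F (u, - s / c * u + 1 / c * h) \<partial>lborel)"
      by (subst nn_integral_real_affine[OF _ ic, of _ "- s / c * h"]) (measurable, simp only: e1 e2)
  qed
  also have "\<dots> = \<bar>1 / c\<bar> * (\<integral>\<^sup>+h. \<integral>\<^sup>+u. F (u, - s / c * u + 1 / c * h) \<partial>lborel \<partial>lborel)"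
    by (rule nn_integral_cmult) measurable
  also have "(\<integral>\<^sup>+h. \<integral>\<^sup>+u. F (u, - s / c * u + 1 / c * h) \<partial>lborel \<partial>lborel) =
      (\<integral>\<^sup>+u. \<integral>\<^sup>+h. F (u, - s / c * u + 1 / c * h) \<partial>lborel \<partial>lborel)"
    by (rule lborel_pair.Fubini') measurable
  also have "\<bar>1 / c\<bar> * \<dots> = (\<integral>\<^sup>+u. \<bar>1 / c\<bar> * (\<integral>\<^sup>+h. F (u, - s / c * u + 1 / c * h) \<partial>lborel) \<partial>lborel)"
    by (rule nn_integral_cmult[symmetric]) measurable
  also have "\<dots> = (\<integral>\<^sup>+u. \<integral>\<^sup>+h. F (u, h) \<partial>lborel \<partial>lborel)"
    by (intro nn_integral_cong nn_integral_real_affine[OF _ ic, symmetric]) measurable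
  finally show ?thesis .
qed

definition normal_law :: "real \<Rightarrow> real measure" where
  "normal_law \<sigma> = density lborel (\<lambda>t. ennreal (normal_density 0 \<sigma> t))"

lemma sets_normal_law [simp, measurable_cong]: "sets (normal_law \<sigma>) = sets borel"
  by (simp add: normal_law_def)

lemma prob_space_normal_law: "0 < \<sigma> \<Longrightarrow> prob_space (normal_law \<sigma>)"
  unfolding normal_law_def by (rule prob_space_normal_density)

lemma nn_integral_normal_law:
  "f \<in> borel_measurable borel \<Longrightarrow>
    (\<integral>\<^sup>+x. f x \<partial>normal_law \<sigma>) = (\<integral>\<^sup>+x. ennreal (normal_density 0 \<sigma> x) * f x \<partial>lborel)"
  unfolding normal_law_def by (rule nn_integral_density) simp_all

text \<open>The product of two centred normal densities of equal variance depends only on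
  \<open>g\<^sup>2 + h\<^sup>2\<close>, so the invariance is inherited from Lebesgue
  measure.\<close>

lemma normal_law_rotation:
  assumes cs: "c\<^sup>2 + s\<^sup>2 = 1" and [measurable]: "f \<in> borel_measurable (borel \<Otimes>\<^sub>M borel)" and \<sigma>: "0 < \<sigma>"
  shows "(\<integral>\<^sup>+g. \<integral>\<^sup>+h. f (c * g + s * h, c * h - s * g) \<partial>normal_law \<sigma> \<partial>normal_law \<sigma>) =
    (\<integral>\<^sup>+g. \<integral>\<^sup>+h. f (g, h) \<partial>normal_law \<sigma> \<partial>normal_law \<sigma>)"
proof -
  interpret prob_space "normal_law \<sigma>" using \<sigma> by (rule prob_space_normal_law)
  define F where "F = (\<lambda>(g, h). ennreal (normal_density 0 \<sigma> g * normal_density 0 \<sigma> h) * f (g, h))"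
  have F[measurable]: "F \<in> borel_measurable (borel \<Otimes>\<^sub>M borel)" unfolding F_def by measurable
  have inv: "normal_density 0 \<sigma> (c * g + s * h) * normal_density 0 \<sigma> (c * h - s * g) =
      normal_density 0 \<sigma> g * normal_density 0 \<sigma> h" for g h
  proof -
    have "(c * g + s * h)\<^sup>2 + (c * h - s * g)\<^sup>2 = (c\<^sup>2 + s\<^sup>2) * (g\<^sup>2 + h\<^sup>2)"
      by (simp add: power2_eq_square algebra_simps)
    then have "(c * g + s * h)\<^sup>2 + (c * h - s * g)\<^sup>2 = g\<^sup>2 + h\<^sup>2" by (simp add: cs)
    then have "- (c * g + s * h)\<^sup>2 / (2 * \<sigma>\<^sup>2) + - (c * h - s * g)\<^sup>2 / (2 * \<sigma>\<^sup>2) = - g\<^sup>2 / (2 * \<sigma>\<^sup>2) + - h\<^sup>2 / (2 * \<sigma>\<^sup>2)"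
      unfolding add_divide_distrib[symmetric] by simp
    then have "exp (- (c * g + s * h)\<^sup>2 / (2 * \<sigma>\<^sup>2)) * exp (- (c * h - s * g)\<^sup>2 / (2 * \<sigma>\<^sup>2)) = exp (- g\<^sup>2 / (2 * \<sigma>\<^sup>2)) * exp (- h\<^sup>2 / (2 * \<sigma>\<^sup>2))"
      by (simp only: exp_add[symmetric])
    then show ?thesis unfolding normal_density_def by simp
  qed
  have expand: "(\<integral>\<^sup>+g. \<integral>\<^sup>+h. k (g, h) \<partial>normal_law \<sigma> \<partial>normal_law \<sigma>) =
      (\<integral>\<^sup>+g. \<integral>\<^sup>+h. ennreal (normal_density 0 \<sigma> g * normal_density 0 \<sigma> h) * k (g, h) \<partial>lborel \<partial>lborel)"
    if k[measurable]: "k \<in> borel_measurable (borel \<Otimes>\<^sub>M borel)" for k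
  proof -
    have "(\<integral>\<^sup>+g. \<integral>\<^sup>+h. k (g, h) \<partial>normal_law \<sigma> \<partial>normal_law \<sigma>) =
        (\<integral>\<^sup>+g. ennreal (normal_density 0 \<sigma> g) * (\<integral>\<^sup>+h. k (g, h) \<partial>normal_law \<sigma>) \<partial>lborel)"
      by (rule nn_integral_normal_law) measurable
    also have "\<dots> = (\<integral>\<^sup>+g. \<integral>\<^sup>+h. ennreal (normal_density 0 \<sigma> g * normal_density 0 \<sigma> h) * k (g, h) \<partial>lborel \<partial>lborel)"
    proof (rule nn_integral_cong)
      fix g
      have "(\<integral>\<^sup>+h. k (g, h) \<partial>normal_law \<sigma>) = (\<integral>\<^sup>+h. ennreal (normal_density 0 \<sigma> h) * k (g, h) \<partial>lborel)"
        by (rule nn_integral_normal_law) measurable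
      then show "ennreal (normal_density 0 \<sigma> g) * (\<integral>\<^sup>+h. k (g, h) \<partial>normal_law \<sigma>) =
          (\<integral>\<^sup>+h. ennreal (normal_density 0 \<sigma> g * normal_density 0 \<sigma> h) * k (g, h) \<partial>lborel)"
        by (simp add: nn_integral_cmult ennreal_mult mult.assoc)
    qed
    finally show ?thesis .
  qed
  have "(\<integral>\<^sup>+g. \<integral>\<^sup>+h. f (c * g + s * h, c * h - s * g) \<partial>normal_law \<sigma> \<partial>normal_law \<sigma>) =
      (\<integral>\<^sup>+g. \<integral>\<^sup>+h. F (c * g + s * h, c * h - s * g) \<partial>lborel \<partial>lborel)"
    using expand[of "\<lambda>(g, h). f (c * g + s * h, c * h - s * g)"] by (simp add: F_def inv)
  also have "\<dots> = (\<integral>\<^sup>+g. \<integral>\<^sup>+h. F (g, h) \<partial>lborel \<partial>lborel)"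
    by (rule nn_integral_lborel_rotation[OF cs F])
  also have "\<dots> = (\<integral>\<^sup>+g. \<integral>\<^sup>+h. f (g, h) \<partial>normal_law \<sigma> \<partial>normal_law \<sigma>)"
    by (subst expand) (simp_all add: F_def)
  finally show ?thesis .
qed

lemma nn_integral_normal_law_eqI:
  assumes "has_bochner_integral lborel (\<lambda>x. normal_density 0 \<sigma> x * h x) v"
    and [measurable]: "h \<in> borel_measurable borel" and "\<And>x. 0 \<le> h x" "0 < \<sigma>"
  shows "(\<integral>\<^sup>+x. ennreal (h x) \<partial>normal_law \<sigma>) = ennreal v"
proof -
  have "(\<integral>\<^sup>+x. ennreal (h x) \<partial>normal_law \<sigma>) = (\<integral>\<^sup>+x. ennreal (normal_density 0 \<sigma> x * h x) \<partial>lborel)"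
    using assms(3) by (simp add: nn_integral_normal_law ennreal_mult)
  also have "\<dots> = ennreal (\<integral>x. normal_density 0 \<sigma> x * h x \<partial>lborel)"
    using assms by (intro nn_integral_eq_integral) (auto intro: integrable.intros)
  finally show ?thesis using has_bochner_integral_integral_eq[OF assms(1)] by simp
qed

lemma normal_law_abs: "0 < \<sigma> \<Longrightarrow> (\<integral>\<^sup>+x. ennreal \<bar>x\<bar> \<partial>normal_law \<sigma>) = ennreal (\<sigma> * sqrt (2 / pi))"
  using normal_moment_abs_odd[of \<sigma> 0 0] by (intro nn_integral_normal_law_eqI) auto

lemma normal_law_square: "0 < \<sigma> \<Longrightarrow> (\<integral>\<^sup>+x. ennreal (x\<^sup>2) \<partial>normal_law \<sigma>) = ennreal (\<sigma>\<^sup>2)"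
  using normal_moment_even[of \<sigma> 0 1] by (intro nn_integral_normal_law_eqI) (auto simp: fact_numeral)

lemma normal_law_fourth: "0 < \<sigma> \<Longrightarrow> (\<integral>\<^sup>+x. ennreal (x^4) \<partial>normal_law \<sigma>) = ennreal (3 * \<sigma>^4)"
  using normal_moment_even[of \<sigma> 0 2]
  by (intro nn_integral_normal_law_eqI)
    (auto simp: fact_numeral power_divide power_mult[symmetric] field_simps)

lemma normal_law_exp_square:
  assumes \<sigma>: "0 < \<sigma>" and t: "2 * t * \<sigma>\<^sup>2 < 1"
  shows "(\<integral>\<^sup>+x. ennreal (exp (t * x\<^sup>2)) \<partial>normal_law \<sigma>) = ennreal (1 / sqrt (1 - 2 * t * \<sigma>\<^sup>2))"
proof -
  define q where "q = sqrt (1 - 2 * t * \<sigma>\<^sup>2)"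
  have q: "0 < q" "q\<^sup>2 = 1 - 2 * t * \<sigma>\<^sup>2" using t by (auto simp: q_def)
  \<comment> \<open>Tilting a centred Gaussian by exp (t x^2) gives 1 / q times the density of the
    Gaussian with this larger standard deviation, so the integral is 1 / q.\<close>
  define \<tau> where "\<tau> = \<sigma> / q"
  have \<tau>: "0 < \<tau>" using \<sigma> q by (simp add: \<tau>_def)
  have e: "normal_density 0 \<sigma> x * exp (t * x\<^sup>2) = 1 / q * normal_density 0 \<tau> x" for x
  proof -
    have "- x\<^sup>2 / (2 * \<sigma>\<^sup>2) + t * x\<^sup>2 = - x\<^sup>2 * (1 - 2 * t * \<sigma>\<^sup>2) / (2 * \<sigma>\<^sup>2)"
      using \<sigma> by (simp add: field_simps)
    also have "\<dots> = - x\<^sup>2 / (2 * \<tau>\<^sup>2)"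
      using \<sigma> q(1) unfolding q(2)[symmetric] by (simp add: \<tau>_def power_divide)
    finally have "exp (- x\<^sup>2 / (2 * \<sigma>\<^sup>2)) * exp (t * x\<^sup>2) = exp (- x\<^sup>2 / (2 * \<tau>\<^sup>2))"
      by (simp only: exp_add[symmetric])
    moreover have "sqrt (2 * pi * \<tau>\<^sup>2) = sqrt (2 * pi * \<sigma>\<^sup>2) / q"
      using q(1) by (simp add: \<tau>_def power_divide real_sqrt_divide real_sqrt_mult)
    ultimately show ?thesis
      using q(1) by (simp add: normal_density_def mult.assoc)
  qed
  have "has_bochner_integral lborel (\<lambda>x. normal_density 0 \<tau> x) 1"
    using normal_moment_even[OF \<tau>, of 0 0] by simp
  then have "has_bochner_integral lborel (\<lambda>x. 1 / q * normal_density 0 \<tau> x) (1 / q * 1)"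
    by (rule has_bochner_integral_mult_right)
  then show ?thesis
    using \<sigma> by (intro nn_integral_normal_law_eqI) (auto simp: e q_def)
qed

lemma inverse_le_exp: "exp (- a) \<le> b \<Longrightarrow> 1 / b \<le> exp a" for a b :: real
proof -
  assume le: "exp (- a) \<le> b"
  then have "0 < b" using exp_gt_zero[of "- a"] by linarith
  then show ?thesis using le by (simp add: exp_minus field_simps)
qed

text \<open>Both come from ln (1 - x) >= - x - 2 x^2 for 0 <= x <= 1/2. The real case takes x = 2 t
  and halves, which fixes the range t <= 1/4 and the coefficient 4; the complex case takes x =
  t.\<close>

lemma mgf_bounds:
  assumes "0 \<le> t" "t \<le> 1 / 4"
  shows "1 / sqrt (1 - 2 * t) \<le> exp (t + 4 * t\<^sup>2)" "1 / (1 - t) \<le> exp (t + 4 * t\<^sup>2)"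
proof -
  have "- (2 * t) - 2 * (2 * t)\<^sup>2 \<le> ln (1 - 2 * t)"
    using assms by (intro ln_one_minus_pos_lower_bound) auto
  then have "exp (- (t + 4 * t\<^sup>2)) \<le> exp (ln (1 - 2 * t) / 2)" by (simp add: power_mult_distrib)
  also have "\<dots> = sqrt (1 - 2 * t)" using assms by (simp add: ln_sqrt[symmetric])
  finally show "1 / sqrt (1 - 2 * t) \<le> exp (t + 4 * t\<^sup>2)"
    by (rule inverse_le_exp)
  have "- t - 2 * t\<^sup>2 \<le> ln (1 - t)"
    using assms by (intro ln_one_minus_pos_lower_bound) auto
  then have "- (t + 4 * t\<^sup>2) \<le> ln (1 - t)" using zero_le_power2[of t] by linarith
  then have "exp (- (t + 4 * t\<^sup>2)) \<le> exp (ln (1 - t))" by simp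
  then have "exp (- (t + 4 * t\<^sup>2)) \<le> 1 - t" using assms by simp
  then show "1 / (1 - t) \<le> exp (t + 4 * t\<^sup>2)"
    by (rule inverse_le_exp)
qed

section \<open>The scalar complex Gaussian law and its invariances\<close>

definition complex_normal_law :: "complex measure" where
  "complex_normal_law = distr (normal_law (sqrt (1 / 2)) \<Otimes>\<^sub>M normal_law (sqrt (1 / 2))) borel
     (\<lambda>(u, v). Complex u v)"

lemma sets_complex_normal_law [simp, measurable_cong]: "sets complex_normal_law = sets borel"
  by (simp add: complex_normal_law_def)

lemma measurable_Complex [measurable]:
  assumes [measurable]: "f \<in> borel_measurable M" "g \<in> borel_measurable M"
  shows "(\<lambda>x. Complex (f x) (g x)) \<in> borel_measurable M"
  unfolding Complex_eq by measurable

lemma prob_space_half: "prob_space (normal_law (sqrt (1 / 2)))"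
  by (rule prob_space_normal_law) simp

lemma measurable_case_Complex:
  "(\<lambda>(u, v). Complex u v) \<in> borel_measurable (normal_law (sqrt (1 / 2)) \<Otimes>\<^sub>M normal_law (sqrt (1 / 2)))"
  by measurable

lemma prob_space_complex_normal_law: "prob_space complex_normal_law"
proof -
  interpret pair_prob_space "normal_law (sqrt (1 / 2))" "normal_law (sqrt (1 / 2))"
    using prob_space_half by (simp add: pair_prob_space_def pair_sigma_finite_def prob_space_imp_sigma_finite)
  show ?thesis unfolding complex_normal_law_def by (rule prob_space_distr[OF measurable_case_Complex])
qed

lemma nn_integral_complex_normal_law:
  assumes [measurable]: "f \<in> borel_measurable borel"
  shows "(\<integral>\<^sup>+z. f z \<partial>complex_normal_law) =
    (\<integral>\<^sup>+u. \<integral>\<^sup>+v. f (Complex u v) \<partial>normal_law (sqrt (1 / 2)) \<partial>normal_law (sqrt (1 / 2)))"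
proof -
  interpret N: prob_space "normal_law (sqrt (1 / 2))" by (rule prob_space_half)
  have "(\<integral>\<^sup>+z. f z \<partial>complex_normal_law) =
      (\<integral>\<^sup>+p. f (case p of (u, v) \<Rightarrow> Complex u v) \<partial>(normal_law (sqrt (1 / 2)) \<Otimes>\<^sub>M normal_law (sqrt (1 / 2))))"
    unfolding complex_normal_law_def by (rule nn_integral_distr[OF measurable_case_Complex]) measurable
  also have "\<dots> = (\<integral>\<^sup>+u. \<integral>\<^sup>+v. f (case (u, v) of (u, v) \<Rightarrow> Complex u v) \<partial>normal_law (sqrt (1 / 2)) \<partial>normal_law (sqrt (1 / 2)))"
    by (rule N.nn_integral_fst[symmetric]) measurable
  finally show ?thesis by simp
qed

text \<open>Multiplication by a unimodular \<open>c\<close> is a plane rotation of the real and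
  imaginary parts, with cosine Re c and, in the sign convention of
  \<open>normal_law_rotation\<close>, sine - Im c.\<close>

lemma complex_phase_invariance:
  assumes c: "norm c = 1" and [measurable]: "f \<in> borel_measurable borel"
  shows "(\<integral>\<^sup>+z. f (c * z) \<partial>complex_normal_law) = (\<integral>\<^sup>+z. f z \<partial>complex_normal_law)"
proof -
  have cs: "(Re c)\<^sup>2 + (- Im c)\<^sup>2 = 1" using c by (simp add: cmod_power2[symmetric])
  have e: "c * Complex u v = Complex (Re c * u + - Im c * v) (Re c * v - - Im c * u)" for u v
    by (simp add: complex_eq_iff)
  show ?thesis
    using normal_law_rotation[OF cs, of "\<lambda>(a, b). f (Complex a b)" "sqrt (1 / 2)"]
    by (simp add: nn_integral_complex_normal_law e)
qed

text \<open>A real rotation of two complex scalars acts on their real parts and on their imaginary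
  parts separately. Reordering the four integrals groups these, and the planar invariance is applied
  once to each group.\<close>

lemma complex_rotation_invariance:
  assumes cs: "c\<^sup>2 + s\<^sup>2 = 1" and [measurable]: "f \<in> borel_measurable (borel \<Otimes>\<^sub>M borel)"
  shows "(\<integral>\<^sup>+g. \<integral>\<^sup>+h. f (of_real c * g + of_real s * h, of_real c * h - of_real s * g) \<partial>complex_normal_law \<partial>complex_normal_law) =
      (\<integral>\<^sup>+g. \<integral>\<^sup>+h. f (g, h) \<partial>complex_normal_law \<partial>complex_normal_law)"
proof -
  let ?N = "normal_law (sqrt (1 / 2))"
  interpret N: prob_space ?N by (rule prob_space_half)
  interpret NN: pair_sigma_finite ?N ?N ..
  interpret C: prob_space complex_normal_law by (rule prob_space_complex_normal_law)
  have split: "(\<integral>\<^sup>+g. \<integral>\<^sup>+h. k (g, h) \<partial>complex_normal_law \<partial>complex_normal_law) =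
      (\<integral>\<^sup>+u1. \<integral>\<^sup>+u2. \<integral>\<^sup>+v1. \<integral>\<^sup>+v2. k (Complex u1 v1, Complex u2 v2) \<partial>?N \<partial>?N \<partial>?N \<partial>?N)"
    if k[measurable]: "k \<in> borel_measurable (borel \<Otimes>\<^sub>M borel)" for k
  proof -
    have "(\<integral>\<^sup>+g. \<integral>\<^sup>+h. k (g, h) \<partial>complex_normal_law \<partial>complex_normal_law) =
      (\<integral>\<^sup>+g. \<integral>\<^sup>+u2. \<integral>\<^sup>+v2. k (g, Complex u2 v2) \<partial>?N \<partial>?N \<partial>complex_normal_law)"
      by (intro nn_integral_cong nn_integral_complex_normal_law) measurable
    also have "\<dots> = (\<integral>\<^sup>+u1. \<integral>\<^sup>+v1. \<integral>\<^sup>+u2. \<integral>\<^sup>+v2. k (Complex u1 v1, Complex u2 v2) \<partial>?N \<partial>?N \<partial>?N \<partial>?N)"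
      by (rule nn_integral_complex_normal_law) measurable
    also have "\<dots> = (\<integral>\<^sup>+u1. \<integral>\<^sup>+u2. \<integral>\<^sup>+v1. \<integral>\<^sup>+v2. k (Complex u1 v1, Complex u2 v2) \<partial>?N \<partial>?N \<partial>?N \<partial>?N)"
      by (intro nn_integral_cong NN.Fubini') measurable
    finally show ?thesis .
  qed
  have \<sigma>: "0 < sqrt (1 / 2)" by simp
  define F where "F = (\<lambda>(a, b). \<integral>\<^sup>+v1. \<integral>\<^sup>+v2. f (Complex a v1, Complex b v2) \<partial>?N \<partial>?N)"
  have F[measurable]: "F \<in> borel_measurable (borel \<Otimes>\<^sub>M borel)" unfolding F_def by measurable
  have "(\<integral>\<^sup>+g. \<integral>\<^sup>+h. f (of_real c * g + of_real s * h, of_real c * h - of_real s * g) \<partial>complex_normal_law \<partial>complex_normal_law) =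
     (\<integral>\<^sup>+u1. \<integral>\<^sup>+u2. \<integral>\<^sup>+v1. \<integral>\<^sup>+v2. (\<lambda>(x, y). f (Complex (c * u1 + s * u2) x, Complex (c * u2 - s * u1) y))
        (c * v1 + s * v2, c * v2 - s * v1) \<partial>?N \<partial>?N \<partial>?N \<partial>?N)"
  proof -
    have e: "of_real c * Complex u1 v1 + of_real s * Complex u2 v2 = Complex (c * u1 + s * u2) (c * v1 + s * v2)"
      "of_real c * Complex u2 v2 - of_real s * Complex u1 v1 = Complex (c * u2 - s * u1) (c * v2 - s * v1)"
      for u1 u2 v1 v2 by (simp_all add: complex_eq_iff)
    show ?thesis
      using split[of "\<lambda>(g, h). f (of_real c * g + of_real s * h, of_real c * h - of_real s * g)"]
      by (simp add: e)
  qed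
  also have "\<dots> = (\<integral>\<^sup>+u1. \<integral>\<^sup>+u2. F (c * u1 + s * u2, c * u2 - s * u1) \<partial>?N \<partial>?N)"
  proof (intro nn_integral_cong)
    fix u1 u2
    have "(\<lambda>(x, y). f (Complex (c * u1 + s * u2) x, Complex (c * u2 - s * u1) y)) \<in> borel_measurable (borel \<Otimes>\<^sub>M borel)"
      by measurable
    from normal_law_rotation[OF cs this \<sigma>]
    show "(\<integral>\<^sup>+v1. \<integral>\<^sup>+v2. (\<lambda>(x, y). f (Complex (c * u1 + s * u2) x, Complex (c * u2 - s * u1) y))
        (c * v1 + s * v2, c * v2 - s * v1) \<partial>?N \<partial>?N) = F (c * u1 + s * u2, c * u2 - s * u1)"
      by (simp add: F_def)
  qed
  also have "\<dots> = (\<integral>\<^sup>+u1. \<integral>\<^sup>+u2. F (u1, u2) \<partial>?N \<partial>?N)"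
    by (rule normal_law_rotation[OF cs F \<sigma>])
  also have "\<dots> = (\<integral>\<^sup>+g. \<integral>\<^sup>+h. f (g, h) \<partial>complex_normal_law \<partial>complex_normal_law)"
    by (subst split) (simp_all add: F_def)
  finally show ?thesis .
qed

lemma nn_integral_arctan: "(\<integral>\<^sup>+t. ennreal (1 / (1 + t\<^sup>2)) \<partial>lborel) = ennreal pi"
proof -
  let ?f = "\<lambda>t::real. ennreal (1 / (1 + t\<^sup>2))"
  have pos: "(\<integral>\<^sup>+t. ?f t * indicator {0..} t \<partial>lborel) = ennreal (pi / 2)"
  proof -
    have "(\<integral>\<^sup>+t. ?f t * indicator {0..} t \<partial>lborel) = ennreal (pi / 2 - arctan 0)"
      by (rule nn_integral_FTC_atLeast)
        (auto intro!: tendsto_arctan_at_top derivative_eq_intros simp: inverse_eq_divide add_pos_nonneg)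
    then show ?thesis by simp
  qed
  have neg: "(\<integral>\<^sup>+t. ?f t * indicator {..<0} t \<partial>lborel) = ennreal (pi / 2)"
  proof -
    have "(\<integral>\<^sup>+t. ?f t * indicator {..<0} t \<partial>lborel) = ennreal \<bar>-1\<bar> * (\<integral>\<^sup>+t. ?f (0 + (-1) * t) * indicator {..<0} (0 + (-1) * t) \<partial>lborel)"
      by (rule nn_integral_real_affine) auto
    \<comment> \<open>Reflection turns the negative half line into the open positive one, which
      differs from \<open>{0..}\<close> by the null set \<open>{0}\<close>.\<close>
    also have "\<dots> = (\<integral>\<^sup>+t. ?f t * indicator {0..} t \<partial>lborel)"
      by (simp, intro nn_integral_cong_AE AE_I[where N="{0}"]) (auto split: split_indicator)
    finally show ?thesis using pos by simp
  qed
  have "(\<integral>\<^sup>+t. ?f t \<partial>lborel) = (\<integral>\<^sup>+t. ?f t * indicator {0..} t + ?f t * indicator {..<0} t \<partial>lborel)"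
    by (intro nn_integral_cong) (auto split: split_indicator)
  also have "\<dots> = ennreal (pi / 2) + ennreal (pi / 2)"
    by (subst nn_integral_add) (simp_all only: pos neg, measurable)
  finally show ?thesis by (simp flip: ennreal_plus)
qed

text \<open>The substitution \<open>v = u t\<close> turns the expectation of the modulus into the integral of
  \<open>1 / (1 + t\<^sup>2)\<close>.\<close>

lemma complex_normal_law_norm:
  "(\<integral>\<^sup>+z. ennreal (norm z) \<partial>complex_normal_law) = ennreal (sqrt pi / 2)"
proof -
  let ?\<sigma> = "sqrt (1 / 2)"
  have nd: "normal_density 0 ?\<sigma> u = 1 / sqrt pi * exp (- u\<^sup>2)" for u
    by (simp add: normal_density_def)
  have "(\<integral>\<^sup>+z. ennreal (norm z) \<partial>complex_normal_law) =
      (\<integral>\<^sup>+u. \<integral>\<^sup>+v. ennreal (sqrt (u\<^sup>2 + v\<^sup>2)) \<partial>normal_law ?\<sigma> \<partial>normal_law ?\<sigma>)"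
    by (simp add: nn_integral_complex_normal_law complex_norm)
  also have "\<dots> = (\<integral>\<^sup>+u. \<integral>\<^sup>+v. ennreal (1 / pi * exp (- u\<^sup>2 - v\<^sup>2) * sqrt (u\<^sup>2 + v\<^sup>2)) \<partial>lborel \<partial>lborel)"
  proof -
    interpret N: prob_space "normal_law ?\<sigma>" by (rule prob_space_half)
    have "(\<integral>\<^sup>+u. \<integral>\<^sup>+v. ennreal (sqrt (u\<^sup>2 + v\<^sup>2)) \<partial>normal_law ?\<sigma> \<partial>normal_law ?\<sigma>) =
       (\<integral>\<^sup>+u. ennreal (normal_density 0 ?\<sigma> u) * (\<integral>\<^sup>+v. ennreal (sqrt (u\<^sup>2 + v\<^sup>2)) \<partial>normal_law ?\<sigma>) \<partial>lborel)"
      by (rule nn_integral_normal_law) measurable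
    also have "\<dots> = (\<integral>\<^sup>+u. \<integral>\<^sup>+v. ennreal (normal_density 0 ?\<sigma> u * (normal_density 0 ?\<sigma> v * sqrt (u\<^sup>2 + v\<^sup>2))) \<partial>lborel \<partial>lborel)"
      by (intro nn_integral_cong) (simp add: nn_integral_normal_law nn_integral_cmult[symmetric] ennreal_mult)
    also have "\<dots> = (\<integral>\<^sup>+u. \<integral>\<^sup>+v. ennreal (1 / pi * exp (- u\<^sup>2 - v\<^sup>2) * sqrt (u\<^sup>2 + v\<^sup>2)) \<partial>lborel \<partial>lborel)"
      unfolding nd by (intro nn_integral_cong arg_cong[of _ _ ennreal]) (simp add: exp_diff exp_minus field_simps)
    finally show ?thesis .
  qed
  also have "\<dots> = (\<integral>\<^sup>+u. \<integral>\<^sup>+t. ennreal (1 / pi * sqrt (1 + t\<^sup>2) * (u\<^sup>2 * exp (- u\<^sup>2 * (1 + t\<^sup>2)))) \<partial>lborel \<partial>lborel)"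
  \<comment> \<open>The substitution v = u t degenerates at u = 0, so the inner integrals are
    compared off this null set.\<close>
  proof (rule nn_integral_cong_AE, rule AE_I[where N="{0}"])
    show "{u \<in> space lborel. \<not> (\<integral>\<^sup>+v. ennreal (1 / pi * exp (- u\<^sup>2 - v\<^sup>2) * sqrt (u\<^sup>2 + v\<^sup>2)) \<partial>lborel) =
        (\<integral>\<^sup>+t. ennreal (1 / pi * sqrt (1 + t\<^sup>2) * (u\<^sup>2 * exp (- u\<^sup>2 * (1 + t\<^sup>2)))) \<partial>lborel)} \<subseteq> {0}"
    proof (clarsimp, rule ccontr)
      fix u :: real
      assume ne: "(\<integral>\<^sup>+v. ennreal (exp (- u\<^sup>2 - v\<^sup>2) * sqrt (u\<^sup>2 + v\<^sup>2) / pi) \<partial>lborel) \<noteq>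
        (\<integral>\<^sup>+t. ennreal (sqrt (1 + t\<^sup>2) * (u\<^sup>2 * exp (- (u\<^sup>2 * (1 + t\<^sup>2)))) / pi) \<partial>lborel)" and u: "u \<noteq> 0"
      have "(\<integral>\<^sup>+v. ennreal (exp (- u\<^sup>2 - v\<^sup>2) * sqrt (u\<^sup>2 + v\<^sup>2) / pi) \<partial>lborel) =
          ennreal \<bar>u\<bar> * (\<integral>\<^sup>+t. ennreal (exp (- u\<^sup>2 - (0 + u * t)\<^sup>2) * sqrt (u\<^sup>2 + (0 + u * t)\<^sup>2) / pi) \<partial>lborel)"
        using u by (intro nn_integral_real_affine) auto
      also have "\<dots> = (\<integral>\<^sup>+t. ennreal (\<bar>u\<bar> * (exp (- u\<^sup>2 - (0 + u * t)\<^sup>2) * sqrt (u\<^sup>2 + (0 + u * t)\<^sup>2) / pi)) \<partial>lborel)"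
        by (simp add: nn_integral_cmult[symmetric] ennreal_mult'[symmetric])
      also have "\<dots> = (\<integral>\<^sup>+t. ennreal (sqrt (1 + t\<^sup>2) * (u\<^sup>2 * exp (- (u\<^sup>2 * (1 + t\<^sup>2)))) / pi) \<partial>lborel)"
      proof (intro nn_integral_cong arg_cong[of _ _ ennreal])
        fix t
        have "u\<^sup>2 + (0 + u * t)\<^sup>2 = u\<^sup>2 * (1 + t\<^sup>2)" by (simp add: power_mult_distrib algebra_simps)
        then have "sqrt (u\<^sup>2 + (0 + u * t)\<^sup>2) = \<bar>u\<bar> * sqrt (1 + t\<^sup>2)" by (simp add: real_sqrt_mult)
        moreover have "- u\<^sup>2 - (0 + u * t)\<^sup>2 = - (u\<^sup>2 * (1 + t\<^sup>2))" by (simp add: power_mult_distrib algebra_simps)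
        moreover have "\<bar>u\<bar> * \<bar>u\<bar> = u\<^sup>2" by (simp add: power2_eq_square)
        ultimately show "\<bar>u\<bar> * (exp (- u\<^sup>2 - (0 + u * t)\<^sup>2) * sqrt (u\<^sup>2 + (0 + u * t)\<^sup>2) / pi) =
            sqrt (1 + t\<^sup>2) * (u\<^sup>2 * exp (- (u\<^sup>2 * (1 + t\<^sup>2)))) / pi"
          by (simp add: mult_ac)
      qed
      finally show False using ne by simp
    qed
  qed simp_all
  also have "\<dots> = (\<integral>\<^sup>+t. \<integral>\<^sup>+u. ennreal (1 / pi * sqrt (1 + t\<^sup>2) * (u\<^sup>2 * exp (- u\<^sup>2 * (1 + t\<^sup>2)))) \<partial>lborel \<partial>lborel)"
    by (rule lborel_pair.Fubini') measurable
  also have "\<dots> = (\<integral>\<^sup>+t. ennreal (1 / (2 * sqrt pi)) * ennreal (1 / (1 + t\<^sup>2)) \<partial>lborel)"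
  proof (rule nn_integral_cong)
    fix t :: real
    define q where "q = sqrt (1 + t\<^sup>2)"
    have q: "0 < q" "q\<^sup>2 = 1 + t\<^sup>2" by (auto simp: q_def add_pos_nonneg)
    \<comment> \<open>The exponential in \<open>u\<close> is, up to normalisation, the density of a
      centred Gaussian of variance 1 / (2 (1 + t^2)). The normalising constant absorbs
      \<open>sqrt (1 + t\<^sup>2)\<close>, and the second moment leaves a multiple of 1 / (1 +
      t^2).\<close>
    define \<tau> where "\<tau> = 1 / (sqrt 2 * q)"
    have \<tau>: "0 < \<tau>" "\<tau>\<^sup>2 = 1 / (2 * q\<^sup>2)" using q by (auto simp: \<tau>_def power_divide power_mult_distrib)
    have nd: "normal_density 0 \<tau> u = q / sqrt pi * exp (- u\<^sup>2 * (1 + t\<^sup>2))" for u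
      using q(1) unfolding normal_density_def \<tau>(2) q(2)[symmetric] by (simp add: real_sqrt_divide)
    have "(\<integral>\<^sup>+u. ennreal (1 / pi * sqrt (1 + t\<^sup>2) * (u\<^sup>2 * exp (- u\<^sup>2 * (1 + t\<^sup>2)))) \<partial>lborel) =
        (\<integral>\<^sup>+u. ennreal (1 / sqrt pi) * (ennreal (normal_density 0 \<tau> u) * ennreal (u\<^sup>2)) \<partial>lborel)"
    proof (rule nn_integral_cong)
      fix u :: real
      have "1 / pi * sqrt (1 + t\<^sup>2) * (u\<^sup>2 * exp (- u\<^sup>2 * (1 + t\<^sup>2))) = 1 / sqrt pi * (normal_density 0 \<tau> u * u\<^sup>2)"
        unfolding nd q_def[symmetric] by simp
      then show "ennreal (1 / pi * sqrt (1 + t\<^sup>2) * (u\<^sup>2 * exp (- u\<^sup>2 * (1 + t\<^sup>2)))) =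
          ennreal (1 / sqrt pi) * (ennreal (normal_density 0 \<tau> u) * ennreal (u\<^sup>2))"
        by (simp only: ennreal_mult normal_density_nonneg zero_le_power2 mult_nonneg_nonneg
            zero_le_divide_1_iff real_sqrt_ge_0_iff pi_ge_zero)
    qed
    also have "\<dots> = ennreal (1 / sqrt pi) * (\<integral>\<^sup>+u. ennreal (u\<^sup>2) \<partial>normal_law \<tau>)"
      by (simp add: nn_integral_cmult nn_integral_normal_law)
    also have "\<dots> = ennreal (1 / sqrt pi) * ennreal (\<tau>\<^sup>2)" using \<tau> by (simp add: normal_law_square)
    also have "\<dots> = ennreal (1 / (2 * sqrt pi)) * ennreal (1 / (1 + t\<^sup>2))"
      unfolding \<tau>(2) q(2) by (simp add: ennreal_mult[symmetric] add_nonneg_nonneg)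
    finally show "(\<integral>\<^sup>+u. ennreal (1 / pi * sqrt (1 + t\<^sup>2) * (u\<^sup>2 * exp (- u\<^sup>2 * (1 + t\<^sup>2)))) \<partial>lborel) =
        ennreal (1 / (2 * sqrt pi)) * ennreal (1 / (1 + t\<^sup>2))" .
  qed
  also have "\<dots> = ennreal (1 / (2 * sqrt pi)) * ennreal pi"
    by (simp add: nn_integral_cmult nn_integral_arctan)
  also have "\<dots> = ennreal (sqrt pi / 2)"
  proof -
    have "1 / (2 * sqrt pi) * pi = sqrt pi / 2"
      by (simp add: real_div_sqrt field_simps)
    then show ?thesis by (simp add: ennreal_mult[symmetric])
  qed
  finally show ?thesis .
qed

section \<open>The two instances of the abstract setting\<close>

lemma conj_field_real: "conj_field (\<lambda>x::real. x)"
  by unfold_locales (simp_all add: power2_eq_square)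

lemma conj_field_complex: "conj_field cnj"
  by unfold_locales (simp_all add: complex_norm_square[symmetric])

lemma gaussian_field_real: "gaussian_field (\<lambda>x::real. x) (normal_law 1) (sqrt (2 / pi))"
proof (intro gaussian_field.intro gaussian_field_axioms.intro conj_field_real)
  show "prob_space (normal_law 1)" by (rule prob_space_normal_law) simp
  show "(\<integral>\<^sup>+g. f (c * g) \<partial>normal_law 1) = (\<integral>\<^sup>+g. f g \<partial>normal_law 1)"
    if c: "norm c = 1" and [measurable]: "f \<in> borel_measurable borel" for c :: real and f
  proof -
    have c': "\<bar>c\<bar> = 1" "c \<noteq> 0" using c by auto
    have "c\<^sup>2 = 1" using c' by (simp add: abs_square_eq_1)
    then have d: "normal_density 0 1 (c * g) = normal_density 0 1 g" for g
      by (simp add: normal_density_def power_mult_distrib)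
    have "(\<integral>\<^sup>+g. f g \<partial>normal_law 1) = (\<integral>\<^sup>+g. ennreal (normal_density 0 1 g) * f g \<partial>lborel)"
      by (rule nn_integral_normal_law) measurable
    also have "\<dots> = \<bar>c\<bar> * (\<integral>\<^sup>+g. ennreal (normal_density 0 1 (0 + c * g)) * f (0 + c * g) \<partial>lborel)"
      by (rule nn_integral_real_affine[OF _ c'(2)]) measurable
    also have "\<dots> = (\<integral>\<^sup>+g. f (c * g) \<partial>normal_law 1)"
      using c' by (simp add: d nn_integral_normal_law)
    finally show ?thesis by simp
  qed
  show "(\<integral>\<^sup>+g. \<integral>\<^sup>+h. f (of_real c * g + of_real s * h, of_real c * h - of_real s * g) \<partial>normal_law 1 \<partial>normal_law 1) =
      (\<integral>\<^sup>+g. \<integral>\<^sup>+h. f (g, h) \<partial>normal_law 1 \<partial>normal_law 1)"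
    if "c\<^sup>2 + s\<^sup>2 = 1" "f \<in> borel_measurable (borel \<Otimes>\<^sub>M borel)" for c s f
    using normal_law_rotation[OF that] by simp
  show "(\<integral>\<^sup>+g. ennreal (exp (t * (norm g)\<^sup>2)) \<partial>normal_law 1) \<le> ennreal (exp (t + 4 * t\<^sup>2))"
    if "0 \<le> t" "t \<le> 1 / 4" for t
    using normal_law_exp_square[of 1 t] mgf_bounds(1)[OF that] that by (simp add: ennreal_leI)
  show "(\<integral>\<^sup>+g. ennreal (norm g ^ 4) \<partial>normal_law 1) \<le> 3"
    using normal_law_fourth[of 1] by simp
  show "(\<integral>\<^sup>+g. ennreal (norm g) \<partial>normal_law 1) = ennreal (sqrt (2 / pi))"
    using normal_law_abs[of 1] by simp
  show "(\<integral>\<^sup>+g. ennreal ((norm g)\<^sup>2) \<partial>normal_law 1) = 1"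
    using normal_law_square[of 1] by simp
  show "(sqrt (2 / pi))\<^sup>2 < 1" using pi_gt3 by simp
qed simp_all

lemma gaussian_field_complex: "gaussian_field cnj complex_normal_law (sqrt pi / 2)"
proof (intro gaussian_field.intro gaussian_field_axioms.intro conj_field_complex)
  let ?\<sigma> = "sqrt (1 / 2)"
  interpret N: prob_space "normal_law ?\<sigma>" by (rule prob_space_half)
  show "prob_space complex_normal_law" by (rule prob_space_complex_normal_law)
  show "(\<integral>\<^sup>+g. ennreal (exp (t * (norm g)\<^sup>2)) \<partial>complex_normal_law) \<le> ennreal (exp (t + 4 * t\<^sup>2))"
    if t: "0 \<le> t" "t \<le> 1 / 4" for t
  proof -
    have "(\<integral>\<^sup>+g. ennreal (exp (t * (norm g)\<^sup>2)) \<partial>complex_normal_law) =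
        (\<integral>\<^sup>+u. \<integral>\<^sup>+v. ennreal (exp (t * u\<^sup>2)) * ennreal (exp (t * v\<^sup>2)) \<partial>normal_law ?\<sigma> \<partial>normal_law ?\<sigma>)"
      by (simp add: nn_integral_complex_normal_law cmod_power2 ennreal_mult[symmetric] exp_add[symmetric] distrib_left)
    also have "\<dots> = ennreal (1 / sqrt (1 - t)) * ennreal (1 / sqrt (1 - t))"
      using normal_law_exp_square[of ?\<sigma> t] t by (simp add: nn_integral_cmult nn_integral_multc)
    also have "\<dots> = ennreal (1 / (1 - t))"
      using t by (simp add: ennreal_mult[symmetric])
    also have "\<dots> \<le> ennreal (exp (t + 4 * t\<^sup>2))"
      by (intro ennreal_leI mgf_bounds(2) t)
    finally show ?thesis .
  qed
  have \<sigma>4: "?\<sigma> ^ 4 = 1 / 4" by (simp add: power4_eq_xxxx)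
  show "(\<integral>\<^sup>+g. ennreal (norm g ^ 4) \<partial>complex_normal_law) \<le> 3"
  proof -
    have "(\<integral>\<^sup>+g. ennreal (norm g ^ 4) \<partial>complex_normal_law) =
        (\<integral>\<^sup>+u. \<integral>\<^sup>+v. ennreal ((u\<^sup>2 + v\<^sup>2)\<^sup>2) \<partial>normal_law ?\<sigma> \<partial>normal_law ?\<sigma>)"
    proof -
      have "norm (Complex u v) ^ 4 = (u\<^sup>2 + v\<^sup>2)\<^sup>2" for u v
      proof -
        have "norm (Complex u v) ^ 4 = ((norm (Complex u v))\<^sup>2)\<^sup>2" by simp
        also have "\<dots> = (u\<^sup>2 + v\<^sup>2)\<^sup>2" by (simp only: cmod_power2 complex.sel)
        finally show ?thesis .
      qed
      then show ?thesis by (simp add: nn_integral_complex_normal_law)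
    qed
    \<comment> \<open>Splitting the square avoids the mixed moment and still meets the bound 3: each
      real fourth moment is 3/4.\<close>
    also have "\<dots> \<le> (\<integral>\<^sup>+u. \<integral>\<^sup>+v. ennreal (2 * u^4) + ennreal (2 * v^4) \<partial>normal_law ?\<sigma> \<partial>normal_law ?\<sigma>)"
    proof (intro nn_integral_mono)
      fix u v :: real
      have "(u\<^sup>2 + v\<^sup>2)\<^sup>2 \<le> 2 * u^4 + 2 * v^4"
        using sum_squares_bound[of "u\<^sup>2" "v\<^sup>2"] by (simp add: power2_sum)
      then show "ennreal ((u\<^sup>2 + v\<^sup>2)\<^sup>2) \<le> ennreal (2 * u^4) + ennreal (2 * v^4)"
        by (simp add: ennreal_leI flip: ennreal_plus)
    qed
    also have "\<dots> = 2 * ennreal (3 * ?\<sigma>^4) + 2 * ennreal (3 * ?\<sigma>^4)"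
      by (simp add: nn_integral_add nn_integral_cmult ennreal_mult' normal_law_fourth N.emeasure_space_1 del: real_sqrt_divide)
    also have "\<dots> = ennreal 3"
      unfolding \<sigma>4 by (simp add: ennreal_mult'[symmetric] flip: ennreal_plus ennreal_numeral)
    finally show ?thesis by simp
  qed
  show "(\<integral>\<^sup>+g. ennreal ((norm g)\<^sup>2) \<partial>complex_normal_law) = 1"
  proof -
    have "(\<integral>\<^sup>+g. ennreal ((norm g)\<^sup>2) \<partial>complex_normal_law) =
        (\<integral>\<^sup>+u. \<integral>\<^sup>+v. ennreal (u\<^sup>2) + ennreal (v\<^sup>2) \<partial>normal_law ?\<sigma> \<partial>normal_law ?\<sigma>)"
      by (simp add: nn_integral_complex_normal_law cmod_power2)
    also have "\<dots> = ennreal (?\<sigma>\<^sup>2) + ennreal (?\<sigma>\<^sup>2)"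
      by (simp add: nn_integral_add normal_law_square N.emeasure_space_1)
    also have "\<dots> = ennreal (?\<sigma>\<^sup>2 + ?\<sigma>\<^sup>2)" by (rule ennreal_plus[symmetric]) simp_all
    also have "?\<sigma>\<^sup>2 + ?\<sigma>\<^sup>2 = 1" by simp
    finally show ?thesis by simp
  qed
  show "(sqrt pi / 2)\<^sup>2 < 1" using pi_less_4 by (simp add: power_divide)
qed (simp_all add: complex_phase_invariance complex_rotation_invariance complex_normal_law_norm)

text \<open>The law is built from a vector of real parts and a vector of imaginary parts, whereas
  the argument works with independent complex entries. Both measures are determined by boxes, where
  the pairing factors over the coordinates.\<close>

lemma std_gaussian_complex_eq: "std_gaussian_complex d = PiM {..<d} (\<lambda>_. complex_normal_law)"
proof -
  let ?N = "normal_law (sqrt (1 / 2))"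
  let ?V = "PiM {..<d} (\<lambda>_. ?N)"
  let ?c = "\<lambda>(u, v). \<lambda>j\<in>{..<d}. Complex (u j) (v j)"
  interpret N: prob_space ?N by (rule prob_space_half)
  interpret C: prob_space complex_normal_law by (rule prob_space_complex_normal_law)
  interpret V: prob_space ?V by (rule prob_space_PiM) (rule prob_space_half)
  interpret P: product_prob_space "\<lambda>_. ?N" "{..<d}" ..
  interpret PC: product_prob_space "\<lambda>_. complex_normal_law" "{..<d}" ..
  have gv: "gaussian_vector (sqrt (1 / 2)) d = ?V"
    by (simp add: gaussian_vector_def normal_law_def)
  have cm: "?c \<in> ?V \<Otimes>\<^sub>M ?V \<rightarrow>\<^sub>M PiM {..<d} (\<lambda>_. borel)"
    unfolding split_beta' by measurable
  have "distr (?V \<Otimes>\<^sub>M ?V) (PiM {..<d} (\<lambda>_. borel)) ?c = PiM {..<d} (\<lambda>_. complex_normal_law)"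
  proof (rule PC.PiM_eqI)
    show "sets (distr (?V \<Otimes>\<^sub>M ?V) (PiM {..<d} (\<lambda>_. borel)) ?c) = sets (PiM {..<d} (\<lambda>_. complex_normal_law))"
      by (simp cong: sets_PiM_cong)
  next
    fix A assume A: "\<And>j. j \<in> {..<d} \<Longrightarrow> A j \<in> sets complex_normal_law"
    then have [measurable]: "\<And>j. j \<in> {..<d} \<Longrightarrow> A j \<in> sets borel" by simp
    have box: "PiE {..<d} A \<in> sets (PiM {..<d} (\<lambda>_. borel))" by (intro sets_PiM_I_finite) auto
    have "emeasure (distr (?V \<Otimes>\<^sub>M ?V) (PiM {..<d} (\<lambda>_. borel)) ?c) (PiE {..<d} A) =
        (\<integral>\<^sup>+p. indicator (PiE {..<d} A) p \<partial>distr (?V \<Otimes>\<^sub>M ?V) (PiM {..<d} (\<lambda>_. borel)) ?c)"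
      using box by simp
    also have "\<dots> = (\<integral>\<^sup>+p. indicator (PiE {..<d} A) (?c p) \<partial>(?V \<Otimes>\<^sub>M ?V))"
      by (rule nn_integral_distr[OF cm]) (use box in simp)
    also have "\<dots> = (\<integral>\<^sup>+u. \<integral>\<^sup>+v. indicator (PiE {..<d} A) (?c (u, v)) \<partial>?V \<partial>?V)"
      by (rule V.nn_integral_fst[symmetric]) (use box cm in measurable)
    also have "\<dots> = (\<integral>\<^sup>+u. \<integral>\<^sup>+v. (\<Prod>j<d. indicator (A j) (Complex (u j) (v j))) \<partial>?V \<partial>?V)"
    proof (intro nn_integral_cong)
      fix u v :: "nat \<Rightarrow> real"
      show "indicator (PiE {..<d} A) (?c (u, v)) = (\<Prod>j<d. indicator (A j) (Complex (u j) (v j)) :: ennreal)"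
        by (auto simp: indicator_def prod_zero_iff PiE_iff)
    qed
    also have "\<dots> = (\<integral>\<^sup>+u. (\<Prod>j<d. \<integral>\<^sup>+v. indicator (A j) (Complex (u j) v) \<partial>?N) \<partial>?V)"
      by (intro nn_integral_cong P.product_nn_integral_prod) auto
    also have "\<dots> = (\<Prod>j<d. \<integral>\<^sup>+u. \<integral>\<^sup>+v. indicator (A j) (Complex u v) \<partial>?N \<partial>?N)"
      by (rule P.product_nn_integral_prod) auto
    also have "\<dots> = (\<Prod>j<d. \<integral>\<^sup>+z. indicator (A j) z \<partial>complex_normal_law)"
      by (intro prod.cong refl nn_integral_complex_normal_law[symmetric]) auto
    also have "\<dots> = (\<Prod>j<d. emeasure complex_normal_law (A j))"
      using A by (intro prod.cong refl nn_integral_indicator) auto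
    finally show "emeasure (distr (?V \<Otimes>\<^sub>M ?V) (PiM {..<d} (\<lambda>_. borel)) ?c) (PiE {..<d} A) =
        (\<Prod>j\<in>{..<d}. emeasure complex_normal_law (A j))" .
  qed simp
  then show ?thesis by (simp add: std_gaussian_complex_def gv)
qed

theorem theorem4p1:
  "\<exists>C>0::real. \<exists>c>0::real. \<forall>(m::nat) (d::nat) (\<delta>::real).
     d \<ge> 2 \<longrightarrow> 0 < \<delta> \<longrightarrow> \<delta> < 0.4 \<longrightarrow> real m \<ge> C * ln (1 / \<delta>) * (1 / \<delta>\<^sup>2) * real d \<longrightarrow>
       \<P>(\<omega> in iid_rows m (std_gaussian_real d).
           ereal beta0_real \<le> condition_number (matrix_of m d \<omega>) \<and>
           condition_number (matrix_of m d \<omega>) \<le> ereal (beta0_real + \<delta>))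
         \<ge> 1 - 2 * exp (- c * \<delta>\<^sup>2 * real m) \<and>
       \<P>(\<omega> in iid_rows m (std_gaussian_complex d).
           ereal beta0_complex \<le> condition_number (matrix_of m d \<omega>) \<and>
           condition_number (matrix_of m d \<omega>) \<le> ereal (beta0_complex + \<delta>))
         \<ge> 1 - 2 * exp (- c * \<delta>\<^sup>2 * real m)"
proof -
  have real_rows: "iid_rows m (std_gaussian_real d) = PiM {..<m} (\<lambda>_. PiM {..<d} (\<lambda>_. normal_law 1))" for m d
    by (simp add: iid_rows_def std_gaussian_real_def gaussian_vector_def normal_law_def)
  have complex_rows: "iid_rows m (std_gaussian_complex d) = PiM {..<m} (\<lambda>_. PiM {..<d} (\<lambda>_. complex_normal_law))" for m d
    by (simp add: iid_rows_def std_gaussian_complex_eq)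
  have br: "1 / sqrt (1 - (sqrt (2 / pi))\<^sup>2) = beta0_real"
  proof -
    have "1 - (sqrt (2 / pi))\<^sup>2 = (pi - 2) / pi" by (simp add: field_simps)
    then show ?thesis by (simp add: beta0_real_def real_sqrt_divide)
  qed
  have bc: "1 / sqrt (1 - (sqrt pi / 2)\<^sup>2) = beta0_complex"
  proof -
    have "1 - (sqrt pi / 2)\<^sup>2 = (4 - pi) / 4" by (simp add: power_divide field_simps)
    then have "1 / sqrt (1 - (sqrt pi / 2)\<^sup>2) = sqrt (1 / ((4 - pi) / 4))"
      by (simp only: real_sqrt_divide real_sqrt_one)
    then show ?thesis by (simp add: beta0_complex_def)
  qed
  obtain C1 c1 where 1: "0 < C1" "0 < c1" and R: "\<And>m d \<delta>. 2 \<le> d \<Longrightarrow> 0 < \<delta> \<Longrightarrow> \<delta> < 0.4 \<Longrightarrow>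
      C1 * ln (1 / \<delta>) * (1 / \<delta>\<^sup>2) * real d \<le> real m \<Longrightarrow>
      1 - 2 * exp (- c1 * \<delta>\<^sup>2 * real m) \<le> \<P>(\<omega> in iid_rows m (std_gaussian_real d).
           ereal beta0_real \<le> condition_number (matrix_of m d \<omega>) \<and>
           condition_number (matrix_of m d \<omega>) \<le> ereal (beta0_real + \<delta>))"
    using gaussian_field.condition_number_concentration[OF gaussian_field_real]
    unfolding br real_rows by blast
  obtain C2 c2 where 2: "0 < C2" "0 < c2" and K: "\<And>m d \<delta>. 2 \<le> d \<Longrightarrow> 0 < \<delta> \<Longrightarrow> \<delta> < 0.4 \<Longrightarrow>
      C2 * ln (1 / \<delta>) * (1 / \<delta>\<^sup>2) * real d \<le> real m \<Longrightarrow>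
      1 - 2 * exp (- c2 * \<delta>\<^sup>2 * real m) \<le> \<P>(\<omega> in iid_rows m (std_gaussian_complex d).
           ereal beta0_complex \<le> condition_number (matrix_of m d \<omega>) \<and>
           condition_number (matrix_of m d \<omega>) \<le> ereal (beta0_complex + \<delta>))"
    using gaussian_field.condition_number_concentration[OF gaussian_field_complex]
    unfolding bc complex_rows by blast
  show ?thesis
  \<comment> \<open>A larger \<open>C\<close> strengthens the condition on \<open>m\<close> and a
    smaller \<open>c\<close> weakens the bound, so the maximum and the minimum serve both
    fields.\<close>
  proof (rule exI[of _ "max C1 C2"], rule conjI, use 1 in simp, rule exI[of _ "min c1 c2"],
      rule conjI, use 1 2 in simp, intro allI impI)
    fix m d :: nat and \<delta> :: real
    assume d: "2 \<le> d" and \<delta>: "0 < \<delta>" "\<delta> < 0.4"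
      and m: "max C1 C2 * ln (1 / \<delta>) * (1 / \<delta>\<^sup>2) * real d \<le> real m"
    have C: "C' * ln (1 / \<delta>) * (1 / \<delta>\<^sup>2) * real d \<le> real m" if "C' \<le> max C1 C2" for C'
    proof -
      have "C' * (ln (1 / \<delta>) * (1 / \<delta>\<^sup>2) * real d) \<le> max C1 C2 * (ln (1 / \<delta>) * (1 / \<delta>\<^sup>2) * real d)"
        using \<delta> that by (intro mult_right_mono mult_nonneg_nonneg) (auto simp: ln_div)
      then show ?thesis using m by (simp only: mult.assoc)
    qed
    have c: "1 - 2 * exp (- min c1 c2 * \<delta>\<^sup>2 * real m) \<le> 1 - 2 * exp (- c' * \<delta>\<^sup>2 * real m)" if "min c1 c2 \<le> c'" for c'
      using that by (simp add: mult_right_mono)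
    show "1 - 2 * exp (- min c1 c2 * \<delta>\<^sup>2 * real m) \<le> \<P>(\<omega> in iid_rows m (std_gaussian_real d).
           ereal beta0_real \<le> condition_number (matrix_of m d \<omega>) \<and>
           condition_number (matrix_of m d \<omega>) \<le> ereal (beta0_real + \<delta>)) \<and>
        1 - 2 * exp (- min c1 c2 * \<delta>\<^sup>2 * real m) \<le> \<P>(\<omega> in iid_rows m (std_gaussian_complex d).
           ereal beta0_complex \<le> condition_number (matrix_of m d \<omega>) \<and>
           condition_number (matrix_of m d \<omega>) \<le> ereal (beta0_complex + \<delta>))"
      using order.trans[OF c R[OF d \<delta> C]] order.trans[OF c K[OF d \<delta> C]] by simp
  qed
qed

end
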